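(* Let a universe of irreducible objects with positive integer weights be given, with exactly $m_i$ different kinds of irreducibles of weight $i$ ($i\ge1$), let $M(z)=\sum_{i\ge1}m_iz^i$, and let $\rho<1$ be the radius of convergence of $M$. Suppose $G(z)=M(z)$ satisfies the Flajolet--Soria conditions FS 1, FS 2 and FS 3 stated in the context, with parameters $\theta>0$ and $\lambda\in\mathbb{R}$. Let $\phi>0$; in the multiset case suppose also that $\phi<1/\rho$. Let $l_1\ge l_2\ge\cdots$ be the irreducible component sizes (weights, listed with multiplicity) of a random combinatorial multiset of weight $n$, or of a random combinatorial selection of weight $n$, chosen from the tilted distribution with parameter $\phi$, and define $L_{jn}=l_j/n$, where this sequence is padded out with zeros. Then, in either case, for each $k>0$, as $n\to\infty$ the joint distribution of $(L_{1n},\dots,L_{kn})$ converges weakly to the joint distribution of the first $k$ coordinates of the Poisson--Dirichlet process $\mathrm{PD}(\phi\theta)$.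
   Context: The $m_i$ are non-negative integers. A combinatorial multiset of weight $n$ is a (finite) multisubset of the universe of irreducibles with total weight $n$ (counting multiplicities). A combinatorial selection of weight $n$ is a subset of the universe (no repeated kinds, though distinct kinds of equal weight are permitted) with total weight $n$. The irreducible components of an object are its elements, counted with multiplicity. Tilted distribution with parameter $\phi>0$: an object of weight $n$ is chosen with probability proportional to $\phi^{K}$, where $K$ is its total number of irreducible components, counted with multiplicity. (Only those $n$ for which objects of weight $n$ exist are considered.) Flajolet--Soria conditions: let $G(z)$ be analytic near $z=0$ with power series at $0$ having real non-negative coefficients and finite (positive) radius of convergence $\rho$. For some $\theta>0$ and real $\lambda$: FS 1: $\rho$ is the unique singularity of $G(z)$ on $|z|=\rho$. FS 2: $G(z)$ is analytically continuable to an open domain $\Delta$ consisting of a disc centered at $0$ of radius exceeding $\rho$, but possibly excluding a closed wedge $|\arg(z-\rho)|\le\gamma$ with vertex at $\rho$, for some $0\le\gamma<\pi/2$. FS 3: as $z\to\rho$ in $\Delta$, $$G(z)=\theta\log\frac{1}{1-z/\rho}+\lambda+O\left(\frac{1}{(\log(1-z/\rho))^2}\right).$$ $\mathrm{PD}(\theta)$, $\theta>0$: let $U_1,U_2,\dots$ be i.i.d. uniform on $[0,1]$, $V_i=U_i^{1/\theta}$, and $G_1=1-V_1$, $G_2=V_1(1-V_2)$, $G_3=V_1V_2(1-V_3),\dots$. Then $\mathrm{PD}(\theta)$ is the law of the sequence $X_1\ge X_2\ge\cdots$ obtained by sorting $G_1,G_2,\dots$ into non-increasing order. *)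

theory Defs
  imports "HOL-Probability.Probability" "HOL-Library.Landau_Symbols"
begin

text \<open>Combinatorial objects over a universe \<open>U\<close> of irreducibles with weights \<open>wt\<close>\<close>

definition multisets_of_weight :: "'a set \<Rightarrow> ('a \<Rightarrow> nat) \<Rightarrow> nat \<Rightarrow> 'a multiset set" where
  "multisets_of_weight U wt n = {A. set_mset A \<subseteq> U \<and> (\<Sum>u\<in>#A. wt u) = n}"

definition selections_of_weight :: "'a set \<Rightarrow> ('a \<Rightarrow> nat) \<Rightarrow> nat \<Rightarrow> 'a set set" where
  "selections_of_weight U wt n = {A. finite A \<and> A \<subseteq> U \<and> (\<Sum>u\<in>A. wt u) = n}"

text \<open>
  The tilted distribution on a finite nonempty set \<open>Obj\<close> of objects, where \<open>K\<close> counts the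
  irreducible components of an object. For empty \<open>Obj\<close> this is the null measure.
\<close>

definition tilted :: "'o set \<Rightarrow> ('o \<Rightarrow> nat) \<Rightarrow> real \<Rightarrow> 'o measure" where
  "tilted Obj K \<phi> = point_measure Obj (\<lambda>A. ennreal (\<phi> ^ K A / (\<Sum>B\<in>Obj. \<phi> ^ K B)))"

text \<open>Indices are 0-based: \<open>nth_largest S 0\<close> is the largest element of \<open>S\<close>.\<close>

definition nth_largest :: "nat multiset \<Rightarrow> nat \<Rightarrow> nat" where
  "nth_largest S j =
     (let l = rev (sorted_list_of_multiset S) in if j < length l then l ! j else 0)"

definition scaled_sizes :: "nat \<Rightarrow> nat \<Rightarrow> nat multiset \<Rightarrow> nat \<Rightarrow> real" where
  "scaled_sizes k n S = (\<lambda>j\<in>{..<k}. real (nth_largest S j) / real n)"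

text \<open>
  \<open>\<real>\<^sup>k\<close> is represented by the extensional functions on \<open>{..<k}\<close>, with the product
  topology and the product Borel \<open>\<sigma>\<close>-algebra.
\<close>

abbreviation R_top :: "nat \<Rightarrow> (nat \<Rightarrow> real) topology" where
  "R_top k \<equiv> product_topology (\<lambda>_. euclideanreal) {..<k}"

abbreviation R_borel :: "nat \<Rightarrow> (nat \<Rightarrow> real) measure" where
  "R_borel k \<equiv> PiM {..<k} (\<lambda>_. borel)"

definition multiset_sizes_law ::
  "'a set \<Rightarrow> ('a \<Rightarrow> nat) \<Rightarrow> real \<Rightarrow> nat \<Rightarrow> nat \<Rightarrow> (nat \<Rightarrow> real) measure" where
  "multiset_sizes_law U wt \<phi> k n =
     distr (tilted (multisets_of_weight U wt n) size \<phi>) (R_borel k)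
       (\<lambda>A. scaled_sizes k n (image_mset wt A))"

definition selection_sizes_law ::
  "'a set \<Rightarrow> ('a \<Rightarrow> nat) \<Rightarrow> real \<Rightarrow> nat \<Rightarrow> nat \<Rightarrow> (nat \<Rightarrow> real) measure" where
  "selection_sizes_law U wt \<phi> k n =
     distr (tilted (selections_of_weight U wt n) card \<phi>) (R_borel k)
       (\<lambda>A. scaled_sizes k n (image_mset wt (mset_set A)))"

definition weakly_converges ::
  "'b topology \<Rightarrow> ('i \<Rightarrow> 'b measure) \<Rightarrow> 'b measure \<Rightarrow> 'i filter \<Rightarrow> bool" where
  "weakly_converges X \<mu> \<nu> F \<longleftrightarrow>
     (\<forall>f. continuous_map X euclideanreal f \<and> bounded (f ` topspace X) \<longrightarrow>
        ((\<lambda>i. \<integral>x. f x \<partial>\<mu> i) \<longlongrightarrow> (\<integral>x. f x \<partial>\<nu>)) F)"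

text \<open>The filter "\<open>n\<close> tends to infinity through those \<open>n\<close> with \<open>P n\<close>"\<close>

abbreviation at_infinity_along :: "(nat \<Rightarrow> bool) \<Rightarrow> nat filter" where
  "at_infinity_along P \<equiv> inf sequentially (principal {n. P n})"

text \<open>The Poisson--Dirichlet distribution\<close>

definition stick_breaking :: "(nat \<Rightarrow> real) \<Rightarrow> nat \<Rightarrow> real" where
  "stick_breaking v i = (\<Prod>j<i. v j) * (1 - v i)"

text \<open>
  The non-increasing rearrangement of a sequence is unique if it exists. It exists for every
  sequence of positive numbers that tends to 0, hence almost surely where it is used below;
  the sequences without one are all sent to the same unspecified value, which
  keeps \<open>sort_decreasing\<close> measurable.
\<close>

definition sort_decreasing :: "(nat \<Rightarrow> real) \<Rightarrow> nat \<Rightarrow> real" where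
  "sort_decreasing g = (THE x. decseq x \<and> (\<exists>p. bij p \<and> x = g \<circ> p))"

definition PD :: "real \<Rightarrow> (nat \<Rightarrow> real) measure" where
  "PD \<theta> = distr (PiM UNIV (\<lambda>_. uniform_measure lborel {0..1})) (PiM UNIV (\<lambda>_. borel))
     (\<lambda>u. sort_decreasing (stick_breaking (\<lambda>i. u i powr (1 / \<theta>))))"

definition PD_first :: "nat \<Rightarrow> real \<Rightarrow> (nat \<Rightarrow> real) measure" where
  "PD_first k \<theta> = distr (PD \<theta>) (R_borel k) (\<lambda>x. restrict x {..<k})"

text \<open>The Flajolet--Soria conditions, for a function given by its power series at 0\<close>

text \<open>
  A point of the circle of convergence is a singularity if the sum of the series has no analytic
  continuation to a neighbourhood of it.
\<close>

definition singular_point :: "complex fps \<Rightarrow> complex \<Rightarrow> bool" where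
  "singular_point G z \<longleftrightarrow>
     \<not> (\<exists>e>0. \<exists>h. h holomorphic_on ball z e \<and>
          (\<forall>w\<in>ball z e. ereal (norm w) < fps_conv_radius G \<longrightarrow> h w = eval_fps G w))"

text \<open>Since \<open>Arg 0 = 0\<close>, the vertex belongs to the wedge.\<close>

definition wedge :: "real \<Rightarrow> real \<Rightarrow> complex set" where
  "wedge \<rho> \<gamma> = {z. \<bar>Arg (z - of_real \<rho>)\<bar> \<le> \<gamma>}"

definition FS1 :: "complex fps \<Rightarrow> real \<Rightarrow> bool" where
  "FS1 G \<rho> \<longleftrightarrow> (\<forall>z. norm z = \<rho> \<longrightarrow> (singular_point G z \<longleftrightarrow> z = of_real \<rho>))"

text \<open>\<open>H\<close> is the analytic continuation of the sum of \<open>G\<close> to the domain \<open>D\<close>.\<close>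

definition FS2 :: "complex fps \<Rightarrow> real \<Rightarrow> complex set \<Rightarrow> (complex \<Rightarrow> complex) \<Rightarrow> bool" where
  "FS2 G \<rho> D H \<longleftrightarrow>
     (\<exists>R>\<rho>. \<exists>\<gamma>. 0 \<le> \<gamma> \<and> \<gamma> < pi / 2 \<and> (D = ball 0 R \<or> D = ball 0 R - wedge \<rho> \<gamma>)) \<and>
     H holomorphic_on D \<and> (\<forall>z\<in>ball 0 \<rho>. H z = eval_fps G z)"

definition FS3 ::
  "real \<Rightarrow> real \<Rightarrow> real \<Rightarrow> complex set \<Rightarrow> (complex \<Rightarrow> complex) \<Rightarrow> bool" where
  "FS3 \<rho> \<theta> c D H \<longleftrightarrow>
     (\<lambda>z. H z - (of_real \<theta> * Ln (1 / (1 - z / of_real \<rho>)) + of_real c))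
       \<in> O[at (of_real \<rho>) within D](\<lambda>z. 1 / (Ln (1 - z / of_real \<rho>))\<^sup>2)"

definition flajolet_soria :: "complex fps \<Rightarrow> real \<Rightarrow> real \<Rightarrow> real \<Rightarrow> bool" where
  "flajolet_soria G \<rho> \<theta> c \<longleftrightarrow>
     (\<forall>i. fps_nth G i \<in> \<real>\<^sub>\<ge>\<^sub>0) \<and> 0 < \<rho> \<and> fps_conv_radius G = ereal \<rho> \<and> 0 < \<theta> \<and>
     FS1 G \<rho> \<and> (\<exists>D H. FS2 G \<rho> D H \<and> FS3 \<rho> \<theta> c D H)"

definition irreducibles_fps :: "(nat \<Rightarrow> nat) \<Rightarrow> complex fps" where
  "irreducibles_fps m = Abs_fps (\<lambda>i. if i = 0 then 0 else of_nat (m i))"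

end

theory Submission
  imports Defs "HOL-Complex_Analysis.Complex_Analysis" "HOL-Combinatorics.Permutations"
    "HOL-Real_Asymp.Real_Asymp"
begin

text \<open>
  Both kinds of objects are picked apart by repeatedly removing an irreducible component chosen
  with probability proportional to its weight. With \<open>p\<^sub>n\<close> the sum of \<open>\<phi>\<^sup>K\<close> over the objects of weight
  \<open>n\<close>, the removed component has weight \<open>j\<close> with probability about \<open>\<phi> j m\<^sub>j p\<^sub>n\<^sub>-\<^sub>j / (n p\<^sub>n)\<close>. Singularity analysis
  gives \<open>j m\<^sub>j \<rho>\<^sup>j \<longlonglongrightarrow> \<theta>\<close> and \<open>p\<^sub>n \<rho>\<^sup>n \<sim> C n\<^sup>a\<^sup>-\<^sup>1\<close> with \<open>a = \<phi>\<theta>\<close>, so \<open>j / n\<close> has asymptotically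
  the density \<open>a (1 - x)\<^sup>a\<^sup>-\<^sup>1\<close>, which is the law of the first stick in the stick-breaking
  construction. Iterating, the expectations of a symmetric Lipschitz function of the component sizes
  and of the stick-breaking sequence satisfy approximately the same recursion. As every step
  shrinks the remaining weight by a constant factor on average, the two expectations agree in the limit.
\<close>

section \<open>A transfer theorem on slit discs\<close>

text \<open>Repeated kinds are the obstacle to an exact size-biased recursion. The defect for a
  function bounded by B is at most B times the defect for the constant 1, and the latter is
  controlled by the asymptotics of \<open>p\<close> alone; multisets and selections then differ only
  in a sign. The exponent \<phi>\<theta> arises from the factor exp (\<phi> M(z)) of the generating
  function. The other terms of its logarithm involve M(z^k) with k \<ge> 2 and converge beyond
  \<rho>, since \<rho> < 1 puts the square root of \<rho> to the right of \<rho>. For multisets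
  \<phi> < 1/\<rho> keeps 1 / (1 - \<phi> z) analytic there; for selections the factors 1 + \<phi>
  z^j of small weight, whose logarithms may be singular inside the disc, are split off as a
  polynomial. Test functions are symmetric because components are not removed in order of size, and
  Lipschitz because stick lengths get rounded to integers. Their class has to be closed under
  prepending a component: after a removal the function acts on the remainder with the removed
  component in front.\<close>

definition slit_disc :: "real \<Rightarrow> real \<Rightarrow> real \<Rightarrow> complex set" where
  "slit_disc \<rho> \<kappa> R = {z. norm z < R \<and> Re (z - of_real \<rho>) < \<kappa> * norm (z - of_real \<rho>)}"

text \<open>The real part of w is |w| cos (Arg w) and cos decreases on [0, pi], so the wedge is a
  cone inequality with \<kappa> = cos \<gamma>. This form makes openness immediate; \<gamma> < pi/2
  becomes \<kappa> > 0, and \<kappa> = 1 removes just the ray to the right of \<rho>.\<close>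

lemma ball_minus_wedge_eq_slit_disc:
  assumes "0 \<le> \<gamma>" "\<gamma> < pi / 2"
  shows "ball 0 R - wedge \<rho> \<gamma> = slit_disc \<rho> (cos \<gamma>) R"
proof -
  have "\<bar>Arg w\<bar> \<le> \<gamma> \<longleftrightarrow> cos \<gamma> * norm w \<le> Re w" for w :: complex
  proof (cases "w = 0")
    case False
    have Arg: "\<bar>Arg w\<bar> \<le> pi"
      using mpi_less_Arg[of w] Arg_le_pi[of w] by linarith
    have "Re w = norm w * cos \<bar>Arg w\<bar>"
      using rcis_cmod_Arg[of w] by (metis Re_rcis cos_abs_real)
    then have "cos \<gamma> * norm w \<le> Re w \<longleftrightarrow> cos \<gamma> \<le> cos \<bar>Arg w\<bar>"
      using False by (simp add: mult.commute)
    also have "\<dots> \<longleftrightarrow> \<bar>Arg w\<bar> \<le> \<gamma>"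
      using Arg assms by (subst cos_mono_le_eq) auto
    finally show ?thesis by simp
  qed (use assms in \<open>simp add: Arg_zero\<close>)
  then show ?thesis
    by (auto simp: wedge_def slit_disc_def not_le)
qed

lemma open_slit_disc: "open (slit_disc \<rho> \<kappa> R)"
proof -
  have "slit_disc \<rho> \<kappa> R = {z. norm z < R} \<inter> {z. Re (z - of_real \<rho>) < \<kappa> * norm (z - of_real \<rho>)}"
    by (auto simp: slit_disc_def)
  also have "open \<dots>"
    by (intro open_Int open_Collect_less continuous_intros)
  finally show ?thesis .
qed

lemma slit_disc_mono: "R \<le> R' \<Longrightarrow> slit_disc \<rho> \<kappa> R \<subseteq> slit_disc \<rho> \<kappa> R'"
  by (auto simp: slit_disc_def)

lemma mem_slit_disc_if_norm_le:
  assumes \<rho>: "0 < \<rho>" "\<rho> < R" and \<kappa>: "0 < \<kappa>"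
    and z: "norm z \<le> \<rho>" "z \<noteq> of_real \<rho>"
  shows "z \<in> slit_disc \<rho> \<kappa> R"
proof -
  have "Re z \<le> \<rho>"
    using complex_Re_le_cmod[of z] z by linarith
  moreover have "0 < \<kappa> * norm (z - of_real \<rho>)"
    using z \<kappa> by simp
  ultimately show ?thesis
    using \<rho> z by (auto simp: slit_disc_def)
qed

text \<open>The radius is proportional to the distance from \<rho>: this is the room needed for
  Cauchy estimates at points of the disc that approach the singularity.\<close>

lemma mem_slit_disc_near_vertex:
  assumes \<rho>: "0 < \<rho>" and \<kappa>: "0 < \<kappa>" "\<kappa> \<le> 1"
    and z: "norm z \<le> \<rho>" "z \<noteq> of_real \<rho>" "norm (z - of_real \<rho>) < (R - \<rho>) / 2"
    and w: "norm (w - z) \<le> \<kappa> / 2 * norm (z - of_real \<rho>)"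
  shows "w \<in> slit_disc \<rho> \<kappa> R"
proof -
  define d where "d = norm (z - of_real \<rho>)"
  have d: "d > 0" using z by (simp add: d_def)
  have Re_z: "Re z \<le> \<rho>"
    using complex_Re_le_cmod[of z] z by linarith
  have Re_le: "Re (w - z) \<le> norm (w - z)"
    by (rule complex_Re_le_cmod)
  have "norm (z - of_real \<rho>) \<le> norm (w - z) + norm (w - of_real \<rho>)"
    using norm_triangle_ineq4[of "w - of_real \<rho>" "w - z"] by (simp add: algebra_simps)
  then have far: "d - \<kappa> / 2 * d \<le> norm (w - of_real \<rho>)"
    using w by (simp add: d_def)
  have neq: "Re (w - of_real \<rho>) < \<kappa> * norm (w - of_real \<rho>)"
  proof (cases "Re z < \<rho>")
    case True
    have "Re (w - of_real \<rho>) = Re (w - z) + (Re z - \<rho>)" by simp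
    also have "\<dots> < \<kappa> / 2 * d"
      using Re_le w True by (simp add: d_def)
    \<comment> \<open>Here \<kappa> \<le> 1 enters: it makes \<kappa> (1 - \<kappa>/2) at least
      \<kappa>/2.\<close>
    also have "\<dots> \<le> \<kappa> * (d - \<kappa> / 2 * d)"
    proof -
      have "\<kappa> * d * \<kappa> \<le> \<kappa> * d * 1"
        using \<kappa> d by (intro mult_left_mono) auto
      then show ?thesis by (simp add: algebra_simps)
    qed
    also have "\<dots> \<le> \<kappa> * norm (w - of_real \<rho>)"
      using far \<kappa> by (intro mult_left_mono) auto
    finally show ?thesis .
  next
    case False
    \<comment> \<open>The only point of the closed disc with real part \<rho> is \<rho> itself,
      which is excluded.\<close>
    then have "Re z = \<rho>" using Re_z by simp
    then have "(norm z)\<^sup>2 = \<rho>\<^sup>2 + (Im z)\<^sup>2"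
      by (simp add: cmod_power2)
    moreover have "(norm z)\<^sup>2 \<le> \<rho>\<^sup>2"
      using z by (intro power_mono) auto
    ultimately have "Im z = 0" by simp
    with \<open>Re z = \<rho>\<close> z(2) show ?thesis by (auto simp: complex_eq_iff)
  qed
  have "norm w \<le> norm (w - z) + norm z"
    using norm_triangle_ineq[of "w - z" z] by simp
  also have "\<dots> < R"
  proof -
    have "norm (w - z) \<le> 1 * norm (z - of_real \<rho>)"
      using w \<kappa> by (elim order_trans) (intro mult_right_mono, auto)
    moreover have "norm (z - of_real \<rho>) < (R - \<rho>)"
      using z(3) norm_ge_zero[of "z - of_real \<rho>"] by argo
    ultimately show ?thesis
      using z by linarith
  qed
  finally show ?thesis
    using neq by (simp add: slit_disc_def)
qed

text \<open>Close to \<rho>, Cauchy's inequality on a disc of radius proportional to the distance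
  costs two powers of that distance. The rest of the closed disc is a compact subset of the domain,
  which accounts for C.\<close>

lemma second_deriv_bound_slit_disc:
  fixes f :: "complex \<Rightarrow> complex"
  assumes \<rho>: "0 < \<rho>" "\<rho> < R" and \<kappa>: "0 < \<kappa>" "\<kappa> \<le> 1" and \<alpha>: "0 \<le> \<alpha>"
    and hol: "f holomorphic_on slit_disc \<rho> \<kappa> R"
    and lim: "((\<lambda>z. norm (f z) * norm (of_real \<rho> - z) powr \<alpha>) \<longlongrightarrow> 0)
                (at (of_real \<rho>) within slit_disc \<rho> \<kappa> R)"
    and \<epsilon>: "\<epsilon> > 0"
  obtains C where "C \<ge> 0" "\<And>z. norm z < \<rho> \<Longrightarrow>
      norm ((deriv ^^ 2) f z) \<le> \<epsilon> * norm (of_real \<rho> - z) powr (- \<alpha> - 2) + C"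
proof -
  let ?D = "slit_disc \<rho> \<kappa> R"
  define c where "c = \<kappa> / 2"
  have c: "0 < c" "c < 1" using \<kappa> by (auto simp: c_def)
  \<comment> \<open>Absorbs the losses of the Cauchy estimate: the factor 2! / c^2, and (1 - c) powr
    (- \<alpha>) for points of the small circle that are closer to \<rho> than z.\<close>
  define \<epsilon>' where "\<epsilon>' = \<epsilon> * c\<^sup>2 * (1 - c) powr \<alpha> / 2"
  have \<epsilon>': "\<epsilon>' > 0" using \<epsilon> c by (simp add: \<epsilon>'_def)
  from tendstoD[OF lim \<epsilon>']
  obtain \<delta>0 where \<delta>0: "\<delta>0 > 0"
    "\<And>z. z \<in> ?D \<Longrightarrow> z \<noteq> of_real \<rho> \<Longrightarrow> dist z (of_real \<rho>) < \<delta>0 \<Longrightarrow>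
        norm (f z) * norm (of_real \<rho> - z) powr \<alpha> < \<epsilon>'"
    unfolding eventually_at by (auto simp: dist_norm)
  define \<delta> where "\<delta> = min (\<delta>0 / 2) ((R - \<rho>) / 2)"
  have \<delta>: "\<delta> > 0" "\<delta> \<le> \<delta>0 / 2" "\<delta> \<le> (R - \<rho>) / 2"
    unfolding \<delta>_def using \<delta>0(1) \<rho> by (simp_all only: min_less_iff_conj min.cobounded1 min.cobounded2) auto
  define K where "K = cball 0 \<rho> - ball (of_real \<rho> :: complex) \<delta>"
  have "compact K"
    unfolding K_def by (intro compact_diff) auto
  have "K \<subseteq> ?D"
  proof
    fix z assume z: "z \<in> K"
    with \<delta> have "z \<noteq> of_real \<rho>" "norm z \<le> \<rho>" by (auto simp: K_def)
    then show "z \<in> ?D"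
      using mem_slit_disc_if_norm_le \<rho> \<kappa> by blast
  qed
  have "(deriv ^^ 2) f holomorphic_on ?D"
    by (intro holomorphic_higher_deriv hol open_slit_disc)
  then have "continuous_on K ((deriv ^^ 2) f)"
    using \<open>K \<subseteq> ?D\<close> by (meson holomorphic_on_imp_continuous_on continuous_on_subset)
  then have "bounded ((deriv ^^ 2) f ` K)"
    using \<open>compact K\<close> compact_continuous_image compact_imp_bounded by blast
  then obtain C where C: "\<And>z. z \<in> K \<Longrightarrow> norm ((deriv ^^ 2) f z) \<le> C"
    unfolding bounded_iff by blast
  show ?thesis
  proof (rule that[of "max C 0"])
    fix z :: complex assume z: "norm z < \<rho>"
    have zneq: "z \<noteq> of_real \<rho>" using z \<rho> by auto
    define d where "d = norm (z - of_real \<rho>)"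
    have d: "d > 0" using zneq by (simp add: d_def)
    show "norm ((deriv ^^ 2) f z) \<le> \<epsilon> * norm (of_real \<rho> - z) powr (- \<alpha> - 2) + max C 0"
    proof (cases "d < \<delta>")
      case False
      then have "z \<in> K" using z by (auto simp: K_def d_def dist_norm norm_minus_commute)
      then have "norm ((deriv ^^ 2) f z) \<le> max C 0" using C by force
      moreover have "0 \<le> \<epsilon> * norm (of_real \<rho> - z) powr (- \<alpha> - 2)" using \<epsilon> by simp
      ultimately show ?thesis by linarith
    next
      case True
      have sub: "cball z (c * d) \<subseteq> ?D"
      proof
        fix w assume w: "w \<in> cball z (c * d)"
        have "d < (R - \<rho>) / 2" using True \<delta> by linarith
        moreover have "norm (w - z) \<le> \<kappa> / 2 * norm (z - of_real \<rho>)"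
          using w by (simp add: dist_norm norm_minus_commute c_def d_def)
        ultimately show "w \<in> ?D"
          using z zneq \<rho> \<kappa> by (intro mem_slit_disc_near_vertex[of \<rho> \<kappa> z]) (auto simp: d_def)
      qed
      have "norm ((deriv ^^ 2) f z) \<le> fact 2 * (\<epsilon>' * ((1 - c) * d) powr (-\<alpha>)) / (c * d) ^ 2"
      proof (rule Cauchy_inequality)
        show "f holomorphic_on ball z (c * d)"
          using hol sub by (meson ball_subset_cball holomorphic_on_subset)
        show "continuous_on (cball z (c * d)) f"
          using hol sub by (meson continuous_on_subset holomorphic_on_imp_continuous_on)
        show "0 < c * d" using c d by simp
      next
        fix w assume w: "norm (z - w) = c * d"
        have "norm (z - of_real \<rho>) \<le> norm (z - w) + norm (w - of_real \<rho>)"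
          using norm_triangle_ineq[of "z - w" "w - of_real \<rho>"] by simp
        then have far: "(1 - c) * d \<le> norm (of_real \<rho> - w)"
          using w by (simp add: d_def norm_minus_commute algebra_simps)
        then have pos: "0 < norm (of_real \<rho> - w)"
          using c d by (smt (verit) mult_pos_pos)
        have "norm (w - of_real \<rho>) \<le> norm (w - z) + norm (z - of_real \<rho>)"
          using norm_triangle_ineq[of "w - z" "z - of_real \<rho>"] by simp
        also have "\<dots> = c * d + d" using w by (simp add: d_def norm_minus_commute)
        also have "\<dots> < 2 * d" using c d by simp
        also have "\<dots> \<le> \<delta>0" using True \<delta> by simp
        finally have "dist w (of_real \<rho>) < \<delta>0" by (simp add: dist_norm)
        moreover have "w \<in> ?D" using sub w by (auto simp: dist_norm)
        ultimately have "norm (f w) * norm (of_real \<rho> - w) powr \<alpha> < \<epsilon>'"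
          using \<delta>0(2)[of w] pos by auto
        then have "norm (f w) \<le> \<epsilon>' * norm (of_real \<rho> - w) powr (-\<alpha>)"
          using pos by (simp add: powr_minus field_simps)
        also have "\<dots> \<le> \<epsilon>' * ((1 - c) * d) powr (-\<alpha>)"
          using far c d \<alpha> \<epsilon>' by (intro mult_left_mono powr_mono2') auto
        finally show "norm (f w) \<le> \<epsilon>' * ((1 - c) * d) powr (-\<alpha>)" .
      qed
      also have "\<dots> = \<epsilon> * (d powr (-\<alpha>) / d\<^sup>2)"
        using c d \<open>\<epsilon> > 0\<close> powr_mult[of "1 - c" d "-\<alpha>"] unfolding \<epsilon>'_def
        by (simp add: powr_minus fact_2 power_mult_distrib field_simps del: powr_mult)
      also have "d powr (-\<alpha>) / d\<^sup>2 = d powr (-\<alpha> - 2)"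
        using d by (simp add: powr_diff)
      finally show ?thesis
        by (simp add: d_def norm_minus_commute)
    qed
  qed simp
qed

text \<open>On a circle about 0 the differential is dz = 2 pi i z dt, so dividing a contour integral
  by 2 pi i turns it into a mean over the parameter.\<close>

lemma circlepath_average_has_integral:
  assumes "(F has_contour_integral I) (circlepath 0 r)"
  shows "((\<lambda>t. circlepath 0 r t * F (circlepath 0 r t)) has_integral I / (2 * of_real pi * \<i>)) {0..1}"
proof -
  have "((\<lambda>t. F (circlepath 0 r t) * vector_derivative (circlepath 0 r) (at t)) has_integral I) {0..1}"
    using assms by (simp add: has_contour_integral)
  then have "((\<lambda>t. (1 / (2 * of_real pi * \<i>)) * (F (circlepath 0 r t) * vector_derivative (circlepath 0 r) (at t)))
      has_integral (1 / (2 * of_real pi * \<i>)) * I) {0..1}"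
    by (rule has_integral_mult_right)
  moreover have "vector_derivative (circlepath 0 r) (at t) = 2 * of_real pi * \<i> * circlepath 0 r t" for t
    by (simp add: vector_derivative_circlepath) (simp add: circlepath)
  ultimately show ?thesis
    by (simp add: mult_ac)
qed

text \<open>On |z| = r the conjugate of z is r^2 / z, so 1 / |\<rho> - z|^2 is the rational function
  z g(z) / (z - w) with g(z) = 1 / (\<rho> (\<rho> - z)) and w = r^2 / \<rho> inside the circle.
  Cauchy's formula yields the mean g(w).\<close>

lemma poisson_kernel_has_integral:
  assumes "0 < r" "r < \<rho>"
  shows "((\<lambda>t. 1 / (norm (of_real \<rho> - circlepath 0 r t))\<^sup>2) has_integral 1 / (\<rho>\<^sup>2 - r\<^sup>2)) {0..1}"
proof -
  define w :: complex where "w = of_real (r\<^sup>2 / \<rho>)"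
  let ?g = "\<lambda>z. 1 / (of_real \<rho> * (of_real \<rho> - z)) :: complex"
  have "r\<^sup>2 / \<rho> < r" using assms by (simp add: field_simps power2_eq_square)
  then have w: "w \<in> ball 0 r"
    using assms by (simp add: w_def abs_of_pos del: of_real_divide of_real_power)
  have neq: "of_real \<rho> - z \<noteq> 0" if "norm z \<le> r" for z :: complex
    using that assms by auto
  have "((\<lambda>u. ?g u / (u - w)) has_contour_integral 2 * of_real pi * \<i> * ?g w) (circlepath 0 r)"
  proof (rule Cauchy_integral_circlepath)
    show "continuous_on (cball 0 r) ?g"
      using neq assms by (intro continuous_intros) auto
    show "?g holomorphic_on ball 0 r"
      using neq assms by (intro holomorphic_intros) auto
  qed (use w in auto)
  from circlepath_average_has_integral[OF this]
  have *: "((\<lambda>t. circlepath 0 r t * (?g (circlepath 0 r t) / (circlepath 0 r t - w))) has_integral ?g w) {0..1}"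
    by simp
  have g_w: "?g w = of_real (1 / (\<rho>\<^sup>2 - r\<^sup>2))"
    using assms by (simp add: w_def power2_eq_square right_diff_distrib)
  have eq: "circlepath 0 r t * (?g (circlepath 0 r t) / (circlepath 0 r t - w)) =
      of_real (1 / (norm (of_real \<rho> - circlepath 0 r t))\<^sup>2)" for t
  proof -
    define z where "z = circlepath 0 r t"
    have z: "norm z = r" using assms by (simp add: z_def circlepath norm_mult)
    then have z0: "z \<noteq> 0" using assms by auto
    have zz: "z * cnj z = of_real (r\<^sup>2)"
      by (simp add: z complex_norm_square[symmetric])
    define u v where "u = of_real \<rho> - z" and "v = of_real \<rho> - cnj z"
    have uv: "u \<noteq> 0" "v \<noteq> 0"
      using neq[of z] neq[of "cnj z"] z by (auto simp: u_def v_def)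
    have norm_u: "of_real ((norm u)\<^sup>2) = u * v"
      using complex_norm_square[of u] by (simp add: u_def v_def)
    have "z - w = z * v / of_real \<rho>"
      using zz assms by (simp add: w_def v_def field_simps)
    then have "z * (1 / (of_real \<rho> * u) / (z - w)) = 1 / (u * v)"
      using z0 uv assms by (simp add: field_simps)
    also have "\<dots> = of_real (1 / (norm u)\<^sup>2)"
      using norm_u by simp
    finally show ?thesis
      by (simp add: z_def u_def)
  qed
  show ?thesis
    using has_integral_linear[OF *[unfolded eq g_w] bounded_linear_Re] by (simp only: o_def Re_complex_of_real)
qed

text \<open>In the exponent - \<alpha> - 2, the part - \<alpha> is estimated at the least distance
  \<rho> - r, while the square is averaged exactly as a Poisson kernel. Compared with a pointwise
  bound this gains a factor of order \<rho> - r, the one that the transfer theorem needs.\<close>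

lemma fps_coeff_bound_by_second_deriv:
  fixes f :: "complex \<Rightarrow> complex"
  assumes hol: "f holomorphic_on ball 0 \<rho>" and A: "f has_fps_expansion A"
    and \<alpha>: "0 \<le> \<alpha>" and \<epsilon>: "0 \<le> \<epsilon>" and r: "0 < r" "r < \<rho>"
    and bound: "\<And>z. norm z < \<rho> \<Longrightarrow>
      norm ((deriv ^^ 2) f z) \<le> \<epsilon> * norm (of_real \<rho> - z) powr (- \<alpha> - 2) + C"
  shows "norm (fps_nth A (m + 2)) * (real (m + 2) * real (m + 1)) \<le>
      (\<epsilon> * (\<rho> - r) powr (- \<alpha>) / (\<rho>\<^sup>2 - r\<^sup>2) + C) / r ^ m"
proof -
  let ?g = "(deriv ^^ 2) f" and ?p = "circlepath 0 r"
  have holg: "?g holomorphic_on ball 0 \<rho>"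
    by (intro holomorphic_higher_deriv hol) auto
  have cont: "continuous_on (cball 0 r) ?g"
    using holg r by (intro holomorphic_on_imp_continuous_on) (auto intro: holomorphic_on_subset)
  have p: "norm (?p t) = r" for t
    using r by (simp add: circlepath norm_mult)
  have p0: "?p t \<noteq> 0" for t
    using p[of t] r by auto
  have "((\<lambda>u. ?g u / (u - 0) ^ Suc m) has_contour_integral
      (2 * pi * \<i>) / fact m * (deriv ^^ m) ?g 0) ?p"
    by (intro Cauchy_has_contour_integral_higher_derivative_circlepath cont holomorphic_on_subset[OF holg])
       (use r in auto)
  from circlepath_average_has_integral[OF this]
  have "((\<lambda>t. ?g (?p t) / ?p t ^ m) has_integral (deriv ^^ m) ?g 0 / fact m) {0..1}"
    using p0 by simp
  then have int: "integral {0..1} (\<lambda>t. ?g (?p t) / ?p t ^ m) = (deriv ^^ m) ?g 0 / fact m"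
    "(\<lambda>t. ?g (?p t) / ?p t ^ m) integrable_on {0..1}"
    by (auto simp: integral_unique)
  have "((\<lambda>t. (\<epsilon> * (\<rho> - r) powr (- \<alpha>)) / r ^ m * (1 / (norm (of_real \<rho> - ?p t))\<^sup>2) + C / r ^ m) has_integral
      (\<epsilon> * (\<rho> - r) powr (- \<alpha>)) / r ^ m * (1 / (\<rho>\<^sup>2 - r\<^sup>2)) + C / r ^ m * (1 - 0)) {0..1}"
    using has_integral_const_real[of "C / r ^ m" 0 1]
    by (intro has_integral_add has_integral_mult_right poisson_kernel_has_integral r) auto
  then have int': "integral {0..1} (\<lambda>t. (\<epsilon> * (\<rho> - r) powr (- \<alpha>)) / r ^ m * (1 / (norm (of_real \<rho> - ?p t))\<^sup>2) + C / r ^ m)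
      = (\<epsilon> * (\<rho> - r) powr (- \<alpha>) / (\<rho>\<^sup>2 - r\<^sup>2) + C) / r ^ m"
    "(\<lambda>t. (\<epsilon> * (\<rho> - r) powr (- \<alpha>)) / r ^ m * (1 / (norm (of_real \<rho> - ?p t))\<^sup>2) + C / r ^ m) integrable_on {0..1}"
    by (auto simp: integral_unique add_divide_distrib)
  have "norm (integral {0..1} (\<lambda>t. ?g (?p t) / ?p t ^ m)) \<le>
      integral {0..1} (\<lambda>t. (\<epsilon> * (\<rho> - r) powr (- \<alpha>)) / r ^ m * (1 / (norm (of_real \<rho> - ?p t))\<^sup>2) + C / r ^ m)"
  proof (intro integral_norm_bound_integral int int')
    fix t :: real
    have far: "\<rho> - r \<le> norm (of_real \<rho> - ?p t)"
      using norm_triangle_ineq2[of "of_real \<rho>" "?p t"] p[of t] r by simp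
    then have pos: "0 < norm (of_real \<rho> - ?p t)" using r by linarith
    have "norm (?g (?p t)) \<le> \<epsilon> * norm (of_real \<rho> - ?p t) powr (- \<alpha> - 2) + C"
      using p r by (intro bound) auto
    also have "norm (of_real \<rho> - ?p t) powr (- \<alpha> - 2) =
        norm (of_real \<rho> - ?p t) powr (- \<alpha>) * (1 / (norm (of_real \<rho> - ?p t))\<^sup>2)"
      using pos by (simp add: powr_diff)
    also have "norm (of_real \<rho> - ?p t) powr (- \<alpha>) \<le> (\<rho> - r) powr (- \<alpha>)"
      using far r \<alpha> by (intro powr_mono2') auto
    finally have *: "norm (?g (?p t)) \<le> \<epsilon> * ((\<rho> - r) powr (- \<alpha>) * (1 / (norm (of_real \<rho> - ?p t))\<^sup>2)) + C"
      using \<epsilon> by (simp add: mult_left_mono mult_right_mono divide_right_mono)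
    have "norm (?g (?p t) / ?p t ^ m) = norm (?g (?p t)) / r ^ m"
      by (simp add: norm_divide norm_power p)
    also have "\<dots> \<le> (\<epsilon> * ((\<rho> - r) powr (- \<alpha>) * (1 / (norm (of_real \<rho> - ?p t))\<^sup>2)) + C) / r ^ m"
      using * r by (intro divide_right_mono) auto
    finally show "norm (?g (?p t) / ?p t ^ m) \<le>
        (\<epsilon> * (\<rho> - r) powr (- \<alpha>)) / r ^ m * (1 / (norm (of_real \<rho> - ?p t))\<^sup>2) + C / r ^ m"
      by (simp add: add_divide_distrib mult_ac)
  qed
  moreover have "(deriv ^^ m) ?g 0 / fact m = fps_nth A (m + 2) * of_real (real (m + 2) * real (m + 1))"
  proof -
    have "(deriv ^^ m) ?g 0 = (deriv ^^ (m + 2)) f 0"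
      unfolding funpow_add comp_def by (rule refl)
    also have "\<dots> = fps_nth A (m + 2) * fact (m + 2)"
      by (subst fps_nth_fps_expansion[OF A]) (simp del: fact_Suc)
    also have "fact (m + 2) = (of_real (real (m + 2) * real (m + 1)) * fact m :: complex)"
      by (simp add: algebra_simps)
    finally show ?thesis by simp
  qed
  ultimately show ?thesis
    unfolding int int' by (simp add: norm_mult del: of_real_mult of_real_add of_real_of_nat_eq of_nat_add of_nat_Suc)
qed

text \<open>
  Two derivatives make the singularity integrable on circles inside the disc of convergence,
  so that Cauchy's formula on these circles suffices and no Hankel contour is needed.
\<close>

theorem fps_coeff_transfer:
  fixes f :: "complex \<Rightarrow> complex"
  assumes \<rho>: "0 < \<rho>" "\<rho> < R" and \<kappa>: "0 < \<kappa>" "\<kappa> \<le> 1" and \<alpha>: "0 \<le> \<alpha>"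
    and hol: "f holomorphic_on slit_disc \<rho> \<kappa> R" and A: "f has_fps_expansion A"
    and lim: "((\<lambda>z. norm (f z) * norm (of_real \<rho> - z) powr \<alpha>) \<longlongrightarrow> 0)
                (at (of_real \<rho>) within slit_disc \<rho> \<kappa> R)"
  shows "(\<lambda>n. norm (fps_nth A n) * \<rho> ^ n * real n powr (1 - \<alpha>)) \<longlonglongrightarrow> 0"
proof (rule LIMSEQ_I)
  fix e :: real assume e: "0 < e"
  \<comment> \<open>6 = 3 * 2 collects \<open>\<rho> ^ m \<le> 3 * r ^ m\<close> and x (x - 1) \<ge>
    x^2 / 2; the power of 2 comes from x + 1 \<le> 2 x.\<close>
  define Q where "Q = 6 * \<rho> powr (- \<alpha>) * 2 powr (\<alpha> + 1)"
  have Q: "Q > 0" using \<rho> by (simp add: Q_def)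
  define \<epsilon> where "\<epsilon> = e / (2 * Q)"
  have \<epsilon>: "\<epsilon> > 0" using e Q by (simp add: \<epsilon>_def)
  obtain C where C: "C \<ge> 0" "\<And>z. norm z < \<rho> \<Longrightarrow>
      norm ((deriv ^^ 2) f z) \<le> \<epsilon> * norm (of_real \<rho> - z) powr (- \<alpha> - 2) + C"
    using second_deriv_bound_slit_disc[OF \<rho> \<kappa> \<alpha> hol lim \<epsilon>] by blast
  have holb: "f holomorphic_on ball 0 \<rho>"
    by (rule holomorphic_on_subset[OF hol]) (use mem_slit_disc_if_norm_le[OF \<rho> \<kappa>(1)] in force)
  have "(\<lambda>n. 6 * \<rho>\<^sup>2 * C * real n powr (- \<alpha> - 1)) \<longlonglongrightarrow> 6 * \<rho>\<^sup>2 * C * 0"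
    using \<alpha> by (intro tendsto_intros tendsto_neg_powr filterlim_real_sequentially) auto
  then have "\<forall>\<^sub>F n in sequentially. 6 * \<rho>\<^sup>2 * C * real n powr (- \<alpha> - 1) < e / 2"
    using e by (intro order_tendstoD(2)[where y = "6 * \<rho>\<^sup>2 * C * 0"]) auto
  then obtain N where N: "\<And>n. n \<ge> N \<Longrightarrow> 6 * \<rho>\<^sup>2 * C * real n powr (- \<alpha> - 1) < e / 2"
    unfolding eventually_sequentially by blast
  show "\<exists>no. \<forall>n\<ge>no. norm (norm (fps_nth A n) * \<rho> ^ n * real n powr (1 - \<alpha>) - 0) < e"
  proof (intro exI allI impI)
    fix n assume n: "n \<ge> max N 2"
    define m where "m = n - 2"
    have m: "n = m + 2" using n unfolding m_def by linarith
    define x where "x = real n"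
    have x: "x \<ge> 2" using n by (simp add: x_def)
    \<comment> \<open>The gap \<rho> - r is of order 1/n: small enough for the n-th powers of \<rho>
      and r to stay comparable, large enough for negative powers of the gap to be powers of
      n.\<close>
    define r where "r = \<rho> * x / (x + 1)"
    have r: "0 < r" "r < \<rho>" using \<rho> x by (auto simp: r_def field_simps)
    have \<rho>r: "\<rho> - r = \<rho> / (x + 1)" using x by (simp add: r_def field_simps)
    define a where "a = norm (fps_nth A n)"
    have "a * (x * (x - 1)) \<le> (\<epsilon> * (\<rho> - r) powr (- \<alpha>) / (\<rho>\<^sup>2 - r\<^sup>2) + C) / r ^ m"
      using fps_coeff_bound_by_second_deriv[OF holb A \<alpha> _ r C(2), of m] \<epsilon>
      by (simp add: a_def m x_def algebra_simps)
    also have "\<dots> \<le> (\<epsilon> * (\<rho> powr (-\<alpha>) * (x + 1) powr \<alpha>) / (\<rho>\<^sup>2 / (x + 1)) + C) / r ^ m"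
    proof -
      have "(\<rho> - r) powr (- \<alpha>) = \<rho> powr (-\<alpha>) * (x + 1) powr \<alpha>"
        using \<rho> x by (simp add: \<rho>r powr_divide powr_minus field_simps)
      moreover have "\<rho>\<^sup>2 / (x + 1) \<le> \<rho>\<^sup>2 - r\<^sup>2"
      proof -
        have "\<rho>\<^sup>2 / (x + 1) = \<rho> * (\<rho> - r)" by (simp add: \<rho>r power2_eq_square)
        also have "\<dots> \<le> (\<rho> + r) * (\<rho> - r)" using r by (intro mult_right_mono) auto
        finally show ?thesis by (simp add: power2_eq_square algebra_simps)
      qed
      moreover have "0 < \<rho>\<^sup>2 / (x + 1)" using \<rho> x by simp
      moreover have "r\<^sup>2 < \<rho>\<^sup>2" using r by (intro power_strict_mono) auto
      ultimately show ?thesis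
        using r \<epsilon> \<rho> x by (simp only:) (intro divide_right_mono add_right_mono divide_left_mono mult_pos_pos; auto)
    qed
    also have "\<epsilon> * (\<rho> powr (-\<alpha>) * (x + 1) powr \<alpha>) / (\<rho>\<^sup>2 / (x + 1)) = \<epsilon> * \<rho> powr (-\<alpha>) * (x + 1) powr (\<alpha> + 1) / \<rho>\<^sup>2"
      using x by (simp add: powr_add)
    also have "(\<epsilon> * \<rho> powr (-\<alpha>) * (x + 1) powr (\<alpha> + 1) / \<rho>\<^sup>2 + C) / r ^ m \<le>
        (\<epsilon> * \<rho> powr (-\<alpha>) * (2 * x) powr (\<alpha> + 1) / \<rho>\<^sup>2 + C) / r ^ m"
      using r \<epsilon> x \<alpha> by (intro divide_right_mono add_right_mono mult_left_mono powr_mono2) auto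
    finally have main: "a * (x * (x - 1)) * r ^ m \<le> \<epsilon> * \<rho> powr (-\<alpha>) * (2 * x) powr (\<alpha> + 1) / \<rho>\<^sup>2 + C"
      using r by (simp add: field_simps)
    have "\<rho> ^ m \<le> 3 * r ^ m"
    proof -
      have "(1 + 1 / x) ^ m \<le> exp (1 / x) ^ m"
        using x by (intro power_mono exp_ge_add_one_self) auto
      also have "\<dots> = exp (real m / x)" by (simp add: exp_of_nat_mult[symmetric])
      also have "\<dots> \<le> exp 1" using x by (simp add: m x_def)
      also have "\<dots> \<le> 3" by (rule exp_le)
      finally have "(1 + 1 / x) ^ m * r ^ m \<le> 3 * r ^ m" using r by simp
      moreover have "(1 + 1 / x) * r = \<rho>"
      proof -
        have "1 + 1 / x = (x + 1) / x" using x by (simp add: field_simps)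
        then show ?thesis using x by (simp add: r_def)
      qed
      ultimately show ?thesis by (simp add: power_mult_distrib[symmetric])
    qed
    then have "a * (x * (x - 1)) * \<rho> ^ m \<le> a * (x * (x - 1)) * (3 * r ^ m)"
      using x by (intro mult_left_mono) (auto simp: a_def)
    also have "\<dots> = 3 * (a * (x * (x - 1)) * r ^ m)" by simp
    also have "\<dots> \<le> 3 * (\<epsilon> * \<rho> powr (-\<alpha>) * (2 * x) powr (\<alpha> + 1) / \<rho>\<^sup>2 + C)"
      using main by (intro mult_left_mono) auto
    finally have "a * (x * (x - 1)) * \<rho> ^ m \<le> 3 * (\<epsilon> * \<rho> powr (-\<alpha>) * (2 * x) powr (\<alpha> + 1) / \<rho>\<^sup>2 + C)" .
    then have "\<rho>\<^sup>2 * (a * (x * (x - 1)) * \<rho> ^ m) \<le> \<rho>\<^sup>2 * (3 * (\<epsilon> * \<rho> powr (-\<alpha>) * (2 * x) powr (\<alpha> + 1) / \<rho>\<^sup>2 + C))"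
      using \<rho> by (intro mult_left_mono) auto
    then have "a * \<rho> ^ n * (x * (x - 1)) \<le> 3 * (\<epsilon> * \<rho> powr (-\<alpha>) * (2 * x) powr (\<alpha> + 1)) + 3 * \<rho>\<^sup>2 * C"
      using \<rho> by (simp add: m power_add power2_eq_square algebra_simps)
    moreover have "a * \<rho> ^ n * (x * (x / 2)) \<le> a * \<rho> ^ n * (x * (x - 1))"
      using x \<rho> by (intro mult_left_mono) (auto simp: a_def)
    ultimately have "a * \<rho> ^ n * x\<^sup>2 \<le> 6 * (\<epsilon> * \<rho> powr (-\<alpha>) * (2 * x) powr (\<alpha> + 1)) + 6 * \<rho>\<^sup>2 * C"
      by (simp add: power2_eq_square)
    then have "a * \<rho> ^ n * x\<^sup>2 * x powr (- \<alpha> - 1) \<le>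
        (6 * (\<epsilon> * \<rho> powr (-\<alpha>) * (2 * x) powr (\<alpha> + 1)) + 6 * \<rho>\<^sup>2 * C) * x powr (- \<alpha> - 1)"
      by (intro mult_right_mono) auto
    also have "\<dots> = Q * \<epsilon> * (x powr (\<alpha> + 1) * x powr (- \<alpha> - 1)) + 6 * \<rho>\<^sup>2 * C * x powr (- \<alpha> - 1)"
      using x by (simp add: Q_def powr_mult algebra_simps)
    also have "x powr (\<alpha> + 1) * x powr (- \<alpha> - 1) = 1"
      using x by (simp add: powr_add[symmetric])
    also have "x\<^sup>2 = x powr 2" using x by simp
    also have "a * \<rho> ^ n * x powr 2 * x powr (- \<alpha> - 1) = a * \<rho> ^ n * x powr (1 - \<alpha>)"
      by (simp add: powr_add[symmetric] mult.assoc)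
    also have "Q * \<epsilon> * 1 = e / 2" using Q by (simp add: \<epsilon>_def)
    finally have "a * \<rho> ^ n * x powr (1 - \<alpha>) < e"
      using N[of n] n by (simp add: x_def)
    moreover have "0 \<le> a * \<rho> ^ n * x powr (1 - \<alpha>)"
      using \<rho> by (auto simp: a_def)
    ultimately show "norm (norm (fps_nth A n) * \<rho> ^ n * real n powr (1 - \<alpha>) - 0) < e"
      by (simp add: a_def x_def)
  qed
qed

section \<open>Size-biased recursions\<close>

lemma abs_divide_le:
  fixes x y d :: real
  shows "\<bar>x\<bar> \<le> y \<Longrightarrow> d > 0 \<Longrightarrow> \<bar>x / d\<bar> \<le> y / d"
  by (simp add: abs_divide divide_right_mono)

text \<open>Toeplitz's argument: finitely many terms die because each column of weights tends to 0,
  and the others are small because the row sums are at most 1.\<close>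

lemma toeplitz_tendsto_0:
  fixes g :: "nat \<Rightarrow> nat \<Rightarrow> real" and x :: "nat \<Rightarrow> real"
  assumes g: "\<And>r i. i < r \<Longrightarrow> 0 \<le> g r i" "\<And>r. (\<Sum>i<r. g r i) \<le> 1"
    and lim: "\<And>i. (\<lambda>r. g r i) \<longlonglongrightarrow> 0" and x: "x \<longlonglongrightarrow> 0"
  shows "(\<lambda>r. \<Sum>i<r. g r i * x i) \<longlonglongrightarrow> 0"
proof (rule LIMSEQ_I)
  fix e :: real assume e: "0 < e"
  obtain N where N: "\<And>i. i \<ge> N \<Longrightarrow> \<bar>x i\<bar> < e / 2"
    using LIMSEQ_D[OF x, of "e / 2"] e by auto
  have "(\<lambda>r. \<Sum>i<N. g r i * \<bar>x i\<bar>) \<longlonglongrightarrow> (\<Sum>i<N. 0 * \<bar>x i\<bar>)"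
    by (intro tendsto_intros lim)
  then obtain M where M: "\<And>r. r \<ge> M \<Longrightarrow> (\<Sum>i<N. g r i * \<bar>x i\<bar>) < e / 2"
    using e order_tendstoD(2)[of _ _ sequentially "e / 2"] by (force simp: eventually_sequentially)
  show "\<exists>no. \<forall>r\<ge>no. norm ((\<Sum>i<r. g r i * x i) - 0) < e"
  proof (intro exI allI impI)
    fix r assume r: "r \<ge> max M N"
    have "norm ((\<Sum>i<r. g r i * x i) - 0) \<le> (\<Sum>i<r. g r i * \<bar>x i\<bar>)"
      unfolding diff_0_right
      by (rule order_trans[OF norm_sum sum_mono]) (use g in \<open>auto simp: abs_mult\<close>)
    also have "\<dots> = (\<Sum>i<N. g r i * \<bar>x i\<bar>) + (\<Sum>i\<in>{N..<r}. g r i * \<bar>x i\<bar>)"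
      using r by (subst sum.union_disjoint[symmetric]) (auto intro!: sum.cong)
    also have "(\<Sum>i\<in>{N..<r}. g r i * \<bar>x i\<bar>) \<le> (\<Sum>i\<in>{N..<r}. g r i * (e / 2))"
      using g N by (intro sum_mono mult_left_mono) (auto intro: less_imp_le)
    also have "\<dots> \<le> (\<Sum>i<r. g r i * (e / 2))"
      using g e by (intro sum_mono2) auto
    also have "\<dots> \<le> 1 * (e / 2)"
      using g(2)[of r] e by (subst sum_distrib_right[symmetric], intro mult_right_mono) auto
    finally show "norm ((\<Sum>i<r. g r i * x i) - 0) < e"
      using M[of r] r by simp
  qed
qed

text \<open>
  \<open>stick_weight a r i\<close> is the probability that \<open>\<lfloor>r V\<rfloor> = i\<close>, where \<open>V\<close> has distribution
  function \<open>x\<^sup>a\<close> on the unit interval.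
\<close>

definition stick_weight :: "real \<Rightarrow> nat \<Rightarrow> nat \<Rightarrow> real" where
  "stick_weight a r i = (real (Suc i) powr a - real i powr a) / real r powr a"

lemma stick_weight_nonneg: "a > 0 \<Longrightarrow> 0 \<le> stick_weight a r i"
  by (auto simp: stick_weight_def intro!: divide_nonneg_nonneg powr_mono2)

lemma sum_stick_weight_lessThan:
  assumes "a > 0" shows "(\<Sum>i<n. stick_weight a r i) = real n powr a / real r powr a"
  using assms sum_lessThan_telescope[of "\<lambda>i. real i powr a" n]
  by (simp add: stick_weight_def sum_divide_distrib[symmetric])

lemma sum_stick_weight: "a > 0 \<Longrightarrow> r > 0 \<Longrightarrow> (\<Sum>i<r. stick_weight a r i) = 1"
  by (simp add: sum_stick_weight_lessThan)

lemma sum_stick_weight_le_1: "a > 0 \<Longrightarrow> (\<Sum>i<r. stick_weight a r i) \<le> 1"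
  by (cases "r = 0") (auto simp: sum_stick_weight)

lemma stick_weight_tendsto_0:
  assumes "a > 0" shows "(\<lambda>r. stick_weight a r i) \<longlonglongrightarrow> 0"
proof -
  have "(\<lambda>r. (real (Suc i) powr a - real i powr a) * real r powr (-a)) \<longlonglongrightarrow> (real (Suc i) powr a - real i powr a) * 0"
    using assms by (intro tendsto_intros tendsto_neg_powr filterlim_real_sequentially) auto
  then show ?thesis by (simp add: stick_weight_def powr_minus divide_inverse)
qed

lemma powr_ratio_tendsto_1: "(\<lambda>r. real (r - j) powr a / real r powr a) \<longlonglongrightarrow> 1"
proof -
  have "(\<lambda>r. (real (r - j) / real r) powr a) \<longlonglongrightarrow> 1 powr a"
    by (intro tendsto_powr tendsto_const) (real_asymp, auto)
  then show ?thesis by (simp add: powr_divide)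
qed

lemma stick_weight_reflected_tendsto_0: "(\<lambda>r. stick_weight a r (r - Suc j)) \<longlonglongrightarrow> 0"
proof -
  have "(\<lambda>r. real (r - j) powr a / real r powr a - real (r - Suc j) powr a / real r powr a) \<longlonglongrightarrow> 1 - 1"
    by (intro tendsto_diff powr_ratio_tendsto_1)
  moreover have "\<forall>\<^sub>F r in sequentially. real (r - j) powr a / real r powr a - real (r - Suc j) powr a / real r powr a
      = stick_weight a r (r - Suc j)"
    using eventually_gt_at_top[of j]
    by eventually_elim (simp add: stick_weight_def diff_divide_distrib Suc_diff_Suc)
  ultimately show ?thesis by (auto intro: Lim_transform_eventually)
qed

lemma stick_weight_average_tendsto_0:
  assumes "a > 0" "x \<longlonglongrightarrow> (0 :: real)"
  shows "(\<lambda>r. \<Sum>i<r. stick_weight a r i * x i) \<longlonglongrightarrow> 0"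
  using assms
  by (intro toeplitz_tendsto_0 stick_weight_nonneg sum_stick_weight_le_1 stick_weight_tendsto_0) auto

text \<open>V has no atom at 1, so the weights near i = r vanish too and Toeplitz's argument applies
  to the reversed index. This is needed because the irreducibles enter through r - i.\<close>

lemma stick_weight_average_reflected_tendsto_0:
  assumes a: "a > 0" and x: "x \<longlonglongrightarrow> (0 :: real)"
  shows "(\<lambda>r. \<Sum>i<r. stick_weight a r i * x (r - i)) \<longlonglongrightarrow> 0"
proof -
  have "(\<lambda>r. \<Sum>j<r. stick_weight a r (r - Suc j) * x (Suc j)) \<longlonglongrightarrow> 0"
  proof (rule toeplitz_tendsto_0)
    show "(\<Sum>i<r. stick_weight a r (r - Suc i)) \<le> 1" for r
      using sum_stick_weight_le_1[OF a, of r] by (simp add: sum.nat_diff_reindex)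
    show "(\<lambda>i. x (Suc i)) \<longlonglongrightarrow> 0" using x by (rule LIMSEQ_Suc)
  qed (use a in \<open>auto intro: stick_weight_nonneg stick_weight_reflected_tendsto_0\<close>)
  moreover have "(\<Sum>j<r. stick_weight a r (r - Suc j) * x (Suc j)) = (\<Sum>i<r. stick_weight a r i * x (r - i))" for r
  proof -
    have "(\<Sum>j<r. stick_weight a r (r - Suc j) * x (Suc j)) =
        (\<Sum>j<r. (\<lambda>i. stick_weight a r i * x (r - i)) (r - Suc j))"
      by (intro sum.cong refl) auto
    also have "\<dots> = (\<Sum>i<r. stick_weight a r i * x (r - i))"
      by (rule sum.nat_diff_reindex)
    finally show ?thesis .
  qed
  ultimately show ?thesis by simp
qed

text \<open>With probability at least 2 powr (- a) the remainder is at most r/2, and then at least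
  half of r is lost. The factor is below 1 and is the source of the contraction.\<close>

lemma stick_weight_mean_le:
  assumes a: "a > 0"
  shows "(\<Sum>i<r. stick_weight a r i * real i) \<le> (1 - 2 powr (-a) / 2) * real r"
proof (cases "r = 0")
  case False
  \<comment> \<open>Half of r rounded up: h / r is at least 1/2, while every i < h still satisfies i
    \<le> r/2.\<close>
  define h where "h = (r + 1) div 2"
  have h: "h \<le> r" "real r / 2 \<le> real h" using False by (auto simp: h_def)
  have "2 powr (-a) / 2 * real r = (real r / 2) powr a / real r powr a * (real r / 2)"
    using False by (simp add: powr_divide powr_minus field_simps)
  also have "\<dots> \<le> real h powr a / real r powr a * (real r / 2)"
    using a h by (intro mult_right_mono divide_right_mono powr_mono2) auto
  also have "\<dots> = (\<Sum>i<h. stick_weight a r i * (real r / 2))"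
    using a by (simp only: sum_stick_weight_lessThan sum_distrib_right[symmetric])
  also have "\<dots> \<le> (\<Sum>i<h. stick_weight a r i * (real r - real i))"
    by (intro sum_mono mult_left_mono stick_weight_nonneg a) (auto simp: h_def)
  also have "\<dots> \<le> (\<Sum>i<r. stick_weight a r i * (real r - real i))"
    using h a by (intro sum_mono2) (auto intro!: mult_nonneg_nonneg stick_weight_nonneg)
  also have "\<dots> = (\<Sum>i<r. stick_weight a r i) * real r - (\<Sum>i<r. stick_weight a r i * real i)"
    by (simp add: right_diff_distrib sum_subtractf sum_distrib_right)
  also have "(\<Sum>i<r. stick_weight a r i) = 1" using False a by (simp add: sum_stick_weight)
  finally show ?thesis by (simp add: algebra_simps)
qed simp

lemma powr_increment_asymp:
  assumes "a > 0"
  shows "(\<lambda>i. (real (Suc i) powr a - real i powr a) * real i powr (1 - a)) \<longlonglongrightarrow> a"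
  using assms by real_asymp

text \<open>The kernel is the stick weight times b(r - i) t(i) s(r), where t and s tend to C/a and
  1/C. The product is close to 1 when i and r - i are both large, and the two averaging lemmas make
  the other i negligible.\<close>

lemma size_biased_kernel_tendsto:
  fixes b q :: "nat \<Rightarrow> real"
  assumes a: "a > 0" and b: "b \<longlonglongrightarrow> a"
    and q: "(\<lambda>n. q n * real n powr (1 - a)) \<longlonglongrightarrow> C" and C: "C > 0"
  shows "(\<lambda>r. \<Sum>i<r. \<bar>b (r - i) * q i / (real r * q r) - stick_weight a r i\<bar>) \<longlonglongrightarrow> 0"
proof -
  define w where "w i = real (Suc i) powr a - real i powr a" for i
  have w: "w i > 0" for i
    using a by (auto simp: w_def intro!: powr_less_mono2)
  define t where "t i = q i / w i" for i
  define s where "s r = real r powr a / (real r * q r)" for r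
  have "(\<lambda>i. (q i * real i powr (1 - a)) / (w i * real i powr (1 - a))) \<longlonglongrightarrow> C / a"
    unfolding w_def using a by (intro tendsto_divide q powr_increment_asymp) auto
  moreover have "\<forall>\<^sub>F i in sequentially. (q i * real i powr (1 - a)) / (w i * real i powr (1 - a)) = t i"
    using eventually_gt_at_top[of 0] by eventually_elim (auto simp: t_def)
  ultimately have t: "t \<longlonglongrightarrow> C / a" by (auto intro: Lim_transform_eventually)
  have "(\<lambda>r. 1 / (q r * real r powr (1 - a))) \<longlonglongrightarrow> 1 / C"
    using C by (intro tendsto_intros q) auto
  moreover have "\<forall>\<^sub>F r in sequentially. 1 / (q r * real r powr (1 - a)) = s r"
    using eventually_gt_at_top[of 0] by eventually_elim (auto simp: s_def powr_diff)
  ultimately have s: "s \<longlonglongrightarrow> 1 / C" by (auto intro: Lim_transform_eventually)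
  obtain T where T: "\<And>i. \<bar>t i\<bar> \<le> T"
    using convergent_imp_Bseq[of t] t by (auto simp: convergent_def Bseq_def)
  obtain S where S: "\<And>i. \<bar>s i\<bar> \<le> S"
    using convergent_imp_Bseq[of s] s by (auto simp: convergent_def Bseq_def)
  have T0: "0 \<le> T" and S0: "0 \<le> S" using T[of 0] S[of 0] by linarith+
  define f where "f r = T * S * (\<Sum>i<r. stick_weight a r i * \<bar>b (r - i) - a\<bar>)
      + a * S * (\<Sum>i<r. stick_weight a r i * \<bar>t i - C / a\<bar>) + \<bar>C * s r - 1\<bar>" for r
  have "f \<longlonglongrightarrow> T * S * 0 + a * S * 0 + \<bar>C * (1 / C) - 1\<bar>"
    unfolding f_def
    by (intro tendsto_intros s stick_weight_average_tendsto_0 stick_weight_average_reflected_tendsto_0 a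
         tendsto_rabs_zero LIM_zero b t)
  then have f0: "f \<longlonglongrightarrow> 0" using C by simp
  have bound: "norm (\<Sum>i<r. \<bar>b (r - i) * q i / (real r * q r) - stick_weight a r i\<bar>) \<le> norm (f r) * 1" for r
  proof -
    have "\<bar>b (r - i) * q i / (real r * q r) - stick_weight a r i\<bar> \<le>
        T * S * (stick_weight a r i * \<bar>b (r - i) - a\<bar>) + a * S * (stick_weight a r i * \<bar>t i - C / a\<bar>)
        + stick_weight a r i * \<bar>C * s r - 1\<bar>" if "i < r" for i
    proof -
      have "b (r - i) * q i / (real r * q r) = stick_weight a r i * (b (r - i) * t i * s r)"
        using w[of i] that by (simp add: stick_weight_def t_def s_def w_def)
      then have "\<bar>b (r - i) * q i / (real r * q r) - stick_weight a r i\<bar> =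
          stick_weight a r i * \<bar>b (r - i) * t i * s r - 1\<bar>"
        using stick_weight_nonneg[OF a, of r i] by (metis abs_mult abs_of_nonneg mult.right_neutral right_diff_distrib)
      \<comment> \<open>Replaces b, t and s by their limits one after the other, so that each
        difference gets an average of its own.\<close>
      also have "b (r - i) * t i * s r - 1 = (b (r - i) - a) * (t i * s r) + a * s r * (t i - C / a) + (C * s r - 1)"
        using a by (simp add: field_simps)
      also have "\<bar>\<dots>\<bar> \<le> \<bar>b (r - i) - a\<bar> * (\<bar>t i\<bar> * \<bar>s r\<bar>) + a * \<bar>s r\<bar> * \<bar>t i - C / a\<bar> + \<bar>C * s r - 1\<bar>"
        using a by (intro order_trans[OF abs_triangle_ineq] add_mono) (auto simp: abs_mult)
      also have "\<dots> \<le> \<bar>b (r - i) - a\<bar> * (T * S) + a * S * \<bar>t i - C / a\<bar> + \<bar>C * s r - 1\<bar>"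
        using T S T0 S0 a by (intro add_mono mult_left_mono mult_right_mono mult_mono) auto
      finally have "\<bar>b (r - i) * q i / (real r * q r) - stick_weight a r i\<bar> \<le> stick_weight a r i *
          (\<bar>b (r - i) - a\<bar> * (T * S) + a * S * \<bar>t i - C / a\<bar> + \<bar>C * s r - 1\<bar>)"
        using stick_weight_nonneg[OF a, of r i] by (simp only: mult_left_mono)
      then show ?thesis by (simp only: distrib_left mult_ac)
    qed
    then have "(\<Sum>i<r. \<bar>b (r - i) * q i / (real r * q r) - stick_weight a r i\<bar>) \<le>
        (\<Sum>i<r. T * S * (stick_weight a r i * \<bar>b (r - i) - a\<bar>) + a * S * (stick_weight a r i * \<bar>t i - C / a\<bar>)
        + stick_weight a r i * \<bar>C * s r - 1\<bar>)"
      by (intro sum_mono) auto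
    also have "\<dots> = T * S * (\<Sum>i<r. stick_weight a r i * \<bar>b (r - i) - a\<bar>)
        + a * S * (\<Sum>i<r. stick_weight a r i * \<bar>t i - C / a\<bar>) + (\<Sum>i<r. stick_weight a r i) * \<bar>C * s r - 1\<bar>"
      by (simp add: sum.distrib sum_distrib_left sum_distrib_right)
    also have "(\<Sum>i<r. stick_weight a r i) * \<bar>C * s r - 1\<bar> \<le> 1 * \<bar>C * s r - 1\<bar>"
      by (intro mult_right_mono sum_stick_weight_le_1 a) auto
    finally show ?thesis by (simp add: f_def[symmetric] sum_nonneg)
  qed
  show ?thesis
    by (rule tendsto_0_le[OF f0 eventuallyI[OF bound]])
qed

section \<open>The contraction argument in abstract form\<close>

text \<open>Intended reading: q n is p_n \<rho>^n, b j is \<phi> j m_j \<rho>^j, \<open>W F\<close>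
  the normalised weighted sum of a function F of the component sizes, \<open>\<Psi> F r\<close> its
  expectation for a stick of length r, \<open>cls B L\<close> the symmetric functions with bound B
  and Lipschitz constant L, and \<open>shift j\<close> prepends a component of size j. Sizes are not
  divided by n, so that one class serves for all r. \<open>W_rec\<close> is an inequality because of
  repetitions.\<close>

locale size_biased_recursion =
  fixes b q :: "nat \<Rightarrow> real" and W \<Psi> :: "'f \<Rightarrow> nat \<Rightarrow> real" and shift :: "nat \<Rightarrow> 'f \<Rightarrow> 'f"
    and cls :: "real \<Rightarrow> real \<Rightarrow> 'f \<Rightarrow> bool"
    and a C :: real
  assumes a: "a > 0" and b: "b \<longlonglongrightarrow> a" "\<And>j. 0 \<le> b j" and q: "\<And>n. 0 \<le> q n"
    and qlim: "(\<lambda>n. q n * real n powr (1 - a)) \<longlonglongrightarrow> C" and C: "C > 0"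
    and cls: "\<And>B L F. cls B L F \<Longrightarrow> 0 \<le> B" "\<And>B L F. cls B L F \<Longrightarrow> 0 \<le> L"
      "\<And>B L F j. cls B L F \<Longrightarrow> cls B L (shift j F)"
    and W: "\<And>B L F r. cls B L F \<Longrightarrow> \<bar>W F r\<bar> \<le> B * q r"
    and \<Psi>: "\<And>B L F r. cls B L F \<Longrightarrow> \<bar>\<Psi> F r\<bar> \<le> B"
    and base: "\<And>B L F r. cls B L F \<Longrightarrow> \<bar>W F r - q r * \<Psi> F r\<bar> \<le> q r * (2 * L * real r)"
    and W_rec: "\<And>B L F r. cls B L F \<Longrightarrow>
        \<bar>real r * W F r - (\<Sum>i<r. b (r - i) * W (shift (r - i) F) i)\<bar> \<le>
        B * \<bar>real r * q r - (\<Sum>i<r. b (r - i) * q i)\<bar>"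
    and \<Psi>_rec: "\<And>B L F r. cls B L F \<Longrightarrow> r > 0 \<Longrightarrow>
        \<bar>\<Psi> F r - (\<Sum>i<r. stick_weight a r i * \<Psi> (shift (r - i) F) i)\<bar> \<le> 2 * L"
begin

text \<open>Each unrolling of the recursion shrinks the mean length, and this factor is gained on
  the Lipschitz term. The error \<open>e\<close> is uniform over the class because the induction
  hypothesis is applied to shifted functions; its weight B + L r does not change when L is divided
  and r multiplied by the same number.\<close>

lemma contraction:
  shows "\<exists>e. e \<longlonglongrightarrow> 0 \<and> (\<forall>r. 0 \<le> e r) \<and> (\<forall>B L F r. cls B L F \<longrightarrow>
      \<bar>W F r - q r * \<Psi> F r\<bar> \<le> q r * (2 * L * real r * (1 - 2 powr (-a) / 2) ^ K + (B + L * real r) * e r))"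
proof (induction K)
  case 0
  show ?case using base by (intro exI[of _ "\<lambda>_. 0"]) auto
next
  case (Suc K)
  define \<beta> where "\<beta> = 1 - 2 powr (-a) / (2 :: real)"
  have "2 powr (-a) \<le> (2 :: real) powr 0"
    using a by (intro powr_mono) auto
  then have \<beta>: "0 \<le> \<beta>" "\<beta> \<le> 1" unfolding \<beta>_def by simp_all
  define \<beta>K where "\<beta>K = \<beta> ^ K"
  have \<beta>K: "0 \<le> \<beta>K" "\<beta>K \<le> 1" using \<beta> by (auto simp: \<beta>K_def power_le_one)
  obtain e where e: "e \<longlonglongrightarrow> 0" "\<And>r. 0 \<le> e r"
    and IH: "\<And>B L F r. cls B L F \<Longrightarrow>
      \<bar>W F r - q r * \<Psi> F r\<bar> \<le> q r * (2 * L * real r * \<beta>K + (B + L * real r) * e r)"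
    using Suc.IH unfolding \<beta>_def[symmetric] \<beta>K_def[symmetric] by blast
  obtain E where E: "\<And>i. \<bar>e i\<bar> \<le> E"
    using convergent_imp_Bseq[of e] e by (auto simp: convergent_def Bseq_def)
  have E0: "0 \<le> E" using E[of 0] by linarith
  define k where "k r i = b (r - i) * q i / (real r * q r)" for r i
  define g where "g = stick_weight a"
  have g0: "0 \<le> g r i" for r i using a by (simp add: g_def stick_weight_nonneg)
  define TV where "TV r = (\<Sum>i<r. \<bar>k r i - g r i\<bar>)" for r
  have TV: "TV \<longlonglongrightarrow> 0" and TV0: "\<And>r. 0 \<le> TV r"
    using size_biased_kernel_tendsto[OF a b(1) qlim C] unfolding TV_def k_def g_def by (auto intro: sum_nonneg)
  \<comment> \<open>4 TV covers the repetition defect, the change of kernel and the excess mean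
    length; the middle terms are the old error averaged over the kernel; 2 / r covers the rounding
    of the stick, as 2 L = L r * (2 / r).\<close>
  define e' where "e' r = 4 * TV r + ((\<Sum>i<r. g r i * e i) + E * TV r) + 2 * (1 / real r)" for r
  have "e' \<longlonglongrightarrow> 4 * 0 + (0 + E * 0) + 2 * 0"
    unfolding e'_def g_def
    by (intro tendsto_intros TV stick_weight_average_tendsto_0 a e lim_1_over_n)
  then have e'_lim: "e' \<longlonglongrightarrow> 0" by simp
  have e'0: "0 \<le> e' r" for r
    unfolding e'_def using TV0 E0 g0 e by (auto intro!: add_nonneg_nonneg sum_nonneg mult_nonneg_nonneg)
  have "\<bar>W F r - q r * \<Psi> F r\<bar> \<le> q r * (2 * L * real r * (\<beta> * \<beta>K) + (B + L * real r) * e' r)"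
    if F: "cls B L F" for B L F r
  proof -
    note B0 = cls(1)[OF F] and L0 = cls(2)[OF F]
    consider "r = 0" | "q r = 0" | "r > 0" "q r > 0"
      using q[of r] by linarith
    then show ?thesis
    proof cases
      case 1
      then show ?thesis using base[OF F, of r] q[of r] B0 e'0[of r] by (auto elim!: order_trans)
    next
      case 2
      then show ?thesis using W[OF F, of r] by simp
    next
      case 3
      have k0: "0 \<le> k r i" for i using 3 b(2) q by (simp add: k_def)
      have k_le: "k r i \<le> g r i + \<bar>k r i - g r i\<bar>" for i by linarith
      have r0: "real r * q r > 0" using 3 by simp
      define \<Delta> where "\<Delta> i = W (shift (r - i) F) i / q i" for i
      define \<Psi>' where "\<Psi>' i = \<Psi> (shift (r - i) F) i" for i
      \<comment> \<open>If q i = 0, the bound \<open>W\<close> makes the numerator vanish too, so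
        the value 0 of the quotient in \<open>\<Delta>\<close> is harmless.\<close>
      have kW: "b (r - i) * W (shift (r - i) F) i / (real r * q r) = k r i * \<Delta> i" for i
        using W[OF cls(3)[OF F], of "r - i" i] by (cases "q i = 0") (auto simp: k_def \<Delta>_def)
      have sum_k: "\<bar>1 - (\<Sum>i<r. k r i)\<bar> \<le> TV r"
      proof -
        have "1 - (\<Sum>i<r. k r i) = (\<Sum>i<r. g r i - k r i)"
          using 3 a by (simp add: sum_subtractf g_def sum_stick_weight)
        also have "\<bar>\<dots>\<bar> \<le> (\<Sum>i<r. \<bar>g r i - k r i\<bar>)" by (rule sum_abs)
        finally show ?thesis by (simp add: TV_def abs_minus_commute)
      qed
      \<comment> \<open>Four comparisons follow: W / q with its average over removals, W / q with
        \<Psi> on the remainder (induction hypothesis), the kernel with the stick weights, and their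
        average of \<Psi> with \<Psi> itself.\<close>
      have 1: "\<bar>W F r / q r - (\<Sum>i<r. k r i * \<Delta> i)\<bar> \<le> B * TV r"
      proof -
        have "W F r / q r - (\<Sum>i<r. k r i * \<Delta> i) =
            (real r * W F r - (\<Sum>i<r. b (r - i) * W (shift (r - i) F) i)) / (real r * q r)"
          using 3 by (simp add: diff_divide_distrib sum_divide_distrib kW)
        also have "\<bar>\<dots>\<bar> \<le> B * \<bar>real r * q r - (\<Sum>i<r. b (r - i) * q i)\<bar> / (real r * q r)"
          by (rule abs_divide_le[OF W_rec[OF F] r0])
        also have "\<dots> = B * \<bar>(real r * q r - (\<Sum>i<r. b (r - i) * q i)) / (real r * q r)\<bar>"
          using r0 by (simp add: abs_divide)
        also have "(real r * q r - (\<Sum>i<r. b (r - i) * q i)) / (real r * q r) = 1 - (\<Sum>i<r. k r i)"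
          using 3 by (simp add: diff_divide_distrib sum_divide_distrib k_def)
        also have "B * \<bar>\<dots>\<bar> \<le> B * TV r" using sum_k B0 by (rule mult_left_mono)
        finally show ?thesis .
      qed
      have 2: "\<bar>(\<Sum>i<r. k r i * \<Delta> i) - (\<Sum>i<r. k r i * \<Psi>' i)\<bar> \<le>
          2 * L * \<beta>K * (real r * (\<beta> + TV r)) + (B + L * real r) * ((\<Sum>i<r. g r i * e i) + E * TV r)"
      proof -
        have "k r i * \<bar>\<Delta> i - \<Psi>' i\<bar> \<le> k r i * (2 * L * \<beta>K * real i + (B + L * real r) * e i)" if "i < r" for i
        proof (cases "q i = 0")
          case False
          then have qi: "q i > 0" using q[of i] by simp
          have "\<Delta> i - \<Psi>' i = (W (shift (r - i) F) i - q i * \<Psi>' i) / q i"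
            using qi by (simp add: \<Delta>_def diff_divide_distrib)
          also have "\<bar>\<dots>\<bar> \<le> q i * (2 * L * real i * \<beta>K + (B + L * real i) * e i) / q i"
            unfolding \<Psi>'_def by (rule abs_divide_le[OF IH[OF cls(3)[OF F]] qi])
          also have "\<dots> \<le> 2 * L * \<beta>K * real i + (B + L * real r) * e i"
            using qi that L0 e(2)[of i] by (simp add: mult_right_mono mult_left_mono mult_ac)
          finally show ?thesis using k0[of i] by (rule mult_left_mono)
        qed (simp add: k_def)
        then have "(\<Sum>i<r. k r i * \<bar>\<Delta> i - \<Psi>' i\<bar>) \<le> (\<Sum>i<r. k r i * (2 * L * \<beta>K * real i + (B + L * real r) * e i))"
          by (intro sum_mono) auto
        also have "\<dots> = 2 * L * \<beta>K * (\<Sum>i<r. k r i * real i) + (B + L * real r) * (\<Sum>i<r. k r i * e i)"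
          by (simp add: algebra_simps sum.distrib sum_distrib_left)
        also have "(\<Sum>i<r. k r i * real i) \<le> (\<Sum>i<r. g r i * real i + \<bar>k r i - g r i\<bar> * real r)"
        proof (intro sum_mono)
          fix i assume "i \<in> {..<r}"
          then have "k r i * real i \<le> (g r i + \<bar>k r i - g r i\<bar>) * real i"
            by (intro mult_right_mono k_le) auto
          also have "\<dots> \<le> g r i * real i + \<bar>k r i - g r i\<bar> * real r"
            using \<open>i \<in> {..<r}\<close> by (simp add: distrib_right mult_left_mono)
          finally show "k r i * real i \<le> g r i * real i + \<bar>k r i - g r i\<bar> * real r" .
        qed
        also have "\<dots> = (\<Sum>i<r. g r i * real i) + TV r * real r"
          by (simp add: TV_def sum.distrib sum_distrib_right)
        also have "\<dots> \<le> real r * (\<beta> + TV r)"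
          using stick_weight_mean_le[OF a, of r] by (simp add: g_def \<beta>_def algebra_simps)
        also have "(\<Sum>i<r. k r i * e i) \<le> (\<Sum>i<r. g r i * e i + E * \<bar>k r i - g r i\<bar>)"
        proof (intro sum_mono)
          fix i
          have "k r i * e i \<le> (g r i + \<bar>k r i - g r i\<bar>) * e i"
            by (intro mult_right_mono k_le e)
          also have "\<dots> \<le> g r i * e i + E * \<bar>k r i - g r i\<bar>"
            using E[of i] e(2)[of i] mult_left_mono[of "e i" E "\<bar>k r i - g r i\<bar>"] by (simp add: algebra_simps)
          finally show "k r i * e i \<le> g r i * e i + E * \<bar>k r i - g r i\<bar>" .
        qed
        also have "\<dots> = (\<Sum>i<r. g r i * e i) + E * TV r"
          by (simp add: TV_def sum.distrib sum_distrib_left)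
        finally have *: "(\<Sum>i<r. k r i * \<bar>\<Delta> i - \<Psi>' i\<bar>) \<le>
            2 * L * \<beta>K * (real r * (\<beta> + TV r)) + (B + L * real r) * ((\<Sum>i<r. g r i * e i) + E * TV r)"
          using L0 B0 \<beta>K by (simp add: mult_left_mono)
        have "\<bar>(\<Sum>i<r. k r i * \<Delta> i) - (\<Sum>i<r. k r i * \<Psi>' i)\<bar> = \<bar>\<Sum>i<r. k r i * (\<Delta> i - \<Psi>' i)\<bar>"
          by (simp add: sum_subtractf right_diff_distrib)
        also have "\<dots> \<le> (\<Sum>i<r. \<bar>k r i * (\<Delta> i - \<Psi>' i)\<bar>)" by (rule sum_abs)
        also have "\<dots> = (\<Sum>i<r. k r i * \<bar>\<Delta> i - \<Psi>' i\<bar>)"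
          using k0 by (simp add: abs_mult)
        finally show ?thesis using * by linarith
      qed
      have 3: "\<bar>(\<Sum>i<r. k r i * \<Psi>' i) - (\<Sum>i<r. g r i * \<Psi>' i)\<bar> \<le> B * TV r"
      proof -
        have "\<bar>(\<Sum>i<r. k r i * \<Psi>' i) - (\<Sum>i<r. g r i * \<Psi>' i)\<bar> = \<bar>\<Sum>i<r. (k r i - g r i) * \<Psi>' i\<bar>"
          by (simp add: sum_subtractf left_diff_distrib)
        also have "\<dots> \<le> (\<Sum>i<r. \<bar>(k r i - g r i) * \<Psi>' i\<bar>)" by (rule sum_abs)
        also have "\<dots> \<le> (\<Sum>i<r. \<bar>k r i - g r i\<bar> * B)"
          unfolding abs_mult \<Psi>'_def by (intro sum_mono mult_left_mono \<Psi>[OF cls(3)[OF F]]) auto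
        finally show ?thesis by (simp add: TV_def sum_distrib_left mult.commute)
      qed
      have 4: "\<bar>(\<Sum>i<r. g r i * \<Psi>' i) - \<Psi> F r\<bar> \<le> 2 * L"
        using \<Psi>_rec[OF F \<open>r > 0\<close>] by (simp add: g_def \<Psi>'_def abs_minus_commute)
      have "\<bar>W F r / q r - \<Psi> F r\<bar> \<le> B * TV r + (2 * L * \<beta>K * (real r * (\<beta> + TV r))
          + (B + L * real r) * ((\<Sum>i<r. g r i * e i) + E * TV r)) + B * TV r + 2 * L"
        using 1 2 3 4 by linarith
      also have "\<dots> \<le> 2 * L * real r * (\<beta> * \<beta>K) + (B + L * real r) * e' r"
      proof -
        have "2 * (L * real r) * TV r * \<beta>K \<le> 2 * (L * real r) * TV r * 1"
          using L0 TV0[of r] \<beta>K by (intro mult_left_mono) auto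
        moreover have "2 * L \<le> (B + L * real r) * (2 * (1 / real r))"
          using \<open>r > 0\<close> B0 by (simp add: field_simps)
        moreover have "0 \<le> B * TV r" "0 \<le> L * real r * TV r" using B0 L0 TV0[of r] by auto
        ultimately show ?thesis unfolding e'_def by (simp add: algebra_simps)
      qed
      finally have "q r * \<bar>W F r / q r - \<Psi> F r\<bar> \<le> q r * (2 * L * real r * (\<beta> * \<beta>K) + (B + L * real r) * e' r)"
        using \<open>q r > 0\<close> by (intro mult_left_mono) auto
      moreover have "q r * \<bar>W F r / q r - \<Psi> F r\<bar> = \<bar>W F r - q r * \<Psi> F r\<bar>"
        using \<open>q r > 0\<close> by (simp add: abs_mult_pos' right_diff_distrib)
      ultimately show ?thesis by simp
    qed
  qed
  then show ?case
    using e'_lim e'0 unfolding \<beta>_def[symmetric] \<beta>K_def by (intro exI[of _ e']) (simp add: mult_ac)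
qed

text \<open>At r = n the Lipschitz term is 2 L \<beta>^K and the error is (B + L) e(n). K is fixed
  first to make the former small; the latter vanishes for this K as n grows.\<close>

theorem limit:
  assumes F: "\<And>n. n > 0 \<Longrightarrow> cls B (L / real n) (F n)"
  shows "(\<lambda>n. W (F n) n / q n - \<Psi> (F n) n) \<longlonglongrightarrow> 0"
proof (rule LIMSEQ_I)
  fix \<epsilon> :: real assume \<epsilon>: "\<epsilon> > 0"
  define \<beta> where "\<beta> = 1 - 2 powr (-a) / (2 :: real)"
  have "2 powr (-a) \<le> (2 :: real) powr 0"
    using a by (intro powr_mono) auto
  then have \<beta>: "0 \<le> \<beta>" "\<beta> < 1" unfolding \<beta>_def by simp_all
  have B0: "0 \<le> B" and L0: "0 \<le> L" using cls(1,2)[OF F[of 1]] by auto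
  have "(\<lambda>K. 2 * L * \<beta> ^ K) \<longlonglongrightarrow> 2 * L * 0"
    by (intro tendsto_intros LIMSEQ_power_zero) (use \<beta> in auto)
  then have "\<forall>\<^sub>F K in sequentially. 2 * L * \<beta> ^ K < \<epsilon> / 2"
    using \<epsilon> by (intro order_tendstoD(2)[where y = "2 * L * 0"]) auto
  then obtain K where K: "2 * L * \<beta> ^ K < \<epsilon> / 2"
    by (auto simp: eventually_sequentially)
  obtain e where e: "e \<longlonglongrightarrow> 0" "\<And>B L F r. cls B L F \<Longrightarrow>
      \<bar>W F r - q r * \<Psi> F r\<bar> \<le> q r * (2 * L * real r * \<beta> ^ K + (B + L * real r) * e r)"
    using contraction[of K] unfolding \<beta>_def[symmetric] by blast
  have "(\<lambda>r. (B + L) * e r) \<longlonglongrightarrow> (B + L) * 0" by (intro tendsto_intros e)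
  then have "\<forall>\<^sub>F r in sequentially. (B + L) * e r < \<epsilon> / 2"
    using \<epsilon> by (intro order_tendstoD(2)[where y = "(B + L) * 0"]) auto
  moreover have "\<forall>\<^sub>F r in sequentially. q r * real r powr (1 - a) > 0"
    using order_tendstoD(1)[OF qlim C] .
  ultimately have "\<forall>\<^sub>F n in sequentially. norm (W (F n) n / q n - \<Psi> (F n) n - 0) < \<epsilon>"
    using eventually_gt_at_top[of 0]
  proof eventually_elim
    case (elim n)
    then have qn: "q n > 0" using q[of n] by (auto simp: zero_less_mult_iff)
    have "W (F n) n / q n - \<Psi> (F n) n = (W (F n) n - q n * \<Psi> (F n) n) / q n"
      using qn by (simp add: diff_divide_distrib)
    also have "\<bar>\<dots>\<bar> \<le> q n * (2 * (L / real n) * real n * \<beta> ^ K + (B + L / real n * real n) * e n) / q n"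
      using elim by (intro abs_divide_le e(2)[OF F] qn) auto
    also have "\<dots> = 2 * L * \<beta> ^ K + (B + L) * e n"
      using qn elim by simp
    also have "\<dots> < \<epsilon>" using K elim by linarith
    finally show ?case by simp
  qed
  then show "\<exists>no. \<forall>n\<ge>no. norm (W (F n) n / q n - \<Psi> (F n) n - 0) < \<epsilon>"
    by (simp add: eventually_sequentially)
qed

end

section \<open>Order statistics and decreasing rearrangements\<close>

definition clip01 :: "real \<Rightarrow> real" where "clip01 x = max 0 (min 1 x)"

lemma clip01_bounds: "0 \<le> clip01 x" "clip01 x \<le> 1"
  by (auto simp: clip01_def)

lemma clip01_mono: "x \<le> y \<Longrightarrow> clip01 x \<le> clip01 y"
  by (auto simp: clip01_def)

lemma clip01_lipschitz: "\<bar>x - y\<bar> \<le> \<delta> \<Longrightarrow> \<bar>clip01 x - clip01 y\<bar> \<le> \<delta>"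
  by (auto simp: clip01_def)

lemma clip01_id: "0 \<le> x \<Longrightarrow> x \<le> 1 \<Longrightarrow> clip01 x = x"
  by (auto simp: clip01_def)

lemma clip01_measurable [measurable]: "clip01 \<in> borel_measurable borel"
  unfolding clip01_def[abs_def] by measurable

text \<open>
  The order statistics of a sequence with values clipped to the unit interval. Unlike
  \<open>sort_decreasing\<close> they are defined and Lipschitz on all sequences.
\<close>

definition order_stat :: "(nat \<Rightarrow> real) \<Rightarrow> nat \<Rightarrow> real" where
  "order_stat g j = (SUP F\<in>{F. finite F \<and> card F = Suc j}. Min ((\<lambda>i. clip01 (g i)) ` F))"

text \<open>Lying above t is a counting statement: at least j + 1 entries exceed t. Bounds,
  Lipschitz continuity, invariance and measurability are all read off from this form.\<close>

lemma less_order_stat_iff: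
  "t < order_stat g j \<longleftrightarrow> (\<exists>F\<in>{F. finite F \<and> card F = Suc j}. \<forall>i\<in>F. t < clip01 (g i))"
proof -
  have Min: "t < Min ((\<lambda>i. clip01 (g i)) ` F) \<longleftrightarrow> (\<forall>i\<in>F. t < clip01 (g i))"
    if "finite F" "card F = Suc j" for F t
    using that by (subst Min_gr_iff) auto
  have "bdd_above ((\<lambda>F. Min ((\<lambda>i. clip01 (g i)) ` F)) ` {F. finite F \<and> card F = Suc j})"
  proof (rule bdd_aboveI2)
    fix F assume F: "F \<in> {F :: nat set. finite F \<and> card F = Suc j}"
    then obtain i where "i \<in> F" by (auto simp: card_Suc_eq)
    with F have "Min ((\<lambda>i. clip01 (g i)) ` F) \<le> clip01 (g i)" by (intro Min_le) auto
    then show "Min ((\<lambda>i. clip01 (g i)) ` F) \<le> 1" using clip01_bounds(2)[of "g i"] by linarith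
  qed
  moreover have "{..j} \<in> {F. finite F \<and> card F = Suc j}" by simp
  ultimately have "t < order_stat g j \<longleftrightarrow>
      (\<exists>F\<in>{F. finite F \<and> card F = Suc j}. t < Min ((\<lambda>i. clip01 (g i)) ` F))"
    unfolding order_stat_def by (intro less_cSUP_iff) blast+
  then show ?thesis using Min by simp
qed

lemma order_stat_bounds: "0 \<le> order_stat g j" "order_stat g j \<le> 1"
proof -
  show "order_stat g j \<le> 1"
  proof (rule ccontr)
    assume "\<not> order_stat g j \<le> 1"
    then have "1 < order_stat g j" by simp
    from less_order_stat_iff[THEN iffD1, OF this]
    obtain F where F: "card F = Suc j" "\<forall>i\<in>F. 1 < clip01 (g i)" by blast
    then obtain i where "i \<in> F" by (auto simp: card_Suc_eq)
    then show False using F clip01_bounds(2)[of "g i"] by force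
  qed
  show "0 \<le> order_stat g j"
  proof (rule ccontr)
    assume "\<not> 0 \<le> order_stat g j"
    then have "\<forall>i\<in>{..j}. order_stat g j < clip01 (g i)"
      using clip01_bounds(1) by (meson less_le_trans not_le)
    then have "\<exists>F\<in>{F. finite F \<and> card F = Suc j}. \<forall>i\<in>F. order_stat g j < clip01 (g i)"
      by (intro bexI[of _ "{..j}"]) auto
    then have "order_stat g j < order_stat g j" by (rule less_order_stat_iff[THEN iffD2])
    then show False by simp
  qed
qed

lemma order_stat_le_add:
  assumes "\<And>i. \<bar>g i - g' i\<bar> \<le> \<delta>"
  shows "order_stat g j \<le> order_stat g' j + \<delta>"
proof (rule ccontr)
  assume "\<not> order_stat g j \<le> order_stat g' j + \<delta>"
  then have "order_stat g' j + \<delta> < order_stat g j" by simp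
  then obtain F where F: "finite F" "card F = Suc j" "\<forall>i\<in>F. order_stat g' j + \<delta> < clip01 (g i)"
    unfolding less_order_stat_iff by auto
  have "order_stat g' j < clip01 (g' i)" if "i \<in> F" for i
    using clip01_lipschitz[OF assms[of i]] F(3) that by force
  then have "order_stat g' j < order_stat g' j"
    unfolding less_order_stat_iff[of "order_stat g' j"] using F by blast
  then show False by simp
qed

lemma order_stat_lipschitz:
  assumes "\<And>i. \<bar>g i - g' i\<bar> \<le> \<delta>"
  shows "\<bar>order_stat g j - order_stat g' j\<bar> \<le> \<delta>"
  using order_stat_le_add[of g g' \<delta> j] order_stat_le_add[of g' g \<delta> j] assms
  by (simp add: abs_le_iff abs_minus_commute)

lemma ex_card_bij_iff:
  assumes "bij p"
  shows "(\<exists>F\<in>{F. finite F \<and> card F = n}. \<forall>i\<in>F. P (p i)) \<longleftrightarrow> (\<exists>F\<in>{F. finite F \<and> card F = n}. \<forall>i\<in>F. P i)"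
proof
  have inj: "inj p" and surj: "surj p" using assms by (auto simp: bij_def)
  assume "\<exists>F\<in>{F. finite F \<and> card F = n}. \<forall>i\<in>F. P (p i)"
  then obtain F where "finite F" "card F = n" "\<forall>i\<in>F. P (p i)" by auto
  then show "\<exists>F\<in>{F. finite F \<and> card F = n}. \<forall>i\<in>F. P i"
    using inj by (intro bexI[of _ "p ` F"]) (auto simp: card_image inj_on_subset)
next
  have inj: "inj (inv p)" and surj: "surj p" using assms bij_imp_bij_inv[OF assms] by (auto simp: bij_def)
  assume "\<exists>F\<in>{F. finite F \<and> card F = n}. \<forall>i\<in>F. P i"
  then obtain F where "finite F" "card F = n" "\<forall>i\<in>F. P i" by auto
  then show "\<exists>F\<in>{F. finite F \<and> card F = n}. \<forall>i\<in>F. P (p i)"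
    using inj surj by (intro bexI[of _ "inv p ` F"]) (auto simp: card_image inj_on_subset surj_f_inv_f)
qed

lemma order_stat_comp_bij:
  assumes "bij p" shows "order_stat (g \<circ> p) = order_stat g"
proof
  fix j
  have "t < order_stat (g \<circ> p) j \<longleftrightarrow> t < order_stat g j" for t
    unfolding less_order_stat_iff comp_def by (rule ex_card_bij_iff[OF assms])
  then show "order_stat (g \<circ> p) j = order_stat g j"
    by (metis less_irrefl linorder_less_linear)
qed

lemma less_decseq_iff:
  fixes x :: "nat \<Rightarrow> 'a :: linorder"
  assumes "decseq x"
  shows "t < x j \<longleftrightarrow> (\<exists>F\<in>{F. finite F \<and> card F = Suc j}. \<forall>i\<in>F. t < x i)"
proof
  assume "t < x j"
  then have "\<forall>i\<in>{..j}. t < x i" using assms by (auto simp: decseq_def intro: less_le_trans)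
  then show "\<exists>F\<in>{F. finite F \<and> card F = Suc j}. \<forall>i\<in>F. t < x i"
    by (intro bexI[of _ "{..j}"]) auto
next
  assume "\<exists>F\<in>{F. finite F \<and> card F = Suc j}. \<forall>i\<in>F. t < x i"
  then obtain F where F: "finite F" "card F = Suc j" "\<forall>i\<in>F. t < x i" by auto
  have "\<not> F \<subseteq> {..<j}" using card_mono[of "{..<j}" F] F by auto
  then obtain i where "i \<in> F" "j \<le> i" by force
  then show "t < x j" using F(3) assms by (auto simp: decseq_def intro: less_le_trans)
qed

lemma order_stat_decseq:
  assumes "decseq x" shows "order_stat x j = clip01 (x j)"
proof -
  have "decseq (\<lambda>i. clip01 (x i))" using assms by (auto simp: decseq_def intro: clip01_mono)
  then have "t < order_stat x j \<longleftrightarrow> t < clip01 (x j)" for t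
    unfolding less_order_stat_iff by (rule less_decseq_iff[symmetric])
  then show ?thesis by (metis less_irrefl linorder_less_linear)
qed

text \<open>Finite sets are enumerated by distinct lists: the type \<open>nat list\<close> is
  countable while \<open>nat set\<close> is not, and measurability requires a countable
  union.\<close>

lemma pred_ex_finite_card:
  fixes P :: "'b \<Rightarrow> nat \<Rightarrow> bool"
  assumes [measurable]: "\<And>i. Measurable.pred M (\<lambda>x. P x i)"
  shows "Measurable.pred M (\<lambda>x. \<exists>F\<in>{F. finite F \<and> card F = n}. \<forall>i\<in>F. P x i)"
proof -
  have "(\<exists>F\<in>{F. finite F \<and> card F = n}. \<forall>i\<in>F. P x i) \<longleftrightarrow>
      (\<exists>xs\<in>{xs. distinct xs \<and> length xs = n}. \<forall>i\<in>set xs. P x i)" for x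
  proof
    assume "\<exists>F\<in>{F. finite F \<and> card F = n}. \<forall>i\<in>F. P x i"
    then obtain F where "finite F" "card F = n" "\<forall>i\<in>F. P x i" by blast
    moreover obtain xs where "set xs = F" "distinct xs"
      using finite_distinct_list[OF \<open>finite F\<close>] by blast
    ultimately show "\<exists>xs\<in>{xs. distinct xs \<and> length xs = n}. \<forall>i\<in>set xs. P x i"
      using distinct_card[of xs] by (intro bexI[of _ xs]) auto
  next
    assume "\<exists>xs\<in>{xs. distinct xs \<and> length xs = n}. \<forall>i\<in>set xs. P x i"
    then obtain xs where "distinct xs" "length xs = n" "\<forall>i\<in>set xs. P x i" by blast
    then show "\<exists>F\<in>{F. finite F \<and> card F = n}. \<forall>i\<in>F. P x i"
      by (intro bexI[of _ "set xs"]) (auto simp: distinct_card)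
  qed
  then show ?thesis by simp
qed

lemma order_stat_measurable [measurable]:
  "(\<lambda>g. order_stat g j) \<in> borel_measurable (PiM UNIV (\<lambda>_. borel))"
  unfolding borel_measurable_iff_greater less_order_stat_iff
  by (intro allI predE pred_ex_finite_card) measurable

section \<open>Existence, uniqueness and measurability of non-increasing rearrangements\<close>

text \<open>The exact condition for a non-increasing rearrangement to exist, as the next two lemmas
  show. Unlike the existence of a bijection it is visibly measurable.\<close>

definition sortable :: "(nat \<Rightarrow> real) \<Rightarrow> bool" where
  "sortable g \<longleftrightarrow> (\<forall>i. finite {j. g i < g j})"

lemma sortableI_decseq:
  assumes p: "bij p" and dec: "decseq (g \<circ> p)"
  shows "sortable g"
  unfolding sortable_def
proof
  fix i
  have "{j. g i < g j} \<subseteq> p ` {..<inv p i}"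
  proof
    fix j assume j: "j \<in> {j. g i < g j}"
    have surj: "surj p" using p by (simp add: bij_def)
    have "inv p j < inv p i"
    proof (rule ccontr)
      assume "\<not> inv p j < inv p i"
      then have "(g \<circ> p) (inv p j) \<le> (g \<circ> p) (inv p i)" using dec by (auto simp: decseq_def)
      then show False using j by (simp add: surj_f_inv_f[OF surj])
    qed
    then show "j \<in> p ` {..<inv p i}"
      using surj_f_inv_f[OF surj, of j] by (metis imageI lessThan_iff)
  qed
  then show "finite {j. g i < g j}" by (rule finite_subset) simp
qed

text \<open>Breaking ties by the index gives a strict total order with finite initial segments. The
  rank is injective with infinite, downward closed range, hence a bijection, and its inverse lists
  the entries in order.\<close>

lemma sortable_imp_decseq:
  assumes "sortable g"
  obtains p where "bij p" "decseq (g \<circ> p)"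
proof -
  define prec where "prec j i \<longleftrightarrow> g i < g j \<or> (g i = g j \<and> j < i)" for j i
  have irrefl: "\<not> prec i i" for i by (auto simp: prec_def)
  have trans: "prec k j \<Longrightarrow> prec j i \<Longrightarrow> prec k i" for i j k by (auto simp: prec_def)
  have total: "i \<noteq> j \<Longrightarrow> prec i j \<or> prec j i" for i j by (auto simp: prec_def)
  define D where "D i = {j. prec j i}" for i
  have fin: "finite (D i)" for i
  proof -
    have "D i \<subseteq> {j. g i < g j} \<union> {..<i}" by (auto simp: D_def prec_def)
    then show ?thesis by (rule finite_subset) (use assms in \<open>auto simp: sortable_def\<close>)
  qed
  define rank where "rank i = card (D i)" for i
  have rank_less: "prec j i \<Longrightarrow> rank j < rank i" for i j
    unfolding rank_def
  proof (intro psubset_card_mono fin psubsetI subsetI)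
    assume "prec j i"
    then show "k \<in> D i" if "k \<in> D j" for k using that trans[of k j i] by (simp add: D_def)
    show "D j \<noteq> D i" using \<open>prec j i\<close> irrefl[of j] unfolding D_def by blast
  qed
  have inj: "inj rank"
  proof (rule injI)
    fix i j assume "rank i = rank j"
    then show "i = j" using rank_less[of i j] rank_less[of j i] total[of i j] by auto
  qed
  have pred: "\<exists>j. rank j = m" if "rank i = Suc m" for i m
  proof -
    have "\<exists>j\<in>D i. \<forall>k\<in>D i. rank k \<le> rank j"
    proof -
      have "D i \<noteq> {}" using that by (auto simp: rank_def)
      then have "Max (rank ` D i) \<in> rank ` D i" using fin by (intro Max_in) auto
      then show ?thesis using fin by (metis (no_types, lifting) Max_ge finite_imageI image_iff)
    qed
    then obtain j where j: "prec j i" "\<And>k. prec k i \<Longrightarrow> rank k \<le> rank j"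
      by (auto simp: D_def)
    \<comment> \<open>As j has maximal rank among the predecessors of i, nothing lies strictly
      between j and i; so the ranks have no gaps.\<close>
    have "D i = insert j (D j)"
    proof (intro equalityI subsetI)
      fix k assume "k \<in> D i"
      then have "prec k i" by (simp add: D_def)
      then have "\<not> prec j k" using j(2)[of k] rank_less[of j k] by auto
      then show "k \<in> insert j (D j)" using total[of j k] by (auto simp: D_def)
    next
      fix k assume "k \<in> insert j (D j)"
      then show "k \<in> D i" using j trans by (auto simp: D_def)
    qed
    then have "rank i = Suc (rank j)"
      unfolding rank_def using fin irrefl by (simp add: D_def)
    then show ?thesis using that by auto
  qed
  have down: "n \<le> rank i \<Longrightarrow> \<exists>j. rank j = n" for n i
  proof (induction "rank i - n" arbitrary: n)
    case (Suc d)
    then have "\<exists>j. rank j = Suc n" using Suc(1)[of "Suc n"] by auto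
    then show ?case using pred by blast
  qed auto
  have "surj rank"
  proof -
    have "\<exists>i. n \<le> rank i" for n
    proof (rule ccontr)
      assume "\<nexists>i. n \<le> rank i"
      then have "range rank \<subseteq> {..<n}" by (auto simp: not_le)
      then have "finite (range rank)" by (rule finite_subset) simp
      then show False using inj by (simp add: finite_image_iff)
    qed
    then show ?thesis using down by (metis surjI)
  qed
  with inj have bij: "bij rank" by (simp add: bij_def)
  show ?thesis
  proof (rule that[of "inv rank"])
    show "bij (inv rank)" by (rule bij_imp_bij_inv[OF bij])
    show "decseq (g \<circ> inv rank)"
      unfolding decseq_def
    proof (intro allI impI)
      fix m n :: nat assume "m \<le> n"
      then have "rank (inv rank m) \<le> rank (inv rank n)"
        using \<open>surj rank\<close> by (simp add: surj_f_inv_f)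
      then have "\<not> prec (inv rank n) (inv rank m)" using rank_less[of "inv rank n" "inv rank m"] by auto
      then show "(g \<circ> inv rank) n \<le> (g \<circ> inv rank) m" by (auto simp: prec_def)
    qed
  qed
qed

lemma less_decseq_rearrangement_iff:
  fixes g :: "nat \<Rightarrow> real"
  assumes "bij p" "decseq (g \<circ> p)"
  shows "t < (g \<circ> p) j \<longleftrightarrow> (\<exists>F\<in>{F. finite F \<and> card F = Suc j}. \<forall>i\<in>F. t < g i)"
  using less_decseq_iff[OF assms(2), of t j] ex_card_bij_iff[OF assms(1), of "Suc j" "\<lambda>i. t < g i"]
  unfolding comp_def by (rule trans)

text \<open>Whether the j-th entry of such a rearrangement exceeds t depends only on how many
  entries of g exceed t, so any two rearrangements agree.\<close>

lemma sort_decreasing_eq: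
  assumes p: "bij p" and dec: "decseq (g \<circ> p)"
  shows "sort_decreasing g = g \<circ> p"
  unfolding sort_decreasing_def
proof (rule the_equality)
  show "decseq (g \<circ> p) \<and> (\<exists>p'. bij p' \<and> g \<circ> p = g \<circ> p')" using assms by blast
next
  fix x assume "decseq x \<and> (\<exists>p. bij p \<and> x = g \<circ> p)"
  then obtain p' where p': "bij p'" "x = g \<circ> p'" "decseq (g \<circ> p')" by blast
  have "t < (g \<circ> p') j \<longleftrightarrow> t < (g \<circ> p) j" for t j
    using less_decseq_rearrangement_iff[OF p dec] less_decseq_rearrangement_iff[OF p'(1,3)] by simp
  then have "(g \<circ> p') j = (g \<circ> p) j" for j by (metis less_irrefl linorder_less_linear)
  then show "x = g \<circ> p" using p'(2) by auto
qed

lemma order_stat_eq_sort_decreasing: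
  assumes "sortable g" and "\<And>i. 0 \<le> g i" "\<And>i. g i \<le> 1"
  shows "order_stat g = sort_decreasing g"
proof -
  obtain p where p: "bij p" "decseq (g \<circ> p)" using sortable_imp_decseq[OF assms(1)] .
  have "order_stat g j = (g \<circ> p) j" for j
    using order_stat_decseq[OF p(2), of j] assms(2,3) by (simp add: order_stat_comp_bij[OF p(1)] clip01_id)
  then show ?thesis using sort_decreasing_eq[OF p] by auto
qed

text \<open>For an unsortable g the description operator is applied to the empty predicate, whatever
  g is. The second case thus compares t with a constant, which is what measurability needs.\<close>

lemma less_sort_decreasing_iff:
  "t < sort_decreasing g j \<longleftrightarrow>
     (sortable g \<and> (\<exists>F\<in>{F. finite F \<and> card F = Suc j}. \<forall>i\<in>F. t < g i)) \<or>
     (\<not> sortable g \<and> t < (THE x :: nat \<Rightarrow> real. False) j)"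
proof (cases "sortable g")
  case True
  then obtain p where p: "bij p" "decseq (g \<circ> p)" using sortable_imp_decseq by blast
  show ?thesis
    using True less_decseq_rearrangement_iff[OF p] sort_decreasing_eq[OF p] by simp
next
  case False
  then have "\<not> (decseq x \<and> (\<exists>p. bij p \<and> x = g \<circ> p))" for x
    using sortableI_decseq[of _ g] by auto
  then have "sort_decreasing g = (THE x. False)"
    unfolding sort_decreasing_def by (intro arg_cong[where f = The] ext) simp
  with False show ?thesis by simp
qed

lemma pred_sortable [measurable]: "Measurable.pred (PiM UNIV (\<lambda>_. borel)) sortable"
proof -
  have "sortable g \<longleftrightarrow> (\<forall>i. \<exists>n. \<forall>j. g i < g j \<longrightarrow> j < n)" for g
    by (auto simp: sortable_def finite_nat_set_iff_bounded)
  then have "sortable = (\<lambda>g. \<forall>i. \<exists>n. \<forall>j. g i < g j \<longrightarrow> j < n)" by auto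
  moreover have "Measurable.pred (PiM UNIV (\<lambda>_. borel)) (\<lambda>g :: nat \<Rightarrow> real. \<forall>i. \<exists>n. \<forall>j. g i < g j \<longrightarrow> j < n)"
    by measurable
  ultimately show ?thesis by simp
qed

lemma sort_decreasing_measurable [measurable]:
  "sort_decreasing \<in> PiM UNIV (\<lambda>_. borel) \<rightarrow>\<^sub>M PiM UNIV (\<lambda>_. borel)"
proof (rule measurable_PiM_single')
  fix j :: nat
  have [measurable]: "Measurable.pred (PiM UNIV (\<lambda>_. borel))
      (\<lambda>g :: nat \<Rightarrow> real. \<exists>F\<in>{F. finite F \<and> card F = Suc j}. \<forall>i\<in>F. t < g i)" for t
    by (intro pred_ex_finite_card) measurable
  show "(\<lambda>g. sort_decreasing g j) \<in> borel_measurable (PiM UNIV (\<lambda>_. borel))"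
    unfolding borel_measurable_iff_greater less_sort_decreasing_iff
    by (intro allI predE) measurable
qed simp

section \<open>The stick-breaking sequence\<close>

text \<open>The sticks in order of breaking, hence the GEM law for s = 1. The initial length s
  allows the remainder after one break to be of the same form.\<close>

definition gem :: "real \<Rightarrow> real \<Rightarrow> (nat \<Rightarrow> real) \<Rightarrow> nat \<Rightarrow> real" where
  "gem a s u = (\<lambda>i. s * stick_breaking (\<lambda>j. u j powr (1 / a)) i)"

abbreviation unif :: "real measure" where
  "unif \<equiv> uniform_measure lborel {0..1}"

abbreviation unif_seq :: "(nat \<Rightarrow> real) measure" where
  "unif_seq \<equiv> PiM UNIV (\<lambda>_. unif)"

lemma prob_space_unif: "prob_space unif"
  by (intro prob_space_uniform_measure) auto

interpretation unif: prob_space unif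
  by (rule prob_space_unif)

interpretation unif_seq: sequence_space unif
  by unfold_locales

lemma sets_unif_seq [measurable_cong]: "sets unif_seq = sets (PiM UNIV (\<lambda>_. borel))"
  by (intro sets_PiM_cong) auto

lemma space_unif_seq [simp]: "space unif_seq = UNIV"
  by (simp add: space_PiM)

lemma stick_breaking_case_nat:
  "stick_breaking (case_nat x v) = case_nat (1 - x) (\<lambda>i. x * stick_breaking v i)"
proof
  fix i show "stick_breaking (case_nat x v) i = case_nat (1 - x) (\<lambda>i. x * stick_breaking v i) i"
    by (cases i) (simp_all add: stick_breaking_def prod.lessThan_Suc_shift mult.assoc del: prod.lessThan_Suc)
qed

text \<open>Self-similarity: after the first break the remainder is broken by the remaining uniforms
  in the same way. This is the exact recursion that the objects satisfy only approximately.\<close>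

lemma gem_case_nat:
  "gem a s (case_nat x u) = case_nat (s * (1 - x powr (1 / a))) (gem a (s * x powr (1 / a)) u)"
proof -
  have "(\<lambda>j. case_nat x u j powr (1 / a)) = case_nat (x powr (1 / a)) (\<lambda>j. u j powr (1 / a))"
    by (auto simp: fun_eq_iff split: nat.splits)
  then show ?thesis
    by (auto simp: gem_def stick_breaking_case_nat fun_eq_iff split: nat.splits)
qed

lemma gem_measurable [measurable]: "gem a s \<in> PiM UNIV (\<lambda>_. borel) \<rightarrow>\<^sub>M PiM UNIV (\<lambda>_. borel)"
proof (rule measurable_PiM_single')
  have [measurable]: "(\<lambda>u :: nat \<Rightarrow> real. u i) \<in> borel_measurable (PiM UNIV (\<lambda>_. borel))" for i
    by (rule measurable_component_singleton) simp
  show "(\<lambda>u. gem a s u i) \<in> borel_measurable (PiM UNIV (\<lambda>_. borel))" for i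
    unfolding gem_def stick_breaking_def by measurable
qed auto

lemma AE_unif: "AE x in unif. 0 < x \<and> x < 1"
proof -
  have "AE x in lborel. x \<noteq> (0 :: real) \<and> x \<noteq> 1"
    using AE_lborel_singleton[of 0] AE_lborel_singleton[of 1] by eventually_elim simp
  then show ?thesis
    by (subst AE_uniform_measure) (auto simp: less_le)
qed

lemma AE_unif_seq: "AE u in unif_seq. \<forall>i. 0 < u i \<and> u i < 1"
  unfolding AE_all_countable
  by (intro allI AE_PiM_component[where P = "\<lambda>x. 0 < x \<and> x < 1"] prob_space_unif AE_unif) auto

lemma stick_breaking_bounds:
  assumes "\<And>i. 0 < v i \<and> v i < 1"
  shows "0 < stick_breaking v i" "stick_breaking v i \<le> (\<Prod>j<i. v j)" "stick_breaking v i \<le> 1"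
proof -
  have v: "0 < v i" "v i < 1" for i using assms by auto
  have prod: "0 < (\<Prod>j<i. v j)" "(\<Prod>j<i. v j) \<le> 1"
    using v by (intro prod_pos, simp) (use v in \<open>auto intro!: prod_le_1 simp: less_imp_le\<close>)
  show "0 < stick_breaking v i" using prod v[of i] by (simp add: stick_breaking_def)
  have "stick_breaking v i \<le> (\<Prod>j<i. v j) * 1"
    unfolding stick_breaking_def using prod v[of i] by (intro mult_left_mono) auto
  then show "stick_breaking v i \<le> (\<Prod>j<i. v j)" by simp
  with prod show "stick_breaking v i \<le> 1" by linarith
qed

lemma powr_root_bounds: "a > 0 \<Longrightarrow> 0 < x \<Longrightarrow> x < 1 \<Longrightarrow> 0 < x powr (1 / a) \<and> x powr (1 / a) < (1 :: real)"
  using powr_less_mono2[of "1 / a" x 1] by auto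

lemma AE_stick_breaking_bounds:
  assumes "a > 0"
  shows "AE u in unif_seq. \<forall>i. 0 < stick_breaking (\<lambda>j. u j powr (1 / a)) i \<and>
     stick_breaking (\<lambda>j. u j powr (1 / a)) i \<le> (\<Prod>j<i. u j powr (1 / a)) \<and> stick_breaking (\<lambda>j. u j powr (1 / a)) i \<le> 1"
  using AE_unif_seq
proof eventually_elim
  case (elim u)
  then have "0 < u i powr (1 / a) \<and> u i powr (1 / a) < 1" for i
    using powr_root_bounds[OF assms] by blast
  then show ?case using stick_breaking_bounds[of "\<lambda>i. u i powr (1 / a)"] by auto
qed

lemma case_nat_pair_measurable [measurable]:
  "(\<lambda>(x, u). case_nat x u) \<in> borel \<Otimes>\<^sub>M PiM UNIV (\<lambda>_. borel) \<rightarrow>\<^sub>M PiM UNIV (\<lambda>_. borel :: real measure)"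
  by (intro measurable_PiM_single') (auto split: nat.split simp: case_prod_beta intro!: measurable_snd')

lemma nn_integral_unif_powr:
  assumes "p \<ge> 0"
  shows "(\<integral>\<^sup>+x. ennreal (x powr p) \<partial>unif) = ennreal (1 / (p + 1))"
proof -
  have "((\<lambda>x. x powr p) has_integral (1 powr (p + 1) / (p + 1))) {0..1}"
    using assms by (intro has_integral_powr_from_0) auto
  then have "(\<integral>\<^sup>+x\<in>{0..1}. ennreal (x powr p) \<partial>lborel) = ennreal (1 / (p + 1))"
    using nn_integral_has_integral_lebesgue[of "{0..1}" "\<lambda>x. x powr p"]
    by (subst nn_integral_cong[of lborel _ "\<lambda>x. ennreal (x powr p * indicator {0..1} x)"])
       (auto simp: mult.commute split: split_indicator)
  then show ?thesis
    using assms divide_ennreal[of "1 / (p + 1)" 1] by (subst nn_integral_uniform_measure) auto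
qed

lemma nn_integral_unif_seq_iter:
  assumes [measurable]: "f \<in> borel_measurable (PiM UNIV (\<lambda>_. borel))"
  shows "(\<integral>\<^sup>+u. f u \<partial>unif_seq) = (\<integral>\<^sup>+x. \<integral>\<^sup>+u. f (case_nat x u) \<partial>unif_seq \<partial>unif)"
proof -
  have [measurable]: "(\<lambda>p. f (case_nat (fst p) (snd p))) \<in> borel_measurable (unif \<Otimes>\<^sub>M unif_seq)"
    using measurable_compose[OF case_nat_pair_measurable assms]
    by (simp add: case_prod_beta cong: measurable_cong_sets)
  have "(\<integral>\<^sup>+u. f u \<partial>unif_seq) = (\<integral>\<^sup>+u. f u \<partial>distr (unif \<Otimes>\<^sub>M unif_seq) unif_seq (\<lambda>(x, u). case_nat x u))"
    by (simp add: unif_seq.PiM_iter)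
  also have "\<dots> = (\<integral>\<^sup>+p. f (case_nat (fst p) (snd p)) \<partial>(unif \<Otimes>\<^sub>M unif_seq))"
    by (subst nn_integral_distr) (auto simp: case_prod_beta)
  also have "\<dots> = (\<integral>\<^sup>+x. \<integral>\<^sup>+u. f (case_nat x u) \<partial>unif_seq \<partial>unif)"
    by (subst unif_seq.P.nn_integral_fst[symmetric]) auto
  finally show ?thesis .
qed

section \<open>Symmetric Lipschitz functions and their stick-breaking expectations\<close>

text \<open>The Lipschitz condition is for the supremum distance on all real sequences, so that
  shifting and rescaling never leave the domain; symmetry makes the order of removal
  invisible.\<close>

definition sym_lipschitz :: "real \<Rightarrow> real \<Rightarrow> ((nat \<Rightarrow> real) \<Rightarrow> real) \<Rightarrow> bool" where
  "sym_lipschitz B L F \<longleftrightarrow>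
     F \<in> borel_measurable (PiM UNIV (\<lambda>_. borel)) \<and> (\<forall>g. \<bar>F g\<bar> \<le> B) \<and>
     (\<forall>g g' \<delta>. (\<forall>i. \<bar>g i - g' i\<bar> \<le> \<delta>) \<longrightarrow> \<bar>F g - F g'\<bar> \<le> L * \<delta>) \<and>
     (\<forall>g p. bij p \<longrightarrow> F (g \<circ> p) = F g)"

lemma sym_lipschitzD:
  assumes "sym_lipschitz B L F"
  shows "F \<in> borel_measurable (PiM UNIV (\<lambda>_. borel))" "\<bar>F g\<bar> \<le> B"
    "(\<And>i. \<bar>g i - g' i\<bar> \<le> \<delta>) \<Longrightarrow> \<bar>F g - F g'\<bar> \<le> L * \<delta>"
    "bij p \<Longrightarrow> F (g \<circ> p) = F g"
  using assms unfolding sym_lipschitz_def by blast+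

lemma sym_lipschitz_nonneg:
  assumes "sym_lipschitz B L F" shows "0 \<le> B" "0 \<le> L"
  using sym_lipschitzD(2)[OF assms, of "\<lambda>_. 0"] sym_lipschitzD(3)[OF assms, of "\<lambda>_. 0" "\<lambda>_. 0" 1] by auto

lemma bij_case_nat:
  assumes "bij p" shows "bij (case_nat 0 (\<lambda>i. Suc (p i)))"
proof (rule bijI)
  show "inj (case_nat 0 (\<lambda>i. Suc (p i)))"
  proof (rule injI)
    fix x y assume "case_nat 0 (\<lambda>i. Suc (p i)) x = case_nat 0 (\<lambda>i. Suc (p i)) y"
    then show "x = y" using bij_is_inj[OF assms] by (cases x; cases y) (auto dest: injD)
  qed
  show "surj (case_nat 0 (\<lambda>i. Suc (p i)))"
  proof (rule surjI)
    fix n show "case_nat 0 (\<lambda>i. Suc (p i)) (case_nat 0 (\<lambda>i. Suc (inv p i)) n) = n"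
      using bij_is_surj[OF assms] by (cases n) (auto simp: surj_f_inv_f)
  qed
qed

lemma case_nat_measurable' [measurable]:
  "case_nat c \<in> PiM UNIV (\<lambda>_. borel) \<rightarrow>\<^sub>M PiM UNIV (\<lambda>_. borel :: real measure)"
proof (rule measurable_PiM_single')
  show "(\<lambda>g. case_nat c g i) \<in> borel_measurable (PiM UNIV (\<lambda>_. borel))" for i
    by (cases i) auto
qed auto

text \<open>Prepending a common coordinate leaves the supremum distance unchanged, and a permutation
  of the old indices extends to one that fixes the new index 0.\<close>

lemma sym_lipschitz_case_nat:
  assumes "sym_lipschitz B L F"
  shows "sym_lipschitz B L (\<lambda>g. F (case_nat c g))"
  unfolding sym_lipschitz_def
proof (intro conjI allI impI)
  note [measurable] = sym_lipschitzD(1)[OF assms]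
  show "(\<lambda>g. F (case_nat c g)) \<in> borel_measurable (PiM UNIV (\<lambda>_. borel))" by measurable
  show "\<bar>F (case_nat c g)\<bar> \<le> B" for g by (rule sym_lipschitzD(2)[OF assms])
  show "\<bar>F (case_nat c g) - F (case_nat c g')\<bar> \<le> L * \<delta>" if "\<forall>i. \<bar>g i - g' i\<bar> \<le> \<delta>" for g g' \<delta>
  proof (rule sym_lipschitzD(3)[OF assms])
    have "0 \<le> \<delta>" using that by (meson abs_ge_zero order_trans)
    then show "\<bar>case_nat c g i - case_nat c g' i\<bar> \<le> \<delta>" for i
      using that by (auto split: nat.split)
  qed
  show "F (case_nat c (g \<circ> p)) = F (case_nat c g)" if "bij p" for g p
  proof -
    have "case_nat c (g \<circ> p) = case_nat c g \<circ> case_nat 0 (\<lambda>i. Suc (p i))"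
      by (auto simp: fun_eq_iff split: nat.splits)
    then show ?thesis using sym_lipschitzD(4)[OF assms bij_case_nat[OF that]] by simp
  qed
qed

definition gem_expectation :: "real \<Rightarrow> ((nat \<Rightarrow> real) \<Rightarrow> real) \<Rightarrow> real \<Rightarrow> real" where
  "gem_expectation a F s = (\<integral>u. F (gem a s u) \<partial>unif_seq)"

lemma gem_measurable' [measurable]: "gem a s \<in> unif_seq \<rightarrow>\<^sub>M PiM UNIV (\<lambda>_. borel)"
  using gem_measurable by (simp cong: measurable_cong_sets)

lemma gem_integrable:
  assumes "sym_lipschitz B L F" shows "integrable unif_seq (\<lambda>u. F (gem a s u))"
  using measurable_compose[OF gem_measurable' sym_lipschitzD(1)[OF assms]] sym_lipschitzD(2)[OF assms]
  by (intro unif_seq.P.integrable_const_bound[where B = B]) auto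

lemma gem_expectation_bound:
  assumes "sym_lipschitz B L F" shows "\<bar>gem_expectation a F s\<bar> \<le> B"
proof -
  have "\<bar>gem_expectation a F s\<bar> \<le> (\<integral>u. \<bar>F (gem a s u)\<bar> \<partial>unif_seq)"
    unfolding gem_expectation_def by (rule integral_abs_bound)
  also have "\<dots> \<le> (\<integral>u. B \<partial>unif_seq)"
    using gem_integrable[OF assms] sym_lipschitzD(2)[OF assms] by (intro integral_mono) auto
  also have "\<dots> = B" using unif_seq.P.prob_space by simp
  finally show ?thesis .
qed

lemma gem_expectation_diff_le:
  assumes F: "sym_lipschitz B L F" and F': "sym_lipschitz B' L' F'"
    and le: "AE u in unif_seq. \<bar>F (gem a s u) - F' (gem a s' u)\<bar> \<le> D"
  shows "\<bar>gem_expectation a F s - gem_expectation a F' s'\<bar> \<le> D"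
proof -
  have "gem_expectation a F s - gem_expectation a F' s' = (\<integral>u. F (gem a s u) - F' (gem a s' u) \<partial>unif_seq)"
    unfolding gem_expectation_def by (intro Bochner_Integration.integral_diff[symmetric] gem_integrable[OF F] gem_integrable[OF F'])
  also have "\<bar>\<dots>\<bar> \<le> (\<integral>u. \<bar>F (gem a s u) - F' (gem a s' u)\<bar> \<partial>unif_seq)"
    by (rule integral_abs_bound)
  also have "\<dots> \<le> (\<integral>u. D \<partial>unif_seq)"
    using gem_integrable[OF F] gem_integrable[OF F'] le by (intro integral_mono_AE) auto
  also have "\<dots> = D" using unif_seq.P.prob_space by simp
  finally show ?thesis .
qed

text \<open>Almost surely every stick is the initial length times a number in (0, 1], so changing
  the length by \<delta> moves each coordinate by at most \<delta>.\<close>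

lemma gem_expectation_lipschitz:
  assumes F: "sym_lipschitz B L F" and a: "a > 0"
    and "\<bar>c - c'\<bar> \<le> \<delta>" "\<bar>s - s'\<bar> \<le> \<delta>"
  shows "\<bar>gem_expectation a (\<lambda>g. F (case_nat c g)) s - gem_expectation a (\<lambda>g. F (case_nat c' g)) s'\<bar> \<le> L * \<delta>"
proof (rule gem_expectation_diff_le[OF sym_lipschitz_case_nat[OF F] sym_lipschitz_case_nat[OF F]])
  show "AE u in unif_seq. \<bar>F (case_nat c (gem a s u)) - F (case_nat c' (gem a s' u))\<bar> \<le> L * \<delta>"
    using AE_stick_breaking_bounds[OF a]
  proof eventually_elim
    case (elim u)
    have gem: "\<bar>gem a s u i - gem a s' u i\<bar> \<le> \<delta>" for i
    proof -
      let ?x = "stick_breaking (\<lambda>j. u j powr (1 / a)) i"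
      have x: "0 < ?x" "?x \<le> 1" using elim by auto
      have "gem a s u i - gem a s' u i = (s - s') * ?x" by (simp add: gem_def algebra_simps)
      then have "\<bar>gem a s u i - gem a s' u i\<bar> = \<bar>s - s'\<bar> * ?x" using x by (simp add: abs_mult)
      also have "\<dots> \<le> \<bar>s - s'\<bar> * 1" using x by (intro mult_left_mono) auto
      finally show ?thesis using assms by simp
    qed
    show ?case
      by (rule sym_lipschitzD(3)[OF F]) (use gem assms(3) in \<open>auto split: nat.split\<close>)
  qed
qed

text \<open>Supplies the start of the contraction: all sticks from a length s lie within s of
  0.\<close>

lemma gem_expectation_near_0:
  assumes F: "sym_lipschitz B L F" and a: "a > 0" and s: "0 \<le> s"
  shows "\<bar>gem_expectation a F s - F (\<lambda>_. 0)\<bar> \<le> L * s"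
proof -
  have "\<bar>gem_expectation a F s - gem_expectation a (\<lambda>_. F (\<lambda>_. 0)) s\<bar> \<le> L * s"
  proof (rule gem_expectation_diff_le[OF F])
    show "sym_lipschitz \<bar>F (\<lambda>_. 0)\<bar> 1 (\<lambda>_. F (\<lambda>_. 0))"
      unfolding sym_lipschitz_def by (auto intro: order_trans[OF abs_ge_zero])
    show "AE u in unif_seq. \<bar>F (gem a s u) - F (\<lambda>_. 0)\<bar> \<le> L * s"
      using AE_stick_breaking_bounds[OF a]
    proof eventually_elim
      case (elim u)
      show ?case
      proof (rule sym_lipschitzD(3)[OF F])
        fix i
        have x: "0 < stick_breaking (\<lambda>j. u j powr (1 / a)) i" "stick_breaking (\<lambda>j. u j powr (1 / a)) i \<le> 1"
          using elim by auto
        then show "\<bar>gem a s u i - 0\<bar> \<le> s"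
          using s mult_left_mono[OF x(2) s] by (simp add: gem_def abs_mult)
      qed
    qed
  qed
  then show ?thesis using unif_seq.P.prob_space by (simp add: gem_expectation_def)
qed

lemma gem_expectation_iter:
  assumes F: "sym_lipschitz B L F"
  shows "gem_expectation a F s =
      (\<integral>x. gem_expectation a (\<lambda>g. F (case_nat (s * (1 - x powr (1 / a))) g)) (s * x powr (1 / a)) \<partial>unif)" (is ?eq)
    and "integrable unif
      (\<lambda>x. gem_expectation a (\<lambda>g. F (case_nat (s * (1 - x powr (1 / a))) g)) (s * x powr (1 / a)))" (is ?int)
proof -
  let ?f = "\<lambda>u. F (gem a s u)"
  have f[measurable]: "?f \<in> borel_measurable unif_seq"
    by (rule measurable_compose[OF gem_measurable' sym_lipschitzD(1)[OF F]])
  have c[measurable]: "(\<lambda>(x, u). case_nat x u) \<in> unif \<Otimes>\<^sub>M unif_seq \<rightarrow>\<^sub>M unif_seq"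
    using case_nat_pair_measurable by (simp cong: measurable_cong_sets)
  interpret P: pair_prob_space unif unif_seq ..
  have meas: "(\<lambda>(x, u). ?f (case_nat x u)) \<in> borel_measurable (unif \<Otimes>\<^sub>M unif_seq)"
    using measurable_compose[OF c f] by (simp add: case_prod_beta)
  have int: "integrable (unif \<Otimes>\<^sub>M unif_seq) (\<lambda>(x, u). ?f (case_nat x u))"
    using meas sym_lipschitzD(2)[OF F] by (intro P.P.integrable_const_bound[where B = B]) (auto simp: case_prod_beta)
  have eq: "(\<integral>u. ?f (case_nat x u) \<partial>unif_seq) =
      gem_expectation a (\<lambda>g. F (case_nat (s * (1 - x powr (1 / a))) g)) (s * x powr (1 / a))" for x
    by (simp add: gem_expectation_def gem_case_nat)
  have "gem_expectation a F s = (\<integral>u. ?f u \<partial>distr (unif \<Otimes>\<^sub>M unif_seq) unif_seq (\<lambda>(x, u). case_nat x u))"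
    by (simp add: unif_seq.PiM_iter gem_expectation_def)
  also have "\<dots> = (\<integral>p. (\<lambda>(x, u). ?f (case_nat x u)) p \<partial>(unif \<Otimes>\<^sub>M unif_seq))"
    by (subst integral_distr) (auto simp: case_prod_beta')
  also have "\<dots> = (\<integral>x. \<integral>u. ?f (case_nat x u) \<partial>unif_seq \<partial>unif)"
    using P.integral_fst[OF int] by simp
  finally show ?eq by (simp add: eq)
  show ?int using P.integrable_fst[OF int] by (simp add: eq)
qed

lemma powr_le_iff_le_root:
  fixes x y a :: real
  assumes "a > 0" "0 \<le> x" "0 \<le> y"
  shows "y powr a \<le> x \<longleftrightarrow> y \<le> x powr (1 / a)"
proof
  assume "y powr a \<le> x"
  then have "(y powr a) powr (1 / a) \<le> x powr (1 / a)" using assms by (intro powr_mono2) auto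
  then show "y \<le> x powr (1 / a)" using assms by (simp add: powr_powr)
next
  assume "y \<le> x powr (1 / a)"
  then have "y powr a \<le> (x powr (1 / a)) powr a" using assms by (intro powr_mono2) auto
  then show "y powr a \<le> x" using assms by (simp add: powr_powr)
qed

text \<open>Round the remaining length r V down to an integer i. The first stick and the remaining
  length both move by at most 1, which costs at most L, and the value i has probability
  \<open>stick_weight a r i\<close>.\<close>

lemma gem_expectation_rec:
  assumes F: "sym_lipschitz B L F" and a: "a > 0" and r: "r > 0"
  shows "\<bar>gem_expectation a F (real r) -
      (\<Sum>i<r. stick_weight a r i * gem_expectation a (\<lambda>g. F (case_nat (real (r - i)) g)) (real i))\<bar> \<le> L"
proof -
  define v where "v x = x powr (1 / a)" for x :: real
  define h where "h x = gem_expectation a (\<lambda>g. F (case_nat (real r * (1 - v x)) g)) (real r * v x)" for x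
  define c where "c i = gem_expectation a (\<lambda>g. F (case_nat (real (r - i)) g)) (real i)" for i
  \<comment> \<open>The event, in terms of the uniform variable x, that r x powr (1 / a) has integer
    part i.\<close>
  define A where "A i = {(real i / real r) powr a..<(real (Suc i) / real r) powr a}" for i
  have meas_A: "measure unif (A i) = stick_weight a r i" if "i < r" for i
  proof -
    have mono: "(real i / real r) powr a \<le> (real (Suc i) / real r) powr a"
      using a by (intro powr_mono2 divide_right_mono) auto
    have "(real (Suc i) / real r) powr a \<le> 1"
      using a that by (intro powr_le1) auto
    then have sub: "{0..1} \<inter> A i = A i" by (auto simp: A_def intro: order_trans[OF powr_ge_zero])
    have "measure unif (A i) = measure lborel ({0..1} \<inter> A i) / measure lborel {0..1::real}"
      by (intro measure_uniform_measure) (auto simp: A_def)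
    also have "\<dots> = (real (Suc i) / real r) powr a - (real i / real r) powr a"
      using mono unfolding sub by (simp add: A_def)
    also have "\<dots> = stick_weight a r i"
      by (simp add: stick_weight_def powr_divide diff_divide_distrib)
    finally show ?thesis .
  qed
  have int_h: "integrable unif h" and eq_h: "gem_expectation a F (real r) = (\<integral>x. h x \<partial>unif)"
    unfolding h_def v_def using gem_expectation_iter[OF F] by auto
  have int_ind: "integrable unif (\<lambda>x. indicator (A i) x * c i)" for i
    by (intro integrable_mult_left unif.integrable_const_bound[where B = 1]) (auto simp: A_def indicator_def)
  have int_sum: "integrable unif (\<lambda>x. \<Sum>i<r. indicator (A i) x * c i)"
    by (intro Bochner_Integration.integrable_sum int_ind)
  have "(\<integral>x. (\<Sum>i<r. indicator (A i) x * c i) \<partial>unif) = (\<Sum>i<r. measure unif (A i) * c i)"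
    by (subst Bochner_Integration.integral_sum[OF int_ind]) (auto simp: A_def)
  also have "\<dots> = (\<Sum>i<r. stick_weight a r i * c i)"
    using meas_A by (intro sum.cong) auto
  finally have eq_sum: "(\<Sum>i<r. stick_weight a r i * c i) = (\<integral>x. (\<Sum>i<r. indicator (A i) x * c i) \<partial>unif)" ..
  have "gem_expectation a F (real r) - (\<Sum>i<r. stick_weight a r i * c i) =
      (\<integral>x. h x - (\<Sum>i<r. indicator (A i) x * c i) \<partial>unif)"
    unfolding eq_h eq_sum using int_h int_sum by simp
  also have "\<bar>\<dots>\<bar> \<le> (\<integral>x. \<bar>h x - (\<Sum>i<r. indicator (A i) x * c i)\<bar> \<partial>unif)"
    by (rule integral_abs_bound)
  also have "\<dots> \<le> (\<integral>x. L \<partial>unif)"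
  proof (rule integral_mono_AE)
    show "AE x in unif. \<bar>h x - (\<Sum>i<r. indicator (A i) x * c i)\<bar> \<le> L"
      using AE_unif
    proof eventually_elim
      case (elim x)
      then have v: "0 < v x" "v x < 1" using powr_root_bounds[OF a, of x] by (auto simp: v_def)
      define I where "I = nat \<lfloor>real r * v x\<rfloor>"
      have nonneg: "0 \<le> real r * v x" using v by simp
      have I: "real I \<le> real r * v x" "real r * v x < real I + 1"
        using nonneg unfolding I_def by linarith+
      have "real r * v x < real r * 1" using v r by (intro mult_strict_left_mono) auto
      then have Ir: "I < r" using I by simp
      have in_A: "x \<in> A i \<longleftrightarrow> i = I" for i
      proof -
        have e: "y powr a \<le> x \<longleftrightarrow> y \<le> v x" if "0 \<le> y" for y
          using powr_le_iff_le_root[OF a _ that, of x] elim by (simp add: v_def)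
        have "x \<in> A i \<longleftrightarrow> (real i / real r) powr a \<le> x \<and> \<not> (real (Suc i) / real r) powr a \<le> x"
          unfolding A_def by (auto simp: not_le)
        also have "\<dots> \<longleftrightarrow> real i / real r \<le> v x \<and> \<not> real (Suc i) / real r \<le> v x"
          using e[of "real i / real r"] e[of "real (Suc i) / real r"] by (simp del: of_nat_Suc)
        also have "\<dots> \<longleftrightarrow> real i \<le> real r * v x \<and> real r * v x < real i + 1"
          using r by (simp add: field_simps not_le)
        also have "\<dots> \<longleftrightarrow> i = I" using I by linarith
        finally show ?thesis .
      qed
      have "(\<Sum>i<r. indicator (A i) x * c i) = (\<Sum>i<r. if i = I then c i else 0)"
        by (intro sum.cong) (auto simp: indicator_def in_A)
      also have "\<dots> = c I" using Ir by simp
      finally have "\<bar>h x - (\<Sum>i<r. indicator (A i) x * c i)\<bar> = \<bar>h x - c I\<bar>" by simp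
      also have "\<dots> \<le> L * 1"
        unfolding h_def c_def using I Ir
        by (intro gem_expectation_lipschitz[OF F a]) (auto simp: of_nat_diff algebra_simps)
      finally show ?case by simp
    qed
  qed (use int_h int_sum in auto)
  also have "\<dots> = L" using unif.prob_space by simp
  finally show ?thesis by (simp add: c_def)
qed

text \<open>By independence the n-th product has mean (1 / (p + 1)) ^ n, so the infimum over n has
  integral 0. The products decrease, so the infimum is their limit.\<close>

lemma AE_prod_unif_tendsto_0:
  assumes p: "p > 0"
  shows "AE u in unif_seq. (\<lambda>n. \<Prod>j<n. u j powr p) \<longlonglongrightarrow> 0"
proof -
  have powr_meas: "(\<lambda>x. ennreal (x powr p)) \<in> borel_measurable unif"
    by (subst measurable_cong_sets[OF sets_uniform_measure refl]) measurable
  have [measurable]: "(\<lambda>u :: nat \<Rightarrow> real. u i) \<in> borel_measurable (PiM UNIV (\<lambda>_. borel))" for i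
    by (rule measurable_component_singleton) simp
  define R where "R n u = ennreal (\<Prod>j<n. u j powr p)" for n and u :: "nat \<Rightarrow> real"
  have [measurable]: "R n \<in> borel_measurable (PiM UNIV (\<lambda>_. borel))" for n
    unfolding R_def by measurable
  have meas: "R n \<in> borel_measurable unif_seq" for n by measurable
  have "(\<integral>\<^sup>+u. R n u \<partial>unif_seq) = ennreal (1 / (p + 1)) ^ n" for n
  proof (induction n)
    case 0
    show ?case using unif_seq.P.emeasure_space_1 by (simp add: R_def)
  next
    case (Suc n)
    have R: "R (Suc n) (case_nat x u) = ennreal (x powr p) * R n u" for x u
      unfolding R_def by (simp add: prod.lessThan_Suc_shift ennreal_mult prod_nonneg del: prod.lessThan_Suc)
    have "(\<integral>\<^sup>+u. R (Suc n) u \<partial>unif_seq) = (\<integral>\<^sup>+x. ennreal (x powr p) * ennreal (1 / (p + 1)) ^ n \<partial>unif)"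
      by (subst nn_integral_unif_seq_iter) (auto simp: R nn_integral_cmult[OF meas] Suc)
    also have "\<dots> = ennreal (1 / (p + 1)) * ennreal (1 / (p + 1)) ^ n"
      using p by (simp add: nn_integral_multc[OF powr_meas] nn_integral_unif_powr)
    finally show ?case by simp
  qed
  moreover have "(\<integral>\<^sup>+u. (INF n. R n u) \<partial>unif_seq) \<le> (\<integral>\<^sup>+u. R n u \<partial>unif_seq)" for n
    by (intro nn_integral_mono INF_lower) auto
  ultimately have le: "(\<integral>\<^sup>+u. (INF n. R n u) \<partial>unif_seq) \<le> ennreal ((1 / (p + 1)) ^ n)" for n
    using p by (simp add: ennreal_power)
  have "(\<lambda>n. ennreal ((1 / (p + 1)) ^ n)) \<longlonglongrightarrow> ennreal 0"
    using p by (intro tendsto_ennrealI LIMSEQ_power_zero) auto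
  then have "(\<integral>\<^sup>+u. (INF n. R n u) \<partial>unif_seq) \<le> 0"
    using le by (intro LIMSEQ_le_const) auto
  then have "AE u in unif_seq. (INF n. R n u) = 0"
    using meas by (subst (asm) le_zero_eq, subst (asm) nn_integral_0_iff_AE) auto
  with AE_unif_seq show ?thesis
  proof eventually_elim
    case (elim u)
    have u: "0 < u j powr p" "u j powr p \<le> 1" for j
      using elim(1) p by (auto intro!: powr_le1 simp: less_imp_le) (metis less_irrefl)
    have dec: "decseq (\<lambda>n. \<Prod>j<n. u j powr p)"
      using u by (intro decseq_SucI) (simp add: mult_right_le_one_le prod_nonneg)
    show ?case
    proof (rule LIMSEQ_I)
      fix e :: real assume e: "0 < e"
      then have "(INF n. R n u) < ennreal e" using elim(2) by simp
      then obtain N where "R N u < ennreal e" by (auto simp: INF_less_iff)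
      then have N: "(\<Prod>j<N. u j powr p) < e" using e by (simp add: R_def ennreal_less_iff prod_nonneg)
      have "(\<Prod>j<n. u j powr p) < e" if "n \<ge> N" for n
        using decseqD[OF dec that] N by linarith
      then show "\<exists>no. \<forall>n\<ge>no. norm ((\<Prod>j<n. u j powr p) - 0) < e"
        by (auto simp: abs_of_nonneg prod_nonneg)
    qed
  qed
qed

text \<open>Almost surely the sticks are positive and bounded by the remaining length, which tends
  to 0. So each stick is exceeded by finitely many others only, and clipping changes
  nothing.\<close>

lemma AE_order_stat_eq_sort_decreasing:
  assumes a: "a > 0"
  shows "AE u in unif_seq. order_stat (gem a 1 u) = sort_decreasing (stick_breaking (\<lambda>j. u j powr (1 / a)))"
  using AE_stick_breaking_bounds[OF a] AE_prod_unif_tendsto_0[of "1 / a", OF divide_pos_pos[OF zero_less_one a]]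
proof eventually_elim
  case (elim u)
  define g where "g = stick_breaking (\<lambda>j. u j powr (1 / a))"
  have g: "0 < g i" "g i \<le> 1" "g i \<le> (\<Prod>j<i. u j powr (1 / a))" for i using elim(1) by (auto simp: g_def)
  have "g \<longlonglongrightarrow> 0"
    by (rule tendsto_sandwich[OF _ _ tendsto_const elim(2)]) (use g in \<open>auto simp: less_imp_le\<close>)
  have "sortable g"
    unfolding sortable_def
  proof
    fix i
    from \<open>g \<longlonglongrightarrow> 0\<close> have "\<forall>\<^sub>F j in sequentially. g j < g i" using g(1) by (rule order_tendstoD)
    then obtain N where "\<And>j. j \<ge> N \<Longrightarrow> g j < g i" by (auto simp: eventually_sequentially)
    then have "{j. g i < g j} \<subseteq> {..<N}" by (auto simp: not_le[symmetric]) (metis less_asym not_le)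
    then show "finite {j. g i < g j}" by (rule finite_subset) simp
  qed
  then have "order_stat g = sort_decreasing g"
    using g by (intro order_stat_eq_sort_decreasing) (auto simp: less_imp_le)
  then show ?case by (simp add: gem_def g_def)
qed

section \<open>Weighted sums over combinatorial objects\<close>

definition size_seq :: "nat multiset \<Rightarrow> nat \<Rightarrow> real" where
  "size_seq S = (\<lambda>i. real (nth_largest S i))"

definition list_seq :: "nat list \<Rightarrow> nat \<Rightarrow> real" where
  "list_seq l = (\<lambda>i. if i < length l then real (l ! i) else 0)"

lemma size_seq_eq_list_seq: "size_seq S = list_seq (rev (sorted_list_of_multiset S))"
  by (auto simp: size_seq_def list_seq_def nth_largest_def Let_def fun_eq_iff)

lemma list_seq_permutation:
  assumes "mset l = mset l'"
  obtains p where "bij p" "list_seq l = list_seq l' \<circ> p"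
proof -
  obtain p where p: "p permutes {..<length l'}" "permute_list p l' = l"
    using mset_eq_permutation[OF assms] .
  have "list_seq l i = list_seq l' (p i)" for i
  proof (cases "i < length l'")
    case True
    then have "p i < length l'" using p(1) permutes_in_image[of p "{..<length l'}" i] by auto
    then show ?thesis using True p by (auto simp: list_seq_def permute_list_nth)
  next
    case False
    then have "p i = i" using p(1) by (simp add: permutes_def)
    then show ?thesis using False p by (auto simp: list_seq_def)
  qed
  then show ?thesis
    using that[of p] permutes_bij[OF p(1)] by (auto simp: fun_eq_iff)
qed

text \<open>Sorting moves the new component to its place, which a symmetric function does not
  notice; for such functions adding a component is prepending a coordinate.\<close>

lemma size_seq_add_mset:
  obtains p where "bij p" "size_seq (add_mset x S) = case_nat (real x) (size_seq S) \<circ> p"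
proof -
  have "list_seq (x # rev (sorted_list_of_multiset S)) = case_nat (real x) (size_seq S)"
    by (auto simp: list_seq_def size_seq_eq_list_seq fun_eq_iff split: nat.splits)
  moreover have "mset (rev (sorted_list_of_multiset (add_mset x S))) = mset (x # rev (sorted_list_of_multiset S))"
    by simp
  then obtain p where "bij p" "list_seq (rev (sorted_list_of_multiset (add_mset x S))) =
      list_seq (x # rev (sorted_list_of_multiset S)) \<circ> p"
    by (rule list_seq_permutation)
  ultimately show ?thesis
    using that[of p] by (simp add: size_seq_eq_list_seq)
qed

lemma sym_lipschitz_size_seq_add_mset:
  assumes "sym_lipschitz B L F"
  shows "F (size_seq (add_mset x S)) = F (case_nat (real x) (size_seq S))"
proof -
  obtain p where "bij p" "size_seq (add_mset x S) = case_nat (real x) (size_seq S) \<circ> p"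
    by (rule size_seq_add_mset)
  then show ?thesis using sym_lipschitzD(4)[OF assms] by simp
qed

lemma decseq_size_seq: "decseq (size_seq S)"
  unfolding decseq_def
proof (intro allI impI)
  fix m n :: nat assume "m \<le> n"
  let ?l = "rev (sorted_list_of_multiset S)"
  have "sorted_wrt (\<ge>) ?l" by (simp add: sorted_wrt_rev)
  then have "?l ! n \<le> ?l ! m" if "n < length ?l" "m < n"
    using that by (meson sorted_wrt_nth_less)
  then show "size_seq S n \<le> size_seq S m"
    using \<open>m \<le> n\<close> by (cases "m = n") (auto simp: size_seq_eq_list_seq list_seq_def)
qed

lemma size_seq_bounds: "0 \<le> size_seq S i" "size_seq S i \<le> real (sum_mset S)"
proof -
  let ?l = "rev (sorted_list_of_multiset S)"
  show "0 \<le> size_seq S i" by (simp add: size_seq_def)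
  show "size_seq S i \<le> real (sum_mset S)"
  proof (cases "i < length ?l")
    case True
    then have "?l ! i \<in># S" using nth_mem[OF True] by simp
    then have "?l ! i \<le> sum_mset S" by (metis le_add1 insert_DiffM sum_mset.add_mset)
    moreover have "size_seq S i = real (?l ! i)"
      using True by (simp add: size_seq_eq_list_seq list_seq_def)
    ultimately show ?thesis by (simp only: of_nat_le_iff)
  next
    case False
    then have "size_seq S i = 0" by (simp add: size_seq_eq_list_seq list_seq_def)
    then show ?thesis by (simp only: of_nat_0_le_iff)
  qed
qed

lemma sum_image_mset_eq_sum_count:
  fixes w :: "'a \<Rightarrow> nat"
  assumes "finite S" "set_mset A \<subseteq> S"
  shows "(\<Sum>u\<in>#A. w u) = (\<Sum>u\<in>S. count A u * w u)"
  using assms(2)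
proof (induction A)
  case (add x A)
  have "(\<Sum>u\<in>S. count (add_mset x A) u * w u) = (\<Sum>u\<in>S. count A u * w u + (if u = x then w u else 0))"
    by (intro sum.cong) auto
  also have "\<dots> = (\<Sum>u\<in>S. count A u * w u) + w x"
    using add.prems assms(1) by (simp add: sum.distrib)
  finally show ?case using add by simp
qed simp

text \<open>\<open>distinct_parts\<close> chooses between selections, taken as multisets without
  repetition, and arbitrary multisets, so that one development serves both.\<close>

locale irreducibles =
  fixes U :: "'a set" and wt :: "'a \<Rightarrow> nat" and distinct_parts :: bool and \<phi> :: real
  assumes wt_pos: "u \<in> U \<Longrightarrow> wt u > 0"
    and finite_wt: "i \<ge> 1 \<Longrightarrow> finite {u \<in> U. wt u = i}"
    and \<phi>: "\<phi> > 0"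
begin

definition mult :: "nat \<Rightarrow> nat" where "mult i = card {u \<in> U. wt u = i}"

definition objects :: "nat \<Rightarrow> 'a multiset set" where
  "objects r = {A \<in> multisets_of_weight U wt r. distinct_parts \<longrightarrow> (\<forall>u. count A u \<le> 1)}"

definition weighted_sum :: "('a multiset \<Rightarrow> real) \<Rightarrow> nat \<Rightarrow> real" where
  "weighted_sum f r = (\<Sum>A\<in>objects r. \<phi> ^ size A * f A)"

abbreviation partition_fun :: "nat \<Rightarrow> real" where
  "partition_fun \<equiv> weighted_sum (\<lambda>_. 1)"

text \<open>With s for this sign, a kind of weight j contributes the factor (1 - s \<phi> z^j)^(- s)
  to the generating function: 1 / (1 - \<phi> z^j) for multisets, 1 + \<phi> z^j for
  selections.\<close>

definition sgn_parts :: real where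
  "sgn_parts = (if distinct_parts then -1 else 1)"

definition small :: "nat \<Rightarrow> 'a set" where
  "small r = {u \<in> U. wt u \<le> r}"

lemma finite_small: "finite (small r)"
proof -
  have "small r \<subseteq> (\<Union>i\<in>{1..r}. {u \<in> U. wt u = i})"
    using wt_pos by (force simp: small_def)
  then show ?thesis by (rule finite_subset) (use finite_wt in auto)
qed

lemma objects_subset_small: "A \<in> objects r \<Longrightarrow> set_mset A \<subseteq> small r"
  by (auto simp: objects_def multisets_of_weight_def small_def dest!: multi_member_split)

lemma finite_objects: "finite (objects r)"
proof -
  have "objects r \<subseteq> (\<Union>n\<le>r. multisets_of_size (small r) n)"
  proof
    fix A assume A: "A \<in> objects r"
    then have "size A \<le> (\<Sum>u\<in>#A. wt u)"
      unfolding size_eq_sum_mset using wt_pos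
      by (intro sum_mset_mono) (auto simp: objects_def multisets_of_weight_def Suc_le_eq)
    then show "A \<in> (\<Union>n\<le>r. multisets_of_size (small r) n)"
      using A objects_subset_small[OF A] by (auto simp: multisets_of_size_def objects_def multisets_of_weight_def)
  qed
  then show ?thesis by (rule finite_subset) (use finite_small in auto)
qed

lemma weighted_sum_abs_le:
  assumes "\<And>A. A \<in> objects r \<Longrightarrow> \<bar>f A\<bar> \<le> g A" shows "\<bar>weighted_sum f r\<bar> \<le> weighted_sum g r"
  unfolding weighted_sum_def
  using assms \<phi> by (intro order_trans[OF sum_abs] sum_mono) (auto simp: abs_mult)

lemma weighted_sum_cmult: "weighted_sum (\<lambda>A. c * f A) r = c * weighted_sum f r"
  by (simp add: weighted_sum_def sum_distrib_left mult_ac)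

lemma weighted_sum_add: "weighted_sum (\<lambda>A. f A + g A) r = weighted_sum f r + weighted_sum g r"
  by (simp add: weighted_sum_def sum.distrib distrib_left)

lemma partition_fun_nonneg: "0 \<le> partition_fun r"
  using \<phi> by (simp add: weighted_sum_def sum_nonneg)

lemma partition_fun_0 [simp]: "partition_fun 0 = 1"
proof -
  have "small 0 = {}" using wt_pos by (auto simp: small_def)
  then have "A = {#}" if "A \<in> objects 0" for A
    using objects_subset_small[OF that] by simp
  moreover have "{#} \<in> objects 0"
    by (simp add: objects_def multisets_of_weight_def)
  ultimately have "objects 0 = {{#}}" by blast
  then show ?thesis by (simp add: weighted_sum_def)
qed

lemma count_eq_0_if_sgn_parts:
  assumes A: "A \<in> objects r" "1 + sgn_parts * real (count A u) \<noteq> 0" and d: distinct_parts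
  shows "count A u = 0"
proof -
  have "count A u \<le> 1" using A(1) d unfolding objects_def by blast
  moreover have "count A u \<noteq> 1" using A(2) unfolding sgn_parts_def by (auto simp: d)
  ultimately show ?thesis by linarith
qed

text \<open>The factor 1 + \<open>sgn_parts\<close> * count vanishes exactly when u may not be
  added: never for multisets, and for selections when u is already present.\<close>

lemma add_mset_bij_objects:
  assumes u: "u \<in> U" "wt u \<le> r"
  shows "bij_betw (add_mset u) {A \<in> objects (r - wt u). 1 + sgn_parts * real (count A u) \<noteq> 0} {A \<in> objects r. u \<in># A}"
proof (rule bij_betwI')
  fix A assume A: "A \<in> {A \<in> objects (r - wt u). 1 + sgn_parts * real (count A u) \<noteq> 0}"
  then have "count A u = 0" if distinct_parts
    using that count_eq_0_if_sgn_parts by blast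
  then show "add_mset u A \<in> {A \<in> objects r. u \<in># A}"
    using A u by (auto simp: objects_def multisets_of_weight_def)
next
  fix A assume A: "A \<in> {A \<in> objects r. u \<in># A}"
  then have eq: "A = add_mset u (A - {#u#})" by simp
  have "wt u + (\<Sum>v\<in>#A - {#u#}. wt v) = r"
    using A arg_cong[OF eq, of "\<lambda>A. \<Sum>v\<in>#A. wt v"] by (simp add: objects_def multisets_of_weight_def)
  then have "(\<Sum>v\<in>#A - {#u#}. wt v) = r - wt u" by linarith
  then have "A - {#u#} \<in> objects (r - wt u)"
    using A by (auto simp: objects_def multisets_of_weight_def le_diff_conv intro: le_SucI dest: in_diffD)
  moreover have "1 + sgn_parts * real (count (A - {#u#}) u) \<noteq> 0"
  proof (cases distinct_parts)
    case True
    then have "count A u \<le> 1" using A unfolding objects_def by blast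
    then show ?thesis by simp
  next
    case False
    have "0 \<le> real (count (A - {#u#}) u)" by (rule of_nat_0_le_iff)
    then show ?thesis unfolding sgn_parts_def if_not_P[OF False] by linarith
  qed
  ultimately show "\<exists>A'\<in>{A \<in> objects (r - wt u). 1 + sgn_parts * real (count A u) \<noteq> 0}. A = add_mset u A'"
    using eq by blast
qed auto

text \<open>Remove one copy of u. The multiplicity before the removal is count + 1 for multisets;
  for selections it is 1, and 1 - count is 1 or 0 according as u could be added. One signed factor
  expresses both.\<close>

lemma weighted_sum_count:
  assumes u: "u \<in> U" "wt u \<le> r"
  shows "weighted_sum (\<lambda>A. real (count A u) * f A) r =
     \<phi> * weighted_sum (\<lambda>A. (1 + sgn_parts * real (count A u)) * f (add_mset u A)) (r - wt u)"
proof -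
  let ?S = "{A \<in> objects (r - wt u). 1 + sgn_parts * real (count A u) \<noteq> 0}"
  have "weighted_sum (\<lambda>A. real (count A u) * f A) r =
      (\<Sum>A | A \<in> objects r \<and> u \<in># A. \<phi> ^ size A * (real (count A u) * f A))"
    unfolding weighted_sum_def using finite_objects
    by (intro sum.mono_neutral_right) (auto simp: not_in_iff)
  also have "\<dots> = (\<Sum>A\<in>?S. \<phi> ^ size (add_mset u A) * (real (count (add_mset u A) u) * f (add_mset u A)))"
    by (rule sum.reindex_bij_betw[OF add_mset_bij_objects[OF u], symmetric])
  also have "\<dots> = (\<Sum>A\<in>?S. \<phi> * (\<phi> ^ size A * ((1 + sgn_parts * real (count A u)) * f (add_mset u A))))"
  proof (rule sum.cong)
    fix A assume A: "A \<in> ?S"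
    then have "distinct_parts \<Longrightarrow> count A u = 0"
      using count_eq_0_if_sgn_parts by blast
    then have "real (count (add_mset u A) u) = 1 + sgn_parts * real (count A u)"
      by (auto simp: sgn_parts_def)
    then show "\<phi> ^ size (add_mset u A) * (real (count (add_mset u A) u) * f (add_mset u A)) =
        \<phi> * (\<phi> ^ size A * ((1 + sgn_parts * real (count A u)) * f (add_mset u A)))"
      by simp
  qed simp
  also have "\<dots> = \<phi> * weighted_sum (\<lambda>A. (1 + sgn_parts * real (count A u)) * f (add_mset u A)) (r - wt u)"
    unfolding weighted_sum_def sum_distrib_left using finite_objects
    by (intro sum.mono_neutral_left) auto
  finally show ?thesis .
qed

lemma weighted_sum_count_0: "r < wt u \<Longrightarrow> weighted_sum (\<lambda>A. real (count A u) * f A) r = 0"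
  unfolding weighted_sum_def
  using objects_subset_small[of _ r] by (intro sum.neutral) (force simp: small_def not_in_iff)

lemma weighted_sum_by_parts:
  "real r * weighted_sum f r = (\<Sum>u\<in>small r. real (wt u) * weighted_sum (\<lambda>A. real (count A u) * f A) r)"
proof -
  have wt: "real r = (\<Sum>u\<in>small r. real (count A u) * real (wt u))" if A: "A \<in> objects r" for A
  proof -
    have "r = (\<Sum>u\<in>#A. wt u)" using A by (simp add: objects_def multisets_of_weight_def)
    also have "\<dots> = (\<Sum>u\<in>small r. count A u * wt u)"
      by (rule sum_image_mset_eq_sum_count[OF finite_small objects_subset_small[OF A]])
    finally have "r = (\<Sum>u\<in>small r. count A u * wt u)" .
    from arg_cong[OF this, of real] show ?thesis by (simp only: of_nat_sum of_nat_mult)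
  qed
  have "real r * weighted_sum f r = (\<Sum>A\<in>objects r. \<Sum>u\<in>small r. real (wt u) * (\<phi> ^ size A * (real (count A u) * f A)))"
    unfolding weighted_sum_def sum_distrib_left
  proof (rule sum.cong[OF refl])
    fix A assume "A \<in> objects r"
    have "real r * (\<phi> ^ size A * f A) = (\<Sum>u\<in>small r. real (count A u) * real (wt u)) * (\<phi> ^ size A * f A)"
      using wt[OF \<open>A \<in> objects r\<close>] by simp
    then show "real r * (\<phi> ^ size A * f A) = (\<Sum>u\<in>small r. real (wt u) * (\<phi> ^ size A * (real (count A u) * f A)))"
      by (simp add: sum_distrib_left sum_distrib_right mult_ac)
  qed
  also have "\<dots> = (\<Sum>u\<in>small r. real (wt u) * weighted_sum (\<lambda>A. real (count A u) * f A) r)"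
    by (subst sum.swap) (simp add: weighted_sum_def sum_distrib_left)
  finally show ?thesis .
qed

lemma sum_small_by_weight: "(\<Sum>u\<in>small r. h (wt u)) = (\<Sum>j\<in>{1..r}. real (mult j) * h j)"
proof -
  have "(\<Sum>u\<in>small r. h (wt u)) = (\<Sum>j\<in>{1..r}. \<Sum>u | u \<in> small r \<and> wt u = j. h (wt u))"
    using wt_pos finite_small by (intro sum.group[symmetric]) (force simp: small_def)+
  also have "\<dots> = (\<Sum>j\<in>{1..r}. real (mult j) * h j)"
  proof (rule sum.cong[OF refl])
    fix j assume "j \<in> {1..r}"
    then have "{u. u \<in> small r \<and> wt u = j} = {u \<in> U. wt u = j}" by (auto simp: small_def)
    then show "(\<Sum>u | u \<in> small r \<and> wt u = j. h (wt u)) = real (mult j) * h j"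
      by (simp add: mult_def)
  qed
  finally show ?thesis .
qed

text \<open>
  Picking an irreducible component with probability proportional to its weight and removing it
  leaves, up to the effect of repetitions, an object of smaller weight. The error term is
  controlled by the same identity for the constant function.
\<close>

lemma weighted_sum_size_bias:
  assumes F: "\<And>A. \<bar>f A\<bar> \<le> B" and g: "\<And>u A. u \<in> U \<Longrightarrow> f (add_mset u A) = g (wt u) A"
  shows "\<bar>real r * weighted_sum f r - (\<Sum>j\<in>{1..r}. real (mult j) * (\<phi> * real j * weighted_sum (g j) (r - j)))\<bar> \<le>
     B * \<bar>real r * partition_fun r - (\<Sum>j\<in>{1..r}. real (mult j) * (\<phi> * real j * partition_fun (r - j)))\<bar>"
proof -
  define X where "X f u = weighted_sum (\<lambda>A. real (count A u) * f A) r" for f u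
  \<comment> \<open>The correction caused by repetitions of u. In the identity for f = 1 it appears
    with the sign \<open>sgn_parts\<close>; in the one for f it is at most B times as large.\<close>
  define E where "E u = weighted_sum (\<lambda>A. real (count A u)) (r - wt u)" for u
  have E0: "0 \<le> E u" for u using \<phi> by (simp add: E_def weighted_sum_def sum_nonneg)
  have B0: "0 \<le> B" using F[of "{#}"] by linarith
  have sgn: "\<bar>sgn_parts\<bar> = 1" by (simp add: sgn_parts_def)
  have X1: "X (\<lambda>_. 1) u - \<phi> * partition_fun (r - wt u) = sgn_parts * (\<phi> * E u)" if u: "u \<in> small r" for u
  proof -
    have "X (\<lambda>_. 1) u = \<phi> * weighted_sum (\<lambda>A. (1 + sgn_parts * real (count A u)) * 1) (r - wt u)"
      unfolding X_def using u by (intro weighted_sum_count) (auto simp: small_def)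
    then show ?thesis by (simp add: E_def weighted_sum_add weighted_sum_cmult distrib_left)
  qed
  have Xf: "\<bar>X f u - \<phi> * weighted_sum (g (wt u)) (r - wt u)\<bar> \<le> B * (\<phi> * E u)" if u: "u \<in> small r" for u
  proof -
    have uU: "u \<in> U" using u by (simp add: small_def)
    have "X f u = \<phi> * weighted_sum (\<lambda>A. (1 + sgn_parts * real (count A u)) * f (add_mset u A)) (r - wt u)"
      unfolding X_def using u by (intro weighted_sum_count) (auto simp: small_def)
    also have "(\<lambda>A. (1 + sgn_parts * real (count A u)) * f (add_mset u A)) =
        (\<lambda>A. g (wt u) A + sgn_parts * (real (count A u) * g (wt u) A))"
      by (simp add: g[OF uU] algebra_simps)
    finally have "X f u - \<phi> * weighted_sum (g (wt u)) (r - wt u) =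
        sgn_parts * (\<phi> * weighted_sum (\<lambda>A. real (count A u) * g (wt u) A) (r - wt u))"
      by (simp add: weighted_sum_add weighted_sum_cmult distrib_left)
    also have "\<bar>\<dots>\<bar> = \<phi> * \<bar>weighted_sum (\<lambda>A. real (count A u) * g (wt u) A) (r - wt u)\<bar>"
      using \<phi> sgn by (simp add: abs_mult)
    also have "\<dots> \<le> \<phi> * weighted_sum (\<lambda>A. B * real (count A u)) (r - wt u)"
    proof (intro mult_left_mono weighted_sum_abs_le)
      fix A
      have "\<bar>g (wt u) A\<bar> \<le> B" using F[of "add_mset u A"] g[OF uU, of A] by simp
      from mult_left_mono[OF this, of "real (count A u)"]
      show "\<bar>real (count A u) * g (wt u) A\<bar> \<le> B * real (count A u)"
        by (simp add: abs_mult mult.commute)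
    qed (use \<phi> in simp)
    finally show ?thesis by (simp add: weighted_sum_cmult E_def mult_ac)
  qed
  have "real r * weighted_sum f r - (\<Sum>j\<in>{1..r}. real (mult j) * (\<phi> * real j * weighted_sum (g j) (r - j))) =
      (\<Sum>u\<in>small r. real (wt u) * (X f u - \<phi> * weighted_sum (g (wt u)) (r - wt u)))"
    unfolding weighted_sum_by_parts[of r f] sum_small_by_weight[symmetric] X_def
    by (simp add: sum_subtractf right_diff_distrib mult_ac)
  also have "\<bar>\<dots>\<bar> \<le> (\<Sum>u\<in>small r. real (wt u) * (B * (\<phi> * E u)))"
    using Xf by (intro order_trans[OF sum_abs] sum_mono) (auto simp: abs_mult intro!: mult_left_mono)
  also have "\<dots> = B * (\<Sum>u\<in>small r. real (wt u) * (\<phi> * E u))"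
    by (simp add: sum_distrib_left mult_ac)
  \<comment> \<open>For the constant function all corrections have the same sign. Nothing cancels,
    and their sum is the full defect in absolute value.\<close>
  also have "(\<Sum>u\<in>small r. real (wt u) * (\<phi> * E u)) = \<bar>sgn_parts * (\<Sum>u\<in>small r. real (wt u) * (\<phi> * E u))\<bar>"
    using \<phi> E0 sgn unfolding abs_mult by (simp add: sum_nonneg)
  also have "sgn_parts * (\<Sum>u\<in>small r. real (wt u) * (\<phi> * E u)) =
      (\<Sum>u\<in>small r. real (wt u) * (X (\<lambda>_. 1) u - \<phi> * partition_fun (r - wt u)))"
    using X1 by (auto simp: sum_distrib_left mult_ac intro!: sum.cong)
  also have "\<dots> = real r * partition_fun r - (\<Sum>j\<in>{1..r}. real (mult j) * (\<phi> * real j * partition_fun (r - j)))"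
    unfolding weighted_sum_by_parts[of r "\<lambda>_. 1"] sum_small_by_weight[symmetric] X_def
    by (simp add: sum_subtractf right_diff_distrib mult_ac)
  finally show ?thesis .
qed

section \<open>The logarithmic derivative of the generating function\<close>

text \<open>The coefficient of z^d in z times the logarithmic derivative of the factor 1 / (1 -
  \<phi> z^j) or 1 + \<phi> z^j of a single kind of weight j.\<close>

definition log_coeff :: "nat \<Rightarrow> nat \<Rightarrow> real" where
  "log_coeff j d = (if j dvd d \<and> d > 0 then real j * sgn_parts ^ (d div j - 1) * \<phi> ^ (d div j) else 0)"

lemma log_coeff_shift:
  assumes "j > 0" "d > 0" shows "log_coeff j (d + j) = sgn_parts * \<phi> * log_coeff j d"
proof (cases "j dvd d")
  case True
  then obtain k where "d = j * k" by auto
  then show ?thesis using assms by (cases k) (auto simp: log_coeff_def div_mult_self1)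
qed (simp add: log_coeff_def)

lemma log_coeff_self: "j > 0 \<Longrightarrow> log_coeff j j = real j * \<phi>"
  by (simp add: log_coeff_def)

lemma log_coeff_eq_0: "d < j \<Longrightarrow> log_coeff j d = 0"
  by (auto simp: log_coeff_def dest: dvd_imp_le)

text \<open>Iterates \<open>weighted_sum_count\<close>: removing copies of u one by one produces the
  powers of \<phi>, with constant sign for multisets and alternating sign for selections.\<close>

lemma count_sum_eq_log_coeff:
  assumes u: "u \<in> U"
  shows "real (wt u) * weighted_sum (\<lambda>A. real (count A u)) r =
      (\<Sum>d\<in>{1..r}. log_coeff (wt u) d * partition_fun (r - d))"
proof (induction r rule: less_induct)
  case (less r)
  define j where "j = wt u"
  have j: "j > 0" using wt_pos[OF u] by (simp add: j_def)
  define c where "c r = weighted_sum (\<lambda>A. real (count A u)) r" for r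
  show ?case
  proof (cases "j \<le> r")
    case False
    then show ?thesis
      using weighted_sum_count_0[of r u "\<lambda>_. 1"] by (auto simp: j_def log_coeff_eq_0 intro!: sum.neutral[symmetric])
  next
    case True
    have "real j * c r = real j * \<phi> * partition_fun (r - j) + sgn_parts * \<phi> * (real j * c (r - j))"
      using weighted_sum_count[OF u, of r "\<lambda>_. 1"] True
      by (simp add: c_def j_def weighted_sum_add weighted_sum_cmult algebra_simps)
    also have "real j * c (r - j) = (\<Sum>d\<in>{1..r-j}. log_coeff j d * partition_fun (r - j - d))"
      using less.IH[of "r - j"] j True by (simp add: c_def j_def)
    also have "sgn_parts * \<phi> * \<dots> = (\<Sum>d\<in>{1..r-j}. log_coeff j (d + j) * partition_fun (r - (d + j)))"
      using j by (auto simp: sum_distrib_left log_coeff_shift mult_ac diff_diff_add add.commute intro!: sum.cong)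
    also have "\<dots> = (\<Sum>d\<in>{j+1..r}. log_coeff j d * partition_fun (r - d))"
      using True by (intro sum.reindex_bij_witness[of _ "\<lambda>d. d - j" "\<lambda>d. d + j"]) auto
    also have "real j * \<phi> * partition_fun (r - j) + \<dots> = (\<Sum>d\<in>{j..r}. log_coeff j d * partition_fun (r - d))"
      using True j by (subst sum.atLeast_Suc_atMost[OF True]) (simp add: log_coeff_self)
    also have "\<dots> = (\<Sum>d\<in>{1..r}. log_coeff j d * partition_fun (r - d))"
      using j by (intro sum.mono_neutral_left) (auto simp: log_coeff_eq_0)
    finally show ?thesis by (simp add: j_def c_def)
  qed
qed

text \<open>Coefficient form of z P' = P * (z P' / P) for the generating function P, obtained by
  distributing the weight of an object over its components instead of through an infinite
  product.\<close>

theorem partition_fun_rec: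
  "real r * partition_fun r =
     (\<Sum>d\<in>{1..r}. (\<Sum>j\<in>{1..d}. real (mult j) * log_coeff j d) * partition_fun (r - d))"
proof -
  have "real r * partition_fun r = (\<Sum>u\<in>small r. \<Sum>d\<in>{1..r}. log_coeff (wt u) d * partition_fun (r - d))"
    unfolding weighted_sum_by_parts[of r] using count_sum_eq_log_coeff
    by (intro sum.cong) (auto simp: small_def)
  also have "\<dots> = (\<Sum>j\<in>{1..r}. real (mult j) * (\<Sum>d\<in>{1..r}. log_coeff j d * partition_fun (r - d)))"
    by (rule sum_small_by_weight)
  also have "\<dots> = (\<Sum>d\<in>{1..r}. (\<Sum>j\<in>{1..r}. real (mult j) * log_coeff j d) * partition_fun (r - d))"
    unfolding sum_distrib_left sum_distrib_right by (subst sum.swap) (simp add: mult_ac)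
  also have "\<dots> = (\<Sum>d\<in>{1..r}. (\<Sum>j\<in>{1..d}. real (mult j) * log_coeff j d) * partition_fun (r - d))"
    by (intro sum.cong refl arg_cong2[where f = "(*)"] sum.mono_neutral_right) (auto simp: log_coeff_eq_0)
  finally show ?thesis .
qed

end

section \<open>Generating functions\<close>

text \<open>A non-positive value would put z on the ray from \<rho> to the right, where the real
  part of z - \<rho> equals its norm. Hence the principal logarithm is holomorphic on the slit
  disc.\<close>

lemma slit_disc_notin_nonpos_Reals:
  assumes z: "z \<in> slit_disc \<rho> \<kappa> R" and \<rho>: "0 < \<rho>" and \<kappa>: "\<kappa> \<le> 1"
  shows "1 - z / of_real \<rho> \<notin> \<real>\<^sub>\<le>\<^sub>0"
proof
  assume "1 - z / of_real \<rho> \<in> \<real>\<^sub>\<le>\<^sub>0"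
  then obtain t where t: "1 - z / of_real \<rho> = of_real t" "t \<le> 0" by (auto simp: nonpos_Reals_def)
  then have "z - of_real \<rho> = of_real (- t * \<rho>)"
    using \<rho> by (simp add: field_simps)
  moreover have "0 \<le> - t * \<rho>" using t \<rho> by (simp add: mult_nonpos_nonneg)
  ultimately have "Re (z - of_real \<rho>) = norm (z - of_real \<rho>)"
    by (metis Re_complex_of_real abs_of_nonneg norm_of_real)
  moreover have "\<kappa> * norm (z - of_real \<rho>) \<le> 1 * norm (z - of_real \<rho>)"
    using \<kappa> by (intro mult_right_mono) auto
  ultimately show False using z by (simp add: slit_disc_def)
qed

text \<open>At n = 0 the formula reads - 1 / 0 = 0, which is the right constant term.\<close>

lemma Ln_has_fps_expansion:
  fixes \<rho> :: real
  assumes "\<rho> > 0"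
  shows "(\<lambda>z. Ln (1 - z / of_real \<rho>)) has_fps_expansion Abs_fps (\<lambda>n. - 1 / (of_nat n * of_real \<rho> ^ n))"
proof (rule has_fps_expansionI)
  have "eventually (\<lambda>z :: complex. z \<in> ball 0 \<rho>) (nhds 0)"
    using assms by (intro eventually_nhds_in_open) auto
  then show "eventually (\<lambda>z :: complex. (\<lambda>n. fps_nth (Abs_fps (\<lambda>n. - 1 / (of_nat n * of_real \<rho> ^ n))) n * z ^ n)
      sums Ln (1 - z / of_real \<rho>)) (nhds 0)"
  proof eventually_elim
    case (elim z)
    then have "cmod (- z / of_real \<rho>) < 1" using assms by (simp add: norm_divide)
    from Ln_series'[OF this] show ?case
      by (simp add: power_divide field_simps)
  qed
qed

text \<open>The principal branch of (1 - z/\<rho>)^(- \<alpha>), kept as an exponential of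
  \<open>Ln\<close> so that it combines with exp (\<phi> M).\<close>

lemma powr_has_fps_expansion:
  fixes \<rho> \<alpha> :: real
  assumes "\<rho> > 0"
  shows "(\<lambda>z. exp (- of_real \<alpha> * Ln (1 - z / of_real \<rho>))) has_fps_expansion
     Abs_fps (\<lambda>n. (- 1 / of_real \<rho>) ^ n * ((- of_real \<alpha>) gchoose n))"
proof -
  let ?L = "fps_const (- 1 / of_real \<rho> :: complex) * fps_X"
  have "(\<lambda>z. (- 1 / of_real \<rho>) * z) has_fps_expansion ?L"
    by (intro fps_expansion_intros)
  then have "((\<lambda>x. (1 + x) powr (- of_real \<alpha>)) \<circ> (\<lambda>z. (- 1 / of_real \<rho>) * z)) has_fps_expansion
      (fps_binomial (- of_real \<alpha>) oo ?L)"
    by (intro has_fps_expansion_compose has_fps_expansion_binomial_complex) auto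
  also have "fps_binomial (- of_real \<alpha>) oo ?L = Abs_fps (\<lambda>n. (- 1 / of_real \<rho>) ^ n * ((- of_real \<alpha>) gchoose n))"
    by (simp add: fps_compose_linear fps_eq_iff)
  finally have 1: "((\<lambda>x. (1 + x) powr (- of_real \<alpha>)) \<circ> (\<lambda>z. (- 1 / of_real \<rho>) * z)) has_fps_expansion \<dots>" .
  have "eventually (\<lambda>z :: complex. z \<in> ball 0 \<rho>) (nhds 0)"
    using assms by (intro eventually_nhds_in_open) auto
  then have "eventually (\<lambda>z. ((\<lambda>x. (1 + x) powr (- of_real \<alpha>)) \<circ> (\<lambda>z. (- 1 / of_real \<rho>) * z)) z =
      exp (- of_real \<alpha> * Ln (1 - z / of_real \<rho>))) (nhds 0)"
  proof eventually_elim
    case (elim z)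
    then have "z \<noteq> of_real \<rho>" using assms by auto
    then show ?case using assms by (simp add: powr_def)
  qed
  from iffD1[OF has_fps_expansion_cong[OF this refl] 1] show ?thesis .
qed

text \<open>The real part of Ln w is ln |w|, so |Ln w| is at least |ln |w||, which tends to infinity
  as w tends to 0.\<close>

lemma inverse_Ln_squared_tendsto_0:
  fixes \<rho> :: real
  assumes \<rho>: "\<rho> > 0"
  shows "((\<lambda>z. 1 / (Ln (1 - z / of_real \<rho>))\<^sup>2) \<longlongrightarrow> 0) (at (of_real \<rho>) within S)"
proof (rule Lim_null_comparison)
  let ?F = "at (of_real \<rho> :: complex) within S"
  have "((\<lambda>z. norm (1 - z / of_real \<rho>)) \<longlongrightarrow> norm (1 - of_real \<rho> / of_real \<rho> :: complex)) ?F"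
    using \<rho> by (intro tendsto_intros) auto
  moreover have nz: "eventually (\<lambda>z. 0 < norm (1 - z / of_real \<rho>)) ?F"
    using \<rho> by (auto simp: eventually_at_filter field_simps)
  ultimately have "filterlim (\<lambda>z. norm (1 - z / of_real \<rho>)) (at_right 0) ?F"
    using \<rho> by (simp add: filterlim_at_withinI eventually_mono)
  moreover have "((\<lambda>t :: real. 1 / (ln t)\<^sup>2) \<longlongrightarrow> 0) (at_right 0)" by real_asymp
  ultimately show "((\<lambda>z. 1 / (ln (norm (1 - z / of_real \<rho>)))\<^sup>2) \<longlongrightarrow> 0) ?F"
    by (rule filterlim_compose[rotated])
  have "eventually (\<lambda>z. norm (1 - z / of_real \<rho>) < 1) ?F"
    using \<open>((\<lambda>z. norm (1 - z / of_real \<rho>)) \<longlongrightarrow> _) ?F\<close> \<rho> by (intro order_tendstoD) auto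
  then show "eventually (\<lambda>z. norm (1 / (Ln (1 - z / of_real \<rho>))\<^sup>2) \<le> 1 / (ln (norm (1 - z / of_real \<rho>)))\<^sup>2) ?F"
    using nz
  proof eventually_elim
    case (elim z)
    let ?w = "1 - z / of_real \<rho>"
    have neg: "ln (norm ?w) < 0" using elim by simp
    have "Re (Ln ?w) = ln (norm ?w)" using elim by (intro Re_Ln) auto
    then have "\<bar>ln (norm ?w)\<bar> \<le> norm (Ln ?w)" by (metis abs_Re_le_cmod)
    then have "(ln (norm ?w))\<^sup>2 \<le> (norm (Ln ?w))\<^sup>2" by (metis abs_ge_zero power2_abs power_mono)
    then show ?case
      using neg by (simp add: norm_divide norm_power frac_le)
  qed
qed

text \<open>Both shapes of the domain contain the slit disc with \<kappa> = cos \<gamma>. On it Ln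
  (1 / w) = - Ln w for w = 1 - z/\<rho>, which turns \<open>FS3\<close> into a limit at
  \<rho>.\<close>

lemma flajolet_soria_slit_disc:
  assumes "flajolet_soria G \<rho> \<theta> c"
  obtains R \<kappa> H where "0 < \<rho>" "\<rho> < R" "0 < \<kappa>" "\<kappa> \<le> 1" "0 < \<theta>"
    "H holomorphic_on slit_disc \<rho> \<kappa> R" "H has_fps_expansion G"
    "((\<lambda>z. H z + of_real \<theta> * Ln (1 - z / of_real \<rho>)) \<longlongrightarrow> of_real c) (at (of_real \<rho>) within slit_disc \<rho> \<kappa> R)"
proof -
  obtain D H where \<rho>: "0 < \<rho>" and conv: "fps_conv_radius G = ereal \<rho>" and \<theta>: "0 < \<theta>"
    and FS: "FS2 G \<rho> D H" "FS3 \<rho> \<theta> c D H"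
    using assms unfolding flajolet_soria_def by blast
  obtain R \<gamma> where R: "R > \<rho>" "0 \<le> \<gamma>" "\<gamma> < pi / 2" "D = ball 0 R \<or> D = ball 0 R - wedge \<rho> \<gamma>"
    and hol: "H holomorphic_on D" and eq: "\<forall>z\<in>ball 0 \<rho>. H z = eval_fps G z"
    using FS(1) unfolding FS2_def by blast
  define \<kappa> where "\<kappa> = cos \<gamma>"
  have \<kappa>: "0 < \<kappa>" "\<kappa> \<le> 1" using R by (auto simp: \<kappa>_def intro!: cos_gt_zero_pi)
  have sub: "slit_disc \<rho> \<kappa> R \<subseteq> D"
    using R ball_minus_wedge_eq_slit_disc[of \<gamma> R \<rho>] by (auto simp: \<kappa>_def)
  let ?F = "at (of_real \<rho>) within slit_disc \<rho> \<kappa> R"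
  let ?f = "\<lambda>z. H z - (of_real \<theta> * Ln (1 / (1 - z / of_real \<rho>)) + of_real c)"
  have "?f \<in> O[?F](\<lambda>z. 1 / (Ln (1 - z / of_real \<rho>))\<^sup>2)"
    using FS(2) unfolding FS3_def by (rule landau_o.big.filter_mono[OF at_le[OF sub]])
  also have "(\<lambda>z. 1 / (Ln (1 - z / of_real \<rho>))\<^sup>2) \<in> o[?F](\<lambda>_. 1)"
    using inverse_Ln_squared_tendsto_0[OF \<rho>] by (intro smalloI_tendsto) auto
  finally have "(?f \<longlongrightarrow> 0) ?F" using smalloD_tendsto by fastforce
  then have lim: "((\<lambda>z. ?f z + of_real c) \<longlongrightarrow> 0 + of_real c) ?F" by (intro tendsto_intros)
  have "eventually (\<lambda>z. ?f z + of_real c = H z + of_real \<theta> * Ln (1 - z / of_real \<rho>)) ?F"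
    unfolding eventually_at_filter
  proof (intro always_eventually allI impI)
    fix z assume "z \<in> slit_disc \<rho> \<kappa> R"
    then have "Ln (1 / (1 - z / of_real \<rho>)) = - Ln (1 - z / of_real \<rho>)"
      using Ln_inverse[OF slit_disc_notin_nonpos_Reals[OF _ \<rho> \<kappa>(2)]] by (simp add: divide_inverse)
    then show "?f z + of_real c = H z + of_real \<theta> * Ln (1 - z / of_real \<rho>)" by simp
  qed
  with lim have "((\<lambda>z. H z + of_real \<theta> * Ln (1 - z / of_real \<rho>)) \<longlongrightarrow> of_real c) ?F"
    by (auto intro: Lim_transform_eventually)
  moreover have "H has_fps_expansion G"
  proof -
    have "eventually (\<lambda>z :: complex. z \<in> ball 0 \<rho>) (nhds 0)"
      using \<rho> by (intro eventually_nhds_in_open) auto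
    then have "eventually (\<lambda>z. eval_fps G z = H z) (nhds 0)"
      by eventually_elim (use eq in auto)
    then show ?thesis using conv \<rho> by (simp add: has_fps_expansion_def)
  qed
  ultimately show ?thesis
    using that[of R \<kappa> H] \<rho> R \<kappa> \<theta> holomorphic_on_subset[OF hol sub] by blast
qed

text \<open>The coefficients of - log (1 - z/\<rho>) are \<rho>^(- n) / n. Subtracting \<theta>
  times this series and c leaves a function with limit 0 at \<rho>, and the transfer theorem with
  \<alpha> = 0 bounds its coefficients.\<close>

lemma flajolet_soria_coeffs:
  assumes "flajolet_soria G \<rho> \<theta> c"
  shows "(\<lambda>n. of_nat n * fps_nth G n * of_real \<rho> ^ n) \<longlonglongrightarrow> of_real \<theta>"
proof -
  obtain R \<kappa> H where \<rho>: "0 < \<rho>" "\<rho> < R" and \<kappa>: "0 < \<kappa>" "\<kappa> \<le> 1"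
    and hol: "H holomorphic_on slit_disc \<rho> \<kappa> R" and H: "H has_fps_expansion G"
    and lim: "((\<lambda>z. H z + of_real \<theta> * Ln (1 - z / of_real \<rho>)) \<longlongrightarrow> of_real c) (at (of_real \<rho>) within slit_disc \<rho> \<kappa> R)"
    using flajolet_soria_slit_disc[OF assms] by blast
  let ?f = "\<lambda>z. H z + of_real \<theta> * Ln (1 - z / of_real \<rho>) - of_real c"
  let ?A = "G + fps_const (of_real \<theta>) * Abs_fps (\<lambda>n. - 1 / (of_nat n * of_real \<rho> ^ n)) - fps_const (of_real c)"
  have "(\<lambda>n. norm (fps_nth ?A n) * \<rho> ^ n * real n powr (1 - 0)) \<longlonglongrightarrow> 0"
  proof (rule fps_coeff_transfer[OF \<rho> \<kappa>])
    show "?f holomorphic_on slit_disc \<rho> \<kappa> R"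
      using slit_disc_notin_nonpos_Reals \<rho> \<kappa> by (intro holomorphic_intros hol) auto
    show "?f has_fps_expansion ?A"
      by (intro fps_expansion_intros H Ln_has_fps_expansion \<rho>)
    have "((\<lambda>z. norm (?f z)) \<longlongrightarrow> 0) (at (of_real \<rho>) within slit_disc \<rho> \<kappa> R)"
      using tendsto_diff[OF lim tendsto_const[of "of_real c"]] by (intro tendsto_norm_zero) simp
    moreover have "eventually (\<lambda>z. norm (?f z) = norm (?f z) * norm (of_real \<rho> - z) powr 0)
        (at (of_real \<rho>) within slit_disc \<rho> \<kappa> R)"
      by (auto simp: eventually_at_filter)
    ultimately show "((\<lambda>z. norm (?f z) * norm (of_real \<rho> - z) powr 0) \<longlongrightarrow> 0) (at (of_real \<rho>) within slit_disc \<rho> \<kappa> R)"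
      by (rule Lim_transform_eventually)
  qed simp
  moreover have "eventually (\<lambda>n. norm (fps_nth ?A n) * \<rho> ^ n * real n powr (1 - 0) =
      norm (of_nat n * fps_nth G n * of_real \<rho> ^ n - of_real \<theta>)) sequentially"
    using eventually_gt_at_top[of 0]
  proof eventually_elim
    case (elim n)
    have "of_nat n * fps_nth G n * of_real \<rho> ^ n - of_real \<theta> = fps_nth ?A n * of_real \<rho> ^ n * of_nat n"
      using elim \<rho> by (simp add: field_simps)
    also have "norm \<dots> = norm (fps_nth ?A n) * \<rho> ^ n * real n"
      using \<rho> by (simp only: norm_mult norm_power norm_of_real norm_of_nat abs_of_pos)
    finally show ?case using elim by simp
  qed
  ultimately have "(\<lambda>n. norm (of_nat n * fps_nth G n * of_real \<rho> ^ n - of_real \<theta>)) \<longlonglongrightarrow> 0"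
    by (rule Lim_transform_eventually)
  then show ?thesis
    using tendsto_norm_zero_iff LIM_zero_iff by blast
qed

section \<open>The Euler product, through formal logarithmic derivatives\<close>

text \<open>Since L has no constant term, the coefficient n y_n is a sum over y_i with i < n, which
  determines the series in characteristic 0. Product formulas can thus be verified by logarithmic
  derivatives alone.\<close>

lemma fps_log_deriv_unique:
  fixes Y Z L :: "'a :: field_char_0 fps"
  assumes Y: "fps_X * fps_deriv Y = Y * L" and Z: "fps_X * fps_deriv Z = Z * L"
    and L: "fps_nth L 0 = 0" and 0: "fps_nth Y 0 = fps_nth Z 0"
  shows "Y = Z"
proof -
  have rec: "of_nat n * fps_nth F n = (\<Sum>i<n. fps_nth F i * fps_nth L (n - i))"
    if F: "fps_X * fps_deriv F = F * L" for F n
  proof -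
    have "of_nat n * fps_nth F n = fps_nth (fps_X * fps_deriv F) n"
      by (cases n) (auto simp: algebra_simps)
    also have "\<dots> = (\<Sum>i=0..n. fps_nth F i * fps_nth L (n - i))"
      unfolding F fps_mult_nth ..
    also have "\<dots> = (\<Sum>i<n. fps_nth F i * fps_nth L (n - i))"
      using L by (intro sum.mono_neutral_right) (auto simp: not_less)
    finally show ?thesis .
  qed
  have "fps_nth Y n = fps_nth Z n" for n
  proof (induction n rule: less_induct)
    case (less n)
    show ?case
    proof (cases "n = 0")
      case False
      have "of_nat n * fps_nth Y n = of_nat n * fps_nth Z n"
        unfolding rec[OF Y] rec[OF Z] using less by (intro sum.cong) auto
      then show ?thesis using False by simp
    qed (use 0 in simp)
  qed
  then show ?thesis by (simp add: fps_eq_iff)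
qed

lemma fps_log_deriv_mult:
  fixes Y Z L M :: "'a :: comm_ring_1 fps"
  assumes "fps_X * fps_deriv Y = Y * L" "fps_X * fps_deriv Z = Z * M"
  shows "fps_X * fps_deriv (Y * Z) = (Y * Z) * (L + M)"
proof -
  have "fps_X * fps_deriv (Y * Z) = Y * (fps_X * fps_deriv Z) + fps_X * fps_deriv Y * Z"
    by (simp add: algebra_simps)
  also have "\<dots> = (Y * Z) * (L + M)" unfolding assms by (simp add: algebra_simps)
  finally show ?thesis .
qed

lemma fps_log_deriv_power:
  fixes Y L :: "'a :: comm_ring_1 fps"
  assumes "fps_X * fps_deriv Y = Y * L"
  shows "fps_X * fps_deriv (Y ^ n) = Y ^ n * (of_nat n * L)"
proof (induction n)
  case (Suc n)
  show ?case using fps_log_deriv_mult[OF assms Suc] by (simp add: algebra_simps)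
qed simp

lemma fps_log_deriv_prod:
  fixes Y L :: "'b \<Rightarrow> 'a :: comm_ring_1 fps"
  assumes "\<And>j. j \<in> S \<Longrightarrow> fps_X * fps_deriv (Y j) = Y j * L j"
  shows "fps_X * fps_deriv (\<Prod>j\<in>S. Y j) = (\<Prod>j\<in>S. Y j) * (\<Sum>j\<in>S. L j)"
  using assms
proof (induction S rule: infinite_finite_induct)
  case (insert x S)
  then show ?case
    unfolding prod.insert[OF insert.hyps(1,2)] sum.insert[OF insert.hyps(1,2)]
    by (intro fps_log_deriv_mult) auto
qed auto

context irreducibles
begin

definition log_fps :: "nat \<Rightarrow> complex fps" where
  "log_fps j = Abs_fps (\<lambda>d. of_real (log_coeff j d))"

definition gen_fps :: "complex fps" where
  "gen_fps = Abs_fps (\<lambda>n. of_real (partition_fun n))"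

text \<open>For selections, the polynomial factors of weight below i0, whose logarithms may be
  singular inside the disc of radius \<rho>. Multisets use i0 = 1, where the product is
  empty.\<close>

definition low_fps :: "nat \<Rightarrow> complex fps" where
  "low_fps i0 = (\<Prod>j\<in>{1..<i0}. (1 + fps_const (of_real \<phi>) * fps_X ^ j) ^ mult j)"

text \<open>The part of the logarithm of degree at least 2 in \<phi>, from kinds of weight at least
  i0: as j < d, the power z^d is at least the square of z^j. The linear part is \<phi> times
  \<open>kinds_from\<close>.\<close>

definition log_tail :: "nat \<Rightarrow> nat \<Rightarrow> real" where
  "log_tail i0 d = (\<Sum>j\<in>{i0..<d}. real (mult j) * log_coeff j d) / real d"

definition kinds_from :: "nat \<Rightarrow> complex fps" where
  "kinds_from i0 = Abs_fps (\<lambda>d. if d \<ge> i0 then of_nat (mult d) else 0)"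

lemma low_factor_log_deriv:
  assumes distinct_parts and j: "j > 0"
  shows "fps_X * fps_deriv (1 + fps_const (of_real \<phi>) * fps_X ^ j) =
     (1 + fps_const (of_real \<phi>) * fps_X ^ j) * log_fps j" (is "?l = ?r")
proof (rule fps_ext)
  fix n
  have sgn: "sgn_parts = -1" unfolding sgn_parts_def if_P[OF assms(1)] ..
  have "fps_nth ?l n = (if n = j then of_nat j * of_real \<phi> else 0)"
    using j by (cases n) (auto simp: fps_deriv_power fps_X_power_nth fps_deriv_mult)
  moreover have "fps_nth ?r n = of_real (log_coeff j n) + (if n \<ge> j then of_real (\<phi> * log_coeff j (n - j)) else 0)"
    by (simp add: distrib_right log_fps_def mult.assoc fps_X_power_mult_nth)
  moreover have "log_coeff j n = - \<phi> * log_coeff j (n - j)" if "n > j"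
    using log_coeff_shift[OF j, of "n - j"] that sgn by simp
  moreover have "log_coeff j n = 0" if "n < j" using that by (rule log_coeff_eq_0)
  moreover have "log_coeff j 0 = 0" by (simp add: log_coeff_def)
  moreover have "log_coeff j j = real j * \<phi>" using log_coeff_self[OF j] .
  ultimately show "fps_nth ?l n = fps_nth ?r n"
    by (cases n j rule: linorder_cases) auto
qed

lemma low_fps_log_deriv:
  assumes "\<not> distinct_parts \<Longrightarrow> i0 = 1"
  shows "fps_X * fps_deriv (low_fps i0) = low_fps i0 * (\<Sum>j\<in>{1..<i0}. of_nat (mult j) * log_fps j)"
proof (cases distinct_parts)
  case True
  show ?thesis unfolding low_fps_def
    by (intro fps_log_deriv_prod fps_log_deriv_power low_factor_log_deriv True) auto
qed (use assms in \<open>simp add: low_fps_def\<close>)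

lemma gen_fps_log_deriv:
  "fps_X * fps_deriv gen_fps = gen_fps * Abs_fps (\<lambda>d. of_real (\<Sum>j\<in>{1..d}. real (mult j) * log_coeff j d))"
  (is "?l = ?r")
proof (rule fps_ext)
  fix n
  have "fps_nth ?l n = of_real (real n * partition_fun n)"
    by (cases n) (auto simp: gen_fps_def algebra_simps)
  also have "\<dots> = of_real (\<Sum>d\<in>{1..n}. (\<Sum>j\<in>{1..d}. real (mult j) * log_coeff j d) * partition_fun (n - d))"
    by (subst partition_fun_rec) simp
  also have "\<dots> = of_real (\<Sum>d\<in>{0..n}. (\<Sum>j\<in>{1..d}. real (mult j) * log_coeff j d) * partition_fun (n - d))"
    by (intro arg_cong[where f = of_real] sum.mono_neutral_left) auto
  also have "\<dots> = fps_nth (Abs_fps (\<lambda>d. of_real (\<Sum>j\<in>{1..d}. real (mult j) * log_coeff j d)) * gen_fps) n"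
    by (simp add: fps_mult_nth gen_fps_def)
  finally show "fps_nth ?l n = fps_nth ?r n" by (simp add: mult.commute)
qed

text \<open>The Euler product with the singular part \<phi> M isolated in the exponent. Both sides
  have constant term 1 and the same logarithmic derivative; kinds below i0 contribute through the
  polynomial, the others through the exponent.\<close>

theorem gen_fps_eq:
  assumes i0: "i0 \<ge> 1" "\<not> distinct_parts \<Longrightarrow> i0 = 1"
  shows "gen_fps = low_fps i0 * (fps_exp 1 oo
      (fps_const (of_real \<phi>) * kinds_from i0 + Abs_fps (\<lambda>d. of_real (log_tail i0 d))))" (is "_ = _ * (_ oo ?L)")
proof (rule fps_log_deriv_unique)
  let ?\<Lambda> = "Abs_fps (\<lambda>d. of_real (\<Sum>j\<in>{1..d}. real (mult j) * log_coeff j d)) :: complex fps"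
  show "fps_X * fps_deriv gen_fps = gen_fps * ?\<Lambda>" by (rule gen_fps_log_deriv)
  have L0: "fps_nth ?L 0 = 0" using i0 by (simp add: kinds_from_def log_tail_def)
  have "fps_X * fps_deriv (fps_exp 1 oo ?L) = (fps_exp 1 oo ?L) * (fps_X * fps_deriv ?L)"
    using L0 by (simp add: fps_compose_deriv fps_exp_deriv mult_ac)
  from fps_log_deriv_mult[OF low_fps_log_deriv[OF i0(2)] this]
  have "fps_X * fps_deriv (low_fps i0 * (fps_exp 1 oo ?L)) =
      low_fps i0 * (fps_exp 1 oo ?L) * ((\<Sum>j\<in>{1..<i0}. of_nat (mult j) * log_fps j) + fps_X * fps_deriv ?L)" .
  also have "(\<Sum>j\<in>{1..<i0}. of_nat (mult j) * log_fps j) + fps_X * fps_deriv ?L = ?\<Lambda>"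
  proof (rule fps_ext)
    fix d
    have low: "fps_nth (\<Sum>j\<in>{1..<i0}. of_nat (mult j) * log_fps j) d =
        of_real (\<Sum>j\<in>{1..<i0}. real (mult j) * log_coeff j d)"
      by (simp add: fps_sum_nth log_fps_def fps_of_nat[symmetric] del: fps_of_nat)
    have high: "fps_nth (fps_X * fps_deriv ?L) d = of_real (\<Sum>j\<in>{i0..d}. real (mult j) * log_coeff j d)"
    proof (cases "d \<ge> i0")
      case True
      then have d: "d > 0" using i0 by simp
      have "fps_nth (fps_X * fps_deriv ?L) d = of_nat d * fps_nth ?L d"
        using d by (cases d) (auto simp: algebra_simps)
      also have "\<dots> = of_real (real (mult d) * log_coeff d d + (\<Sum>j\<in>{i0..<d}. real (mult j) * log_coeff j d))"
        using d True by (simp add: kinds_from_def log_tail_def log_coeff_self field_simps)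
      also have "real (mult d) * log_coeff d d + (\<Sum>j\<in>{i0..<d}. real (mult j) * log_coeff j d) =
          (\<Sum>j\<in>{i0..d}. real (mult j) * log_coeff j d)"
        using True by (simp add: sum.last_plus)
      finally show ?thesis .
    next
      case False
      then show ?thesis by (cases d) (auto simp: kinds_from_def log_tail_def)
    qed
    have "(\<Sum>j\<in>{1..<i0}. real (mult j) * log_coeff j d) + (\<Sum>j\<in>{i0..d}. real (mult j) * log_coeff j d) =
        (\<Sum>j\<in>{1..<i0} \<union> {i0..d}. real (mult j) * log_coeff j d)"
      by (intro sum.union_disjoint[symmetric]) auto
    also have "\<dots> = (\<Sum>j\<in>{1..d}. real (mult j) * log_coeff j d)"
      using i0 by (intro sum.mono_neutral_right) (auto simp: log_coeff_eq_0 not_le)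
    finally show "fps_nth ((\<Sum>j\<in>{1..<i0}. of_nat (mult j) * log_fps j) + fps_X * fps_deriv ?L) d = fps_nth ?\<Lambda> d"
      unfolding fps_add_nth low high of_real_add[symmetric] by simp
  qed
  finally show "fps_X * fps_deriv (low_fps i0 * (fps_exp 1 oo ?L)) = low_fps i0 * (fps_exp 1 oo ?L) * ?\<Lambda>" .
  show "fps_nth ?\<Lambda> 0 = 0" by simp
  have "fps_nth (low_fps i0) 0 = 1"
    by (auto simp: low_fps_def fps_prod_nth' fps_nth_power_0 fps_X_power_nth power_0_left intro!: prod.neutral)
  then show "fps_nth gen_fps 0 = fps_nth (low_fps i0 * (fps_exp 1 oo ?L)) 0"
    by (simp add: gen_fps_def)
qed

end

section \<open>Asymptotics of the partition function\<close>

lemma gbinomial_powr_asymptotic: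
  fixes \<alpha> :: real
  shows "(\<lambda>n. (- 1) ^ n * ((- of_real \<alpha> :: complex) gchoose n) * of_real (real n powr (1 - \<alpha>)))
     \<longlonglongrightarrow> inverse (Gamma (of_real \<alpha>))"
proof -
  have "(\<lambda>n. (- of_real \<alpha> gchoose n) / ((- 1) ^ n / exp ((- of_real \<alpha> + 1) * of_real (ln (real n)))))
      \<longlonglongrightarrow> inverse (Gamma (- (- complex_of_real \<alpha>)))"
    by (rule gbinomial_asymptotic)
  moreover have "eventually (\<lambda>n. (- of_real \<alpha> gchoose n) / ((- 1) ^ n / exp ((- of_real \<alpha> + 1) * of_real (ln (real n)))) =
      (- 1) ^ n * ((- of_real \<alpha> :: complex) gchoose n) * of_real (real n powr (1 - \<alpha>))) sequentially"
    using eventually_gt_at_top[of 0]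
  proof eventually_elim
    case (elim n)
    have "complex_of_real (real n powr (1 - \<alpha>)) = exp ((- of_real \<alpha> + 1) * of_real (ln (real n)))"
      using elim by (simp add: powr_def exp_of_real[symmetric] mult.commute)
    moreover have "x / ((- 1) ^ n / y) = (- 1) ^ n * x * y" for x y :: complex
      by (cases "even n") auto
    ultimately show ?case by simp
  qed
  ultimately show ?thesis by (auto intro: Lim_transform_eventually)
qed

lemma sum_power_from_2_le:
  fixes y y0 :: real
  assumes "0 \<le> y" "y \<le> y0" "y0 < 1"
  shows "(\<Sum>l\<in>{2..N}. y ^ l) \<le> y\<^sup>2 / (1 - y0)"
proof (cases "2 \<le> N")
  case True
  have "(1 - y0) * (\<Sum>l\<in>{2..N}. y ^ l) \<le> (1 - y) * (\<Sum>l\<in>{2..N}. y ^ l)"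
    using assms by (intro mult_right_mono sum_nonneg) auto
  also have "\<dots> = y\<^sup>2 - y ^ Suc N" by (rule sum_gp_multiplied[OF True])
  also have "\<dots> \<le> y\<^sup>2" using assms by simp
  finally show ?thesis using assms by (simp add: field_simps)
qed (use assms in simp)

context irreducibles
begin

text \<open>Only the multiples d = j l with l \<ge> 2 contribute, which makes the bound quadratic in
  \<phi> x^j.\<close>

lemma abs_log_coeff_sum_le:
  fixes x :: real
  assumes j: "j > 0" and x: "0 \<le> x" and y0: "\<phi> * x ^ j \<le> y0" "y0 < 1"
  shows "(\<Sum>d\<in>{j+1..N}. \<bar>log_coeff j d\<bar> * x ^ d) \<le> real j * ((\<phi> * x ^ j)\<^sup>2 / (1 - y0))"
proof -
  let ?S = "{d \<in> {j+1..N}. j dvd d}"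
  have "(\<Sum>d\<in>{j+1..N}. \<bar>log_coeff j d\<bar> * x ^ d) = (\<Sum>d\<in>?S. real j * (\<phi> * x ^ j) ^ (d div j))"
  proof (intro sum.mono_neutral_cong_right ballI)
    fix d assume "d \<in> ?S"
    then obtain l where d: "d = j * l" by auto
    then have "l > 0" using \<open>d \<in> ?S\<close> by (cases l) auto
    have "\<bar>sgn_parts\<bar> = 1" by (simp add: sgn_parts_def)
    then show "\<bar>log_coeff j d\<bar> * x ^ d = real j * (\<phi> * x ^ j) ^ (d div j)"
      using j \<phi> x \<open>l > 0\<close> unfolding d
      by (simp add: log_coeff_def abs_mult power_abs power_mult_distrib power_mult)
  qed (auto simp: log_coeff_def)
  also have "\<dots> = (\<Sum>l\<in>(\<lambda>d. d div j) ` ?S. real j * (\<phi> * x ^ j) ^ l)"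
    by (subst sum.reindex) (auto intro!: inj_onI, metis dvd_div_mult_self)
  also have "\<dots> \<le> (\<Sum>l\<in>{2..N}. real j * (\<phi> * x ^ j) ^ l)"
  proof (intro sum_mono2)
    show "(\<lambda>d. d div j) ` ?S \<subseteq> {2..N}"
    proof safe
      fix d assume d: "d \<in> {j+1..N}" "j dvd d"
      then obtain l where l: "d = j * l" by auto
      with d j have "l \<noteq> 0" "l \<noteq> 1" by (auto intro: ccontr)
      moreover have "l \<le> j * l" "j * l \<le> N" using j d l by simp_all
      then have "l \<le> N" by (rule le_trans)
      ultimately show "d div j \<in> {2..N}" using l j by auto
    qed
  qed (use \<phi> x in auto)
  also have "\<dots> = real j * (\<Sum>l\<in>{2..N}. (\<phi> * x ^ j) ^ l)" by (simp add: sum_distrib_left)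
  also have "\<dots> \<le> real j * ((\<phi> * x ^ j)\<^sup>2 / (1 - y0))"
    using \<phi> x y0 by (intro mult_left_mono sum_power_from_2_le) auto
  finally show ?thesis .
qed

text \<open>The quadratic bound together with j m_j = O(\<rho>^(- j)) leaves a geometric series of
  ratio x^2 / \<rho>. For \<rho> < 1 such an x exists beyond \<rho>, so the tail does not disturb
  the singularity.\<close>

lemma log_tail_conv_radius:
  fixes x \<rho> :: real
  assumes bound: "\<And>j. real j * real (mult j) * \<rho> ^ j \<le> Bm" and \<rho>: "0 < \<rho>"
    and x: "0 < x" "x < 1" "x\<^sup>2 < \<rho>" "\<phi> * x ^ i0 < 1" and i0: "i0 \<ge> 1"
  shows "fps_conv_radius (Abs_fps (\<lambda>d. of_real (log_tail i0 d)) :: complex fps) \<ge> ereal x"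
proof -
  define y0 where "y0 = \<phi> * x ^ i0"
  define e where "e d = (\<Sum>j\<in>{i0..<d}. real (mult j) * \<bar>log_coeff j d\<bar>) * x ^ d" for d
  define K where "K = \<phi>\<^sup>2 / (1 - y0) * Bm / (1 - x\<^sup>2 / \<rho>)"
  have Bm: "0 \<le> Bm" using bound[of 0] by simp
  have xr: "0 \<le> x\<^sup>2 / \<rho>" "x\<^sup>2 / \<rho> < 1" using x \<rho> by auto
  have e0: "0 \<le> e d" for d using x by (auto simp: e_def intro!: mult_nonneg_nonneg sum_nonneg)
  have "(\<Sum>d<n. e d) \<le> K" for n
  proof -
    have "(\<Sum>d<n. e d) = (\<Sum>d<n. \<Sum>j\<in>{i0..<d}. real (mult j) * (\<bar>log_coeff j d\<bar> * x ^ d))"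
      unfolding e_def by (simp add: sum_distrib_right mult.assoc)
    also have "\<dots> = (\<Sum>(d, j)\<in>(SIGMA d:{..<n}. {i0..<d}). real (mult j) * (\<bar>log_coeff j d\<bar> * x ^ d))"
      by (subst sum.Sigma) auto
    also have "\<dots> = (\<Sum>(j, d)\<in>(SIGMA j:{i0..<n}. {j+1..<n}). real (mult j) * (\<bar>log_coeff j d\<bar> * x ^ d))"
      by (intro sum.reindex_bij_witness[of _ "\<lambda>(j, d). (d, j)" "\<lambda>(d, j). (j, d)"]) auto
    also have "\<dots> = (\<Sum>j\<in>{i0..<n}. real (mult j) * (\<Sum>d\<in>{j+1..<n}. \<bar>log_coeff j d\<bar> * x ^ d))"
      by (subst sum.Sigma[symmetric]) (auto simp: sum_distrib_left)
    also have "\<dots> \<le> (\<Sum>j\<in>{i0..<n}. real (mult j) * (real j * ((\<phi> * x ^ j)\<^sup>2 / (1 - y0))))"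
    proof (intro sum_mono mult_left_mono)
      fix j assume j: "j \<in> {i0..<n}"
      have "x ^ j \<le> x ^ i0" using j x by (intro power_decreasing) auto
      then have "\<phi> * x ^ j \<le> y0" unfolding y0_def using \<phi> by (intro mult_left_mono) auto
      moreover have "{j+1..<n} = {j+1..n - 1}" using j by auto
      ultimately show "(\<Sum>d\<in>{j+1..<n}. \<bar>log_coeff j d\<bar> * x ^ d) \<le> real j * ((\<phi> * x ^ j)\<^sup>2 / (1 - y0))"
        using abs_log_coeff_sum_le[of j x y0 "n - 1"] j i0 x by (simp add: y0_def)
    qed simp
    also have "\<dots> = \<phi>\<^sup>2 / (1 - y0) * (\<Sum>j\<in>{i0..<n}. (real j * real (mult j) * \<rho> ^ j) * (x\<^sup>2 / \<rho>) ^ j)"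
      using \<rho> by (simp add: sum_distrib_left power_mult_distrib power_divide power_mult[symmetric] mult_ac)
    also have "\<dots> \<le> \<phi>\<^sup>2 / (1 - y0) * (\<Sum>j\<in>{i0..<n}. Bm * (x\<^sup>2 / \<rho>) ^ j)"
      using x xr by (intro mult_left_mono sum_mono mult_right_mono bound) (auto simp: y0_def)
    also have "\<dots> \<le> \<phi>\<^sup>2 / (1 - y0) * (Bm * (\<Sum>j. (x\<^sup>2 / \<rho>) ^ j))"
      unfolding sum_distrib_left[symmetric] using x xr Bm
      by (intro mult_left_mono sum_le_suminf summable_geometric) (auto simp: y0_def)
    also have "\<dots> = K" using xr by (simp add: K_def suminf_geometric)
    finally show ?thesis .
  qed
  then have summable: "summable e" using e0 by (intro bounded_imp_summable[of e K]) (auto simp: lessThan_Suc_atMost[symmetric] simp del: sum.lessThan_Suc)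
  have "summable (\<lambda>d. complex_of_real (log_tail i0 d) * of_real x ^ d)"
  proof (rule summable_comparison_test'[OF summable, of 1])
    fix d :: nat assume d: "d \<ge> 1"
    have "\<bar>\<Sum>j\<in>{i0..<d}. real (mult j) * log_coeff j d\<bar> \<le> (\<Sum>j\<in>{i0..<d}. real (mult j) * \<bar>log_coeff j d\<bar>)"
      by (intro order_trans[OF sum_abs]) (simp add: abs_mult)
    also have "\<dots> \<le> real d * (\<Sum>j\<in>{i0..<d}. real (mult j) * \<bar>log_coeff j d\<bar>)"
      using d mult_right_mono[of 1 "real d" "\<Sum>j\<in>{i0..<d}. real (mult j) * \<bar>log_coeff j d\<bar>"]
      by (simp add: sum_nonneg)
    finally have "\<bar>log_tail i0 d\<bar> \<le> (\<Sum>j\<in>{i0..<d}. real (mult j) * \<bar>log_coeff j d\<bar>)"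
      using d by (simp add: log_tail_def abs_divide divide_le_eq mult.commute)
    then have "\<bar>log_tail i0 d\<bar> * x ^ d \<le> e d"
      unfolding e_def using x by (intro mult_right_mono) auto
    then show "norm (complex_of_real (log_tail i0 d) * of_real x ^ d) \<le> e d"
      using x by (simp add: norm_mult norm_power)
  qed
  then have "conv_radius (\<lambda>d. complex_of_real (log_tail i0 d)) \<ge> norm (complex_of_real x)"
    by (intro conv_radius_geI)
  then show ?thesis using x by (simp add: fps_conv_radius_def)
qed

text \<open>Near \<rho> the generating function behaves like C (1 - z/\<rho>)^(- \<phi>\<theta>):
  the power comes from exp (\<phi> M), and the remaining factors are continuous and nonzero at
  \<rho>. The difference is transferred; the binomial coefficients of the singular part supply the
  main term.\<close>

theorem partition_fun_asymptotics:
  assumes fs: "flajolet_soria (irreducibles_fps mult) \<rho> \<theta> c" and \<rho>1: "\<rho> < 1"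
    and \<phi>\<rho>: "\<not> distinct_parts \<Longrightarrow> \<phi> < 1 / \<rho>"
  shows "\<exists>K>0. (\<lambda>n. partition_fun n * \<rho> ^ n * real n powr (1 - \<phi> * \<theta>)) \<longlonglongrightarrow> K"
proof -
  obtain R \<kappa> H where \<rho>: "0 < \<rho>" "\<rho> < R" and \<kappa>: "0 < \<kappa>" "\<kappa> \<le> 1" and \<theta>: "0 < \<theta>"
    and hol: "H holomorphic_on slit_disc \<rho> \<kappa> R" and H: "H has_fps_expansion irreducibles_fps mult"
    and lim: "((\<lambda>z. H z + of_real \<theta> * Ln (1 - z / of_real \<rho>)) \<longlongrightarrow> of_real c) (at (of_real \<rho>) within slit_disc \<rho> \<kappa> R)"
    using flajolet_soria_slit_disc[OF fs] by blast
  define \<alpha> where "\<alpha> = \<phi> * \<theta>"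
  have \<alpha>: "\<alpha> > 0" using \<phi> \<theta> by (simp add: \<alpha>_def)
  have "convergent (\<lambda>n. of_nat n * fps_nth (irreducibles_fps mult) n * complex_of_real \<rho> ^ n)"
    using flajolet_soria_coeffs[OF fs] by (auto simp: convergent_def)
  then obtain Bm where Bm: "norm (of_nat n * fps_nth (irreducibles_fps mult) n * complex_of_real \<rho> ^ n) \<le> Bm" for n
    using convergent_imp_Bseq[of "\<lambda>n. of_nat n * fps_nth (irreducibles_fps mult) n * complex_of_real \<rho> ^ n"]
    unfolding Bseq_def by blast
  have bound: "real j * real (mult j) * \<rho> ^ j \<le> Bm" for j
    using Bm[of j] \<rho> by (cases "j = 0") (auto simp: irreducibles_fps_def norm_mult norm_power)
  \<comment> \<open>For multisets i0 = 1 and the bound is \<phi> < 1/\<rho>; for selections \<rho> <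
    1 allows i0 to be taken large.\<close>
  obtain i0 where i0: "i0 \<ge> 1" "\<not> distinct_parts \<Longrightarrow> i0 = 1" "\<phi> * \<rho> ^ i0 < 1"
  proof (cases distinct_parts)
    case True
    have "(\<lambda>i. \<phi> * \<rho> ^ i) \<longlonglongrightarrow> \<phi> * 0"
      using \<rho> \<rho>1 by (intro tendsto_intros LIMSEQ_power_zero) auto
    then have "eventually (\<lambda>i. \<phi> * \<rho> ^ i < 1) sequentially"
      by (rule order_tendstoD) simp
    then obtain N where "\<phi> * \<rho> ^ i < 1" if "i \<ge> N" for i by (auto simp: eventually_sequentially)
    then show ?thesis using that[of "max 1 N"] True by auto
  next
    case False
    then show ?thesis using that[of 1] \<phi>\<rho> \<rho> by (simp add: field_simps)
  qed
  \<comment> \<open>The upper bounds hold strictly at \<rho> itself, hence also slightly to the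
    right of it.\<close>
  have "eventually (\<lambda>x. x < 1 \<and> x\<^sup>2 < \<rho> \<and> \<phi> * x ^ i0 < 1 \<and> x > \<rho>) (at_right \<rho>)"
  proof (intro eventually_conj)
    show "eventually (\<lambda>x. x < 1) (at_right \<rho>)"
      by (rule order_tendstoD(2)[OF tendsto_ident_at \<rho>1])
    have "\<rho>\<^sup>2 < \<rho>" using \<rho> \<rho>1 by (simp add: power2_eq_square)
    then show "eventually (\<lambda>x. x\<^sup>2 < \<rho>) (at_right \<rho>)"
      by (intro order_tendstoD(2)[of _ "\<rho>\<^sup>2"] tendsto_intros)
    show "eventually (\<lambda>x. \<phi> * x ^ i0 < 1) (at_right \<rho>)"
      by (intro order_tendstoD(2)[OF _ i0(3)] tendsto_intros)
    show "eventually (\<lambda>x. x > \<rho>) (at_right \<rho>)"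
      by (simp add: eventually_at_right_less)
  qed
  then obtain x where x: "x < 1" "x\<^sup>2 < \<rho>" "\<phi> * x ^ i0 < 1" "x > \<rho>"
    using eventually_happens'[OF trivial_limit_at_right_real] by blast
  define E where "E = (Abs_fps (\<lambda>d. of_real (log_tail i0 d)) :: complex fps)"
  have E_radius: "fps_conv_radius E \<ge> ereal x"
    unfolding E_def using x \<rho> by (intro log_tail_conv_radius[OF bound \<rho>(1)] i0) auto
  define R' where "R' = min R x"
  have R': "\<rho> < R'" "R' \<le> R" "R' \<le> x" using \<rho> x by (auto simp: R'_def)
  let ?D = "slit_disc \<rho> \<kappa> R'"
  define low :: "complex \<Rightarrow> complex" where
    "low z = (\<Prod>j\<in>{1..<i0}. (1 + of_real \<phi> * z ^ j) ^ mult j)" for z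
  define M0 :: "complex \<Rightarrow> complex" where "M0 z = (\<Sum>j\<in>{1..<i0}. of_nat (mult j) * z ^ j)" for z
  define Y where "Y z = low z * exp (of_real \<phi> * (H z - M0 z) + eval_fps E z)" for z
  \<comment> \<open>The limit at \<rho> of the continued generating function times (1 -
    z/\<rho>)^\<alpha>.\<close>
  define C where "C = low (of_real \<rho>) * exp (of_real \<phi> * (of_real c - M0 (of_real \<rho>)) + eval_fps E (of_real \<rho>))"
  have E_hol: "eval_fps E holomorphic_on ball 0 x"
  proof (intro holomorphic_on_eval_fps subsetI)
    fix z :: complex assume "z \<in> ball 0 x"
    then have "ereal (norm z) < ereal x" by simp
    also note E_radius
    finally show "z \<in> eball 0 (fps_conv_radius E)" by (simp add: in_eball_iff)
  qed
  have "C \<noteq> 0"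
  proof -
    have low_eq: "low (of_real \<rho>) = of_real (\<Prod>j\<in>{1..<i0}. (1 + \<phi> * \<rho> ^ j) ^ mult j)"
      by (simp add: low_def)
    have pos: "(\<Prod>j\<in>{1..<i0}. (1 + \<phi> * \<rho> ^ j) ^ mult j) > 0"
      using \<phi> \<rho> by (intro prod_pos ballI zero_less_power add_pos_nonneg) auto
    have "low (of_real \<rho>) \<noteq> 0" unfolding low_eq of_real_eq_0_iff using pos by linarith
    then show ?thesis by (simp add: C_def)
  qed
  have hol': "H holomorphic_on ?D"
    using holomorphic_on_subset[OF hol slit_disc_mono[OF R'(2)]] .
  have E_hol': "eval_fps E holomorphic_on ?D"
    by (rule holomorphic_on_subset[OF E_hol]) (use R' in \<open>auto simp: slit_disc_def\<close>)
  have low_cont: "continuous_on UNIV low" and M0_cont: "continuous_on UNIV M0"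
    unfolding low_def M0_def by (intro continuous_intros)+
  let ?l = "\<lambda>z. Ln (1 - z / of_real \<rho>)"
  let ?F = "at (of_real \<rho>) within ?D"
  let ?f = "\<lambda>z. Y z - C * exp (- of_real \<alpha> * ?l z)"
  \<comment> \<open>This is \<open>?f\<close> times (1 - z/\<rho>)^\<alpha>: the logarithm moves
    into the exponent and completes H to H + \<theta> Ln, which has a limit.\<close>
  let ?G = "\<lambda>z. low z * exp (of_real \<phi> * ((H z + of_real \<theta> * ?l z) - M0 z) + eval_fps E z) - C"
  let ?A = "gen_fps - fps_const C * Abs_fps (\<lambda>n. (- 1 / of_real \<rho>) ^ n * ((- of_real \<alpha>) gchoose n))"
  have "(\<lambda>n. norm (fps_nth ?A n) * \<rho> ^ n * real n powr (1 - \<alpha>)) \<longlonglongrightarrow> 0"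
  proof (rule fps_coeff_transfer[OF \<rho>(1) R'(1) \<kappa>])
    show "0 \<le> \<alpha>" using \<alpha> by simp
    have "low holomorphic_on ?D" "M0 holomorphic_on ?D"
      unfolding low_def M0_def by (intro holomorphic_intros)+
    then show "?f holomorphic_on ?D"
      unfolding Y_def using slit_disc_notin_nonpos_Reals \<rho> \<kappa> by (intro holomorphic_intros hol' E_hol') auto
    have "Y has_fps_expansion gen_fps"
    proof -
      let ?M0 = "\<Sum>j\<in>{1..<i0}. fps_const (of_nat (mult j)) * fps_X ^ j :: complex fps"
      have M0_fps: "M0 has_fps_expansion ?M0"
        unfolding M0_def by (intro fps_expansion_intros)
      have kinds: "irreducibles_fps mult - ?M0 = kinds_from i0"
      proof (rule fps_ext)
        fix n
        have "fps_nth ?M0 n = (\<Sum>j\<in>{1..<i0}. if n = j then of_nat (mult j) else 0)"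
          by (simp add: fps_sum_nth fps_X_power_nth if_distrib[of "\<lambda>x. _ * x"] cong: if_cong)
        also have "\<dots> = (if 1 \<le> n \<and> n < i0 then of_nat (mult n) else 0)"
          by (simp add: sum.delta)
        finally show "fps_nth (irreducibles_fps mult - ?M0) n = fps_nth (kinds_from i0) n"
          using i0(1) by (auto simp: irreducibles_fps_def kinds_from_def)
      qed
      have E_fps: "eval_fps E has_fps_expansion E"
        using E_radius x \<rho> by (intro eval_fps_has_fps_expansion) (auto intro: less_le_trans[of 0 "ereal x"])
      have "(\<lambda>z. of_real \<phi> * (H z - M0 z) + eval_fps E z) has_fps_expansion
          (fps_const (of_real \<phi>) * (irreducibles_fps mult - ?M0) + E)"
        by (intro fps_expansion_intros H M0_fps E_fps)
      then have L: "(\<lambda>z. of_real \<phi> * (H z - M0 z) + eval_fps E z) has_fps_expansion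
          (fps_const (of_real \<phi>) * kinds_from i0 + E)" unfolding kinds .
      have "fps_nth (fps_const (of_real \<phi>) * kinds_from i0 + E) 0 = 0"
        using i0 by (simp add: E_def kinds_from_def log_tail_def)
      then have "(exp \<circ> (\<lambda>z. of_real \<phi> * (H z - M0 z) + eval_fps E z)) has_fps_expansion
          (fps_exp 1 oo (fps_const (of_real \<phi>) * kinds_from i0 + E))"
        by (intro has_fps_expansion_compose has_fps_expansion_exp1 L)
      moreover have "low has_fps_expansion low_fps i0"
        unfolding low_def low_fps_def
        by (intro has_fps_expansion_prod has_fps_expansion_power fps_expansion_intros)
      ultimately have "(\<lambda>z. low z * (exp \<circ> (\<lambda>z. of_real \<phi> * (H z - M0 z) + eval_fps E z)) z) has_fps_expansion
          low_fps i0 * (fps_exp 1 oo (fps_const (of_real \<phi>) * kinds_from i0 + E))"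
        by (intro has_fps_expansion_mult)
      moreover have "gen_fps = low_fps i0 * (fps_exp 1 oo (fps_const (of_real \<phi>) * kinds_from i0 + E))"
        unfolding E_def using i0(2) by (intro gen_fps_eq i0(1)) blast
      ultimately show ?thesis by (simp add: Y_def[abs_def] o_def)
    qed
    then show "?f has_fps_expansion ?A"
      by (intro fps_expansion_intros powr_has_fps_expansion \<rho>)
    have "((\<lambda>z. low z * exp (of_real \<phi> * ((H z + of_real \<theta> * ?l z) - M0 z) + eval_fps E z) - C) \<longlongrightarrow> C - C) ?F"
      unfolding C_def
    proof (intro tendsto_intros)
      show "(low \<longlongrightarrow> low (of_real \<rho>)) ?F" "(M0 \<longlongrightarrow> M0 (of_real \<rho>)) ?F"
        using low_cont M0_cont by (auto simp: continuous_on_def intro: tendsto_within_subset)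
      show "((\<lambda>z. H z + of_real \<theta> * ?l z) \<longlongrightarrow> of_real c) ?F"
        by (rule tendsto_within_subset[OF lim slit_disc_mono[OF R'(2)]])
      have "continuous_on (ball 0 x) (eval_fps E)"
        by (rule holomorphic_on_imp_continuous_on[OF E_hol])
      moreover have "of_real \<rho> \<in> ball (0 :: complex) x" using x \<rho> by simp
      ultimately have "isCont (eval_fps E) (of_real \<rho>)"
        by (simp add: continuous_on_eq_continuous_at)
      then show "(eval_fps E \<longlongrightarrow> eval_fps E (of_real \<rho>)) ?F"
        by (auto simp: isCont_def intro: tendsto_within_subset)
    qed
    then have "((\<lambda>z. \<rho> powr \<alpha> * norm (?G z))
        \<longlongrightarrow> \<rho> powr \<alpha> * norm (C - C)) ?F"
      by (rule tendsto_mult[OF tendsto_const tendsto_norm])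
    moreover have "eventually (\<lambda>z. \<rho> powr \<alpha> * norm (?G z)
        = norm (?f z) * norm (of_real \<rho> - z) powr \<alpha>) ?F"
      unfolding eventually_at_filter
    proof (intro always_eventually allI impI)
      fix z :: complex assume z: "z \<noteq> of_real \<rho>"
      have nz: "1 - z / of_real \<rho> \<noteq> 0" using z \<rho> by (auto simp: field_simps)
      have "of_real \<rho> - z = of_real \<rho> * (1 - z / of_real \<rho>)" using \<rho> by (simp add: field_simps)
      then have "norm (of_real \<rho> - z) powr \<alpha> = \<rho> powr \<alpha> * norm (1 - z / of_real \<rho>) powr \<alpha>"
        using \<rho> by (simp add: norm_mult powr_mult)
      also have "norm (1 - z / of_real \<rho>) powr \<alpha> = norm (exp (of_real \<alpha> * ?l z))"
        using nz by (simp add: powr_def norm_exp_eq_Re)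
      finally have "norm (?f z) * norm (of_real \<rho> - z) powr \<alpha> = \<rho> powr \<alpha> * norm (?f z * exp (of_real \<alpha> * ?l z))"
        by (simp add: norm_mult mult_ac)
      also have "?f z * exp (of_real \<alpha> * ?l z) =
          ?G z"
        unfolding Y_def left_diff_distrib mult.assoc exp_add[symmetric]
        by (simp add: \<alpha>_def algebra_simps)
      finally show "\<rho> powr \<alpha> * norm (?G z)
        = norm (?f z) * norm (of_real \<rho> - z) powr \<alpha>" ..
    qed
    ultimately show "((\<lambda>z. norm (?f z) * norm (of_real \<rho> - z) powr \<alpha>) \<longlongrightarrow> 0) ?F"
      by (auto intro: Lim_transform_eventually)
  qed
  also have "(\<lambda>n. norm (fps_nth ?A n) * \<rho> ^ n * real n powr (1 - \<alpha>)) =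
      (\<lambda>n. norm (of_real (partition_fun n * \<rho> ^ n * real n powr (1 - \<alpha>)) -
         C * ((- 1) ^ n * ((- of_real \<alpha>) gchoose n) * of_real (real n powr (1 - \<alpha>)))))"
  proof
    fix n
    have "norm (fps_nth ?A n) * \<rho> ^ n * real n powr (1 - \<alpha>) =
        norm (fps_nth ?A n * of_real (\<rho> ^ n * real n powr (1 - \<alpha>)))"
      using \<rho> by (simp add: norm_mult norm_power)
    also have "fps_nth ?A n * of_real (\<rho> ^ n * real n powr (1 - \<alpha>)) =
        of_real (partition_fun n * \<rho> ^ n * real n powr (1 - \<alpha>)) -
         C * ((- 1) ^ n * ((- of_real \<alpha>) gchoose n) * of_real (real n powr (1 - \<alpha>)))"
    proof -
      define w where "w = (- 1 / complex_of_real \<rho>) ^ n"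
      have w: "(- 1) ^ n = w * of_real \<rho> ^ n"
        using \<rho> unfolding w_def power_mult_distrib[symmetric] by simp
      have nth: "fps_nth ?A n = of_real (partition_fun n) - C * (w * ((- of_real \<alpha>) gchoose n))"
        by (simp only: fps_sub_nth gen_fps_def fps_nth_Abs_fps fps_mult_left_const_nth w_def)
      show ?thesis unfolding nth w by (simp add: algebra_simps)
    qed
    finally show "norm (fps_nth ?A n) * \<rho> ^ n * real n powr (1 - \<alpha>) =
      norm (of_real (partition_fun n * \<rho> ^ n * real n powr (1 - \<alpha>)) -
         C * ((- 1) ^ n * ((- of_real \<alpha>) gchoose n) * of_real (real n powr (1 - \<alpha>))))" .
  qed
  finally have "(\<lambda>n. of_real (partition_fun n * \<rho> ^ n * real n powr (1 - \<alpha>)) -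
         C * ((- 1) ^ n * ((- of_real \<alpha>) gchoose n) * of_real (real n powr (1 - \<alpha>)))) \<longlonglongrightarrow> 0"
    by (rule tendsto_norm_zero_cancel)
  moreover have "(\<lambda>n. C * ((- 1) ^ n * ((- of_real \<alpha>) gchoose n) * of_real (real n powr (1 - \<alpha>))))
      \<longlonglongrightarrow> C * inverse (Gamma (of_real \<alpha>))"
    by (intro tendsto_intros gbinomial_powr_asymptotic)
  ultimately have conv: "(\<lambda>n. complex_of_real (partition_fun n * \<rho> ^ n * real n powr (1 - \<alpha>)))
      \<longlonglongrightarrow> C * inverse (Gamma (of_real \<alpha>))"
    using tendsto_add by fastforce
  define K where "K = C * inverse (Gamma (complex_of_real \<alpha>))"
  have "Gamma (complex_of_real \<alpha>) \<noteq> 0"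
    using \<alpha> by (simp add: Gamma_complex_of_real Gamma_real_pos less_imp_neq[symmetric])
  then have "K \<noteq> 0" using \<open>C \<noteq> 0\<close> by (simp add: K_def)
  have Re: "(\<lambda>n. partition_fun n * \<rho> ^ n * real n powr (1 - \<alpha>)) \<longlonglongrightarrow> Re K"
    using tendsto_Re[OF conv] by (simp add: K_def)
  \<comment> \<open>A limit of non-negative reals is real and non-negative; being nonzero, it is
    positive.\<close>
  have "(\<lambda>n. 0) \<longlonglongrightarrow> Im K"
    using tendsto_Im[OF conv] by (simp add: K_def)
  then have "Im K = 0" using LIMSEQ_unique tendsto_const by metis
  moreover have "Re K \<ge> 0"
    using Re \<rho> partition_fun_nonneg by (intro LIMSEQ_le_const[OF Re]) auto
  ultimately have "Re K > 0" using \<open>K \<noteq> 0\<close> by (auto simp: complex_eq_iff less_le)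
  then show ?thesis using Re unfolding \<alpha>_def by blast
qed

end

section \<open>Weak convergence of the component sizes\<close>

text \<open>The metric on functions weights the coordinates by powers of 1/2, and these add up to
  2.\<close>

lemma dist_fun_le:
  fixes x y :: "'a :: countable \<Rightarrow> 'b :: metric_space"
  assumes "\<And>i. dist (x i) (y i) \<le> \<delta>"
  shows "dist x y \<le> 2 * \<delta>"
proof -
  have "dist x y = (\<Sum>n. (1 / 2) ^ n * min (dist (x (from_nat n)) (y (from_nat n))) 1)"
    by (simp add: dist_fun_def)
  also have "\<dots> \<le> (\<Sum>n. (1 / 2) ^ n * \<delta>)"
  proof (rule suminf_le)
    show "summable (\<lambda>n. (1 / 2) ^ n * min (dist (x (from_nat n)) (y (from_nat n))) 1)"
      by (rule summable_comparison_test'[of "\<lambda>n. (1 / 2) ^ n"]) (auto simp: summable_geometric_iff)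
    show "summable (\<lambda>n. (1 / 2 :: real) ^ n * \<delta>)"
      by (intro summable_mult2) (simp add: summable_geometric_iff)
    show "(1 / 2) ^ n * min (dist (x (from_nat n)) (y (from_nat n))) 1 \<le> (1 / 2) ^ n * \<delta>" for n
      by (intro mult_left_mono) (auto intro: order_trans[OF min.cobounded1 assms])
  qed
  also have "\<dots> = 2 * \<delta>"
    using suminf_mult2[of "\<lambda>n. (1 / 2 :: real) ^ n" \<delta>, symmetric]
    by (simp add: suminf_geometric summable_geometric_iff)
  finally show ?thesis .
qed

text \<open>h is the inf-convolution of f with m times the distance, hence Lipschitz on the whole
  space. On S, a far point y in the infimum costs at least m \<delta> = 2 B, the largest possible
  gain; near points are handled by uniform continuity.\<close>

lemma lipschitz_approximation:
  fixes f :: "'a :: metric_space \<Rightarrow> real"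
  assumes S: "compact S" "S \<noteq> {}" and f: "continuous_on S f" and \<epsilon>: "\<epsilon> > 0"
  obtains m h where "m \<ge> 0" "\<And>x y. \<bar>h x - h y\<bar> \<le> m * dist x y" "\<And>x. x \<in> S \<Longrightarrow> \<bar>h x - f x\<bar> \<le> \<epsilon>"
proof -
  have "bounded (f ` S)" using compact_imp_bounded[OF compact_continuous_image[OF f S(1)]] .
  then obtain B where B: "\<And>x. x \<in> S \<Longrightarrow> \<bar>f x\<bar> \<le> B" by (auto simp: bounded_iff)
  have "uniformly_continuous_on S f" using compact_uniformly_continuous f S by blast
  then obtain \<delta> where \<delta>: "\<delta> > 0" "\<And>x y. x \<in> S \<Longrightarrow> y \<in> S \<Longrightarrow> dist y x < \<delta> \<Longrightarrow> dist (f y) (f x) < \<epsilon>"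
    using \<epsilon> unfolding uniformly_continuous_on_def by metis
  have B0: "0 \<le> B" using S B by (meson abs_ge_zero all_not_in_conv order_trans)
  define m where "m = 2 * B / \<delta>"
  have m: "m \<ge> 0" using B0 \<delta> by (simp add: m_def)
  define h where "h x = (INF y\<in>S. f y + m * dist x y)" for x
  have bdd: "bdd_below ((\<lambda>y. f y + m * dist x y) ` S)" for x
  proof (rule bdd_belowI2)
    fix y assume "y \<in> S"
    then show "- B \<le> f y + m * dist x y" using B[of y] m by (simp add: add_increasing2 abs_le_iff)
  qed
  have h_le: "h x \<le> h x' + m * dist x x'" for x x'
  proof -
    have "h x - m * dist x x' \<le> f y + m * dist x' y" if "y \<in> S" for y
    proof -
      have "h x \<le> f y + m * dist x y" unfolding h_def by (rule cINF_lower[OF bdd that])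
      also have "\<dots> \<le> f y + m * (dist x x' + dist x' y)"
        using m by (intro add_left_mono mult_left_mono dist_triangle) auto
      finally show ?thesis by (simp add: algebra_simps)
    qed
    then have "h x - m * dist x x' \<le> h x'" unfolding h_def[of x'] by (intro cINF_greatest S)
    then show ?thesis by simp
  qed
  show ?thesis
  proof (rule that[OF m])
    show "\<bar>h x - h y\<bar> \<le> m * dist x y" for x y
      using h_le[of x y] h_le[of y x] by (simp add: abs_le_iff dist_commute)
    fix x assume x: "x \<in> S"
    have "h x \<le> f x + m * dist x x" unfolding h_def by (rule cINF_lower[OF bdd x])
    moreover have "f x - \<epsilon> \<le> h x" unfolding h_def
    proof (rule cINF_greatest[OF S(2)])
      fix y assume y: "y \<in> S"
      show "f x - \<epsilon> \<le> f y + m * dist x y"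
      proof (cases "dist x y < \<delta>")
        case True
        then have "\<bar>f x - f y\<bar> < \<epsilon>" using \<delta>(2)[OF y x] by (simp add: dist_real_def)
        moreover have "0 \<le> m * dist x y" using m by simp
        ultimately show ?thesis by linarith
      next
        case False
        then have "m * \<delta> \<le> m * dist x y" using m by (intro mult_left_mono) auto
        moreover have "m * \<delta> = 2 * B" using \<delta> by (simp add: m_def)
        ultimately show ?thesis using B[OF x] B[OF y] \<epsilon> by linarith
      qed
    qed
    ultimately show "\<bar>h x - f x\<bar> \<le> \<epsilon>" using \<epsilon> by simp
  qed
qed

lemma compact_unit_cube: "compact {x :: nat \<Rightarrow> real. \<forall>i. 0 \<le> x i \<and> x i \<le> 1}"
proof -
  have "compactin (product_topology (\<lambda>_ :: nat. euclidean) UNIV) (PiE UNIV (\<lambda>_. {0..1 :: real}))"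
    by (subst compactin_PiE) auto
  moreover have "PiE UNIV (\<lambda>_. {0..1 :: real}) = {x :: nat \<Rightarrow> real. \<forall>i. 0 \<le> x i \<and> x i \<le> 1}"
    by auto
  ultimately show ?thesis by (simp add: euclidean_product_topology)
qed

lemma order_stat_measurable_borel: "order_stat \<in> PiM UNIV (\<lambda>_. borel) \<rightarrow>\<^sub>M borel"
  by (rule measurable_coordinatewise_then_product) (rule order_stat_measurable)

text \<open>\<open>order_stat\<close> is 1-Lipschitz for the supremum distance, and passing to the
  metric of the sequence space gives the factor 2. Symmetry is inherited from
  \<open>order_stat\<close>.\<close>

lemma sym_lipschitz_order_stat:
  assumes m: "m \<ge> 0" and h: "\<And>x y. \<bar>h x - h y\<bar> \<le> m * dist x y"
    and B: "\<And>x. (\<And>i. 0 \<le> x i \<and> x i \<le> 1) \<Longrightarrow> \<bar>h x\<bar> \<le> B"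
  shows "sym_lipschitz B (2 * m) (\<lambda>g. h (order_stat g))"
  unfolding sym_lipschitz_def
proof (intro conjI allI impI)
  have "continuous_on UNIV h"
  proof (rule continuous_onI)
    fix x and e :: real assume e: "e > 0"
    show "\<exists>d>0. \<forall>x'\<in>UNIV. dist x' x < d \<longrightarrow> dist (h x') (h x) \<le> e"
    proof (intro exI conjI ballI impI)
      show "e / (m + 1) > 0" using e m by simp
      fix x' assume "dist x' x < e / (m + 1)"
      then have "(m + 1) * dist x' x \<le> e" using m by (simp add: field_simps)
      moreover have "m * dist x' x \<le> (m + 1) * dist x' x" by (intro mult_right_mono) auto
      ultimately show "dist (h x') (h x) \<le> e" using h[of x' x] by (simp add: dist_real_def)
    qed
  qed
  then have "h \<in> borel_measurable borel" by (rule borel_measurable_continuous_onI)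
  then show "(\<lambda>g. h (order_stat g)) \<in> borel_measurable (PiM UNIV (\<lambda>_. borel))"
    using measurable_compose[OF order_stat_measurable_borel] by blast
  show "\<bar>h (order_stat g)\<bar> \<le> B" for g
    using order_stat_bounds by (intro B) auto
  show "\<bar>h (order_stat g) - h (order_stat g')\<bar> \<le> 2 * m * \<delta>" if "\<forall>i. \<bar>g i - g' i\<bar> \<le> \<delta>" for g g' \<delta>
  proof -
    have "dist (order_stat g) (order_stat g') \<le> 2 * \<delta>"
      using that by (intro dist_fun_le) (simp add: dist_real_def order_stat_lipschitz)
    then have "m * dist (order_stat g) (order_stat g') \<le> m * (2 * \<delta>)" using m by (intro mult_left_mono)
    then show ?thesis using h[of "order_stat g" "order_stat g'"] by simp
  qed
  show "h (order_stat (g \<circ> p)) = h (order_stat g)" if "bij p" for g p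
    by (simp add: order_stat_comp_bij[OF that])
qed

lemma continuous_on_restrict:
  assumes "continuous_map (R_top k) euclideanreal f"
  shows "continuous_on UNIV (\<lambda>x. f (restrict x {..<k}))"
proof -
  have "continuous_map euclidean (R_top k) (\<lambda>x :: nat \<Rightarrow> real. restrict x {..<k})"
    unfolding continuous_map_componentwise
    by (auto simp: continuous_on_product_coordinates)
  from continuous_map_compose[OF this assms] show ?thesis by (simp add: o_def)
qed

text \<open>Extensional functions are padded by 0 to full sequences, where continuity implies Borel
  measurability, and are recovered by restriction.\<close>

lemma borel_measurable_R_top:
  assumes "continuous_map (R_top k) euclideanreal f"
  shows "f \<in> borel_measurable (R_borel k)"
proof -
  define pad where "pad x = (\<lambda>i. if i < k then x i else 0)" for x :: "nat \<Rightarrow> real"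
  have "pad \<in> R_borel k \<rightarrow>\<^sub>M borel"
  proof (rule measurable_coordinatewise_then_product)
    fix i show "(\<lambda>x. pad x i) \<in> borel_measurable (R_borel k)"
      by (cases "i < k") (auto simp: pad_def)
  qed
  from measurable_compose[OF this borel_measurable_continuous_onI[OF continuous_on_restrict[OF assms]]]
  have "(\<lambda>x. f (restrict (pad x) {..<k})) \<in> borel_measurable (R_borel k)" .
  moreover have "f (restrict (pad x) {..<k}) = f x" if "x \<in> space (R_borel k)" for x
  proof -
    have "restrict (pad x) {..<k} = x"
      using that by (auto simp: pad_def space_PiM fun_eq_iff PiE_def extensional_def)
    then show ?thesis by simp
  qed
  ultimately show ?thesis by (simp cong: measurable_cong)
qed

lemma restrict_measurable_R_borel: "(\<lambda>x. restrict x {..<k}) \<in> PiM UNIV (\<lambda>_. borel) \<rightarrow>\<^sub>M R_borel k"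
  by (rule measurable_restrict_subset) simp

text \<open>Almost surely \<open>sort_decreasing\<close> may be replaced by
  \<open>order_stat\<close>, which is Lipschitz everywhere and so fits the recursion.\<close>

lemma integral_PD_first:
  assumes f: "continuous_map (R_top k) euclideanreal f" and a: "a > 0"
  shows "(\<integral>x. f x \<partial>PD_first k a) = gem_expectation a (\<lambda>g. f (restrict (order_stat g) {..<k})) 1"
proof -
  note f_meas = borel_measurable_R_top[OF f]
  have stick: "(\<lambda>u. sort_decreasing (stick_breaking (\<lambda>i. u i powr (1 / a)))) = (\<lambda>u. sort_decreasing (gem a 1 u))"
    by (simp add: gem_def)
  have sort_meas: "(\<lambda>u. sort_decreasing (gem a 1 u)) \<in> unif_seq \<rightarrow>\<^sub>M PiM UNIV (\<lambda>_. borel)"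
    by (rule measurable_compose[OF gem_measurable' sort_decreasing_measurable])
  have fr_meas: "(\<lambda>x. f (restrict x {..<k})) \<in> borel_measurable (PiM UNIV (\<lambda>_. borel))"
    by (rule measurable_compose[OF restrict_measurable_R_borel f_meas])
  have "(\<integral>x. f x \<partial>PD_first k a) = (\<integral>x. f (restrict x {..<k}) \<partial>PD a)"
    unfolding PD_first_def
    by (intro integral_distr f_meas) (simp add: PD_def restrict_measurable_R_borel)
  also have "\<dots> = (\<integral>u. f (restrict (sort_decreasing (gem a 1 u)) {..<k}) \<partial>unif_seq)"
    unfolding PD_def stick by (intro integral_distr sort_meas fr_meas)
  also have "\<dots> = (\<integral>u. f (restrict (order_stat (gem a 1 u)) {..<k}) \<partial>unif_seq)"
  proof (rule integral_cong_AE)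
    show "(\<lambda>u. f (restrict (sort_decreasing (gem a 1 u)) {..<k})) \<in> borel_measurable unif_seq"
      by (rule measurable_compose[OF sort_meas fr_meas])
    have "order_stat \<in> PiM UNIV (\<lambda>_. borel) \<rightarrow>\<^sub>M PiM UNIV (\<lambda>_. borel)"
      by (rule measurable_PiM_single') auto
    then show "(\<lambda>u. f (restrict (order_stat (gem a 1 u)) {..<k})) \<in> borel_measurable unif_seq"
      by (intro measurable_compose[OF _ fr_meas] measurable_compose[OF gem_measurable'])
    show "AE u in unif_seq. f (restrict (sort_decreasing (gem a 1 u)) {..<k}) =
        f (restrict (order_stat (gem a 1 u)) {..<k})"
      using AE_order_stat_eq_sort_decreasing[OF a] by eventually_elim (simp add: gem_def)
  qed
  finally show ?thesis by (simp add: gem_expectation_def)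
qed

text \<open>Also true for empty \<open>Obj\<close>: the measure is null and the right side is 0 / 0
  = 0.\<close>

lemma integral_distr_tilted:
  assumes "finite Obj" and \<phi>: "\<phi> > 0" and f: "f \<in> borel_measurable N"
    and T: "\<And>A. A \<in> Obj \<Longrightarrow> T A \<in> space N"
  shows "(\<integral>x. f x \<partial>distr (tilted Obj K \<phi>) N T) = (\<Sum>A\<in>Obj. \<phi> ^ K A * f (T A)) / (\<Sum>A\<in>Obj. \<phi> ^ K A)"
proof -
  have "(\<integral>x. f x \<partial>distr (tilted Obj K \<phi>) N T) = (\<integral>A. f (T A) \<partial>tilted Obj K \<phi>)"
    unfolding tilted_def using T by (intro integral_distr f) (auto simp: measurable_point_measure_eq1)
  also have "\<dots> = (\<Sum>A\<in>Obj. (\<phi> ^ K A / (\<Sum>B\<in>Obj. \<phi> ^ K B)) * f (T A))"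
    unfolding tilted_def using assms(1) \<phi>
    by (subst lebesgue_integral_point_measure_finite) (auto intro!: divide_nonneg_nonneg sum_nonneg)
  finally show ?thesis by (simp add: sum_divide_distrib)
qed

lemma scaled_sizes_eq: "scaled_sizes k n S = restrict (\<lambda>i. size_seq S i / real n) {..<k}"
  by (simp add: scaled_sizes_def size_seq_def)

lemma scaled_sizes_in_space: "scaled_sizes k n S \<in> space (R_borel k)"
  by (simp add: scaled_sizes_def space_PiM)

context irreducibles
begin

lemma size_seq_object_bounds:
  assumes "A \<in> objects r" shows "0 \<le> size_seq (image_mset wt A) i" "size_seq (image_mset wt A) i \<le> real r"
  using size_seq_bounds[of "image_mset wt A" i] assms
  by (auto simp: objects_def multisets_of_weight_def simp del: of_nat_sum_mset)

text \<open>Multiplying by \<rho>^r turns the exponential growth of \<open>partition_fun\<close>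
  into a power of n, as the abstract recursion requires. Dividing sizes by n turns L into L / n, the
  scaling in its limit theorem.\<close>

theorem object_expectation_tendsto:
  assumes fs: "flajolet_soria (irreducibles_fps mult) \<rho> \<theta> c" and \<rho>1: "\<rho> < 1"
    and \<phi>\<rho>: "\<not> distinct_parts \<Longrightarrow> \<phi> < 1 / \<rho>" and F: "sym_lipschitz B L F"
  shows "(\<lambda>n. weighted_sum (\<lambda>A. F (\<lambda>i. size_seq (image_mset wt A) i / real n)) n / partition_fun n)
     \<longlonglongrightarrow> gem_expectation (\<phi> * \<theta>) F 1"
proof -
  have \<rho>: "\<rho> > 0" and \<theta>: "\<theta> > 0" using fs by (auto simp: flajolet_soria_def)
  obtain K where K: "K > 0"
    "(\<lambda>n. partition_fun n * \<rho> ^ n * real n powr (1 - \<phi> * \<theta>)) \<longlonglongrightarrow> K"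
    using partition_fun_asymptotics[OF fs \<rho>1 \<phi>\<rho>] by blast
  define b where "b j = \<phi> * (real j * real (mult j) * \<rho> ^ j)" for j
  define q where "q n = partition_fun n * \<rho> ^ n" for n
  define WS where "WS F r = weighted_sum (\<lambda>A. F (size_seq (image_mset wt A))) r" for F r
  define W where "W F r = WS F r * \<rho> ^ r" for F r
  define \<Psi> where "\<Psi> F r = gem_expectation (\<phi> * \<theta>) F (real r)" for F r
  define shift where "shift j F = (\<lambda>g. F (case_nat (real j) g))" for j :: nat and F :: "(nat \<Rightarrow> real) \<Rightarrow> real"
  have a: "\<phi> * \<theta> > 0" using \<phi> \<theta> by simp
  have q0: "0 \<le> q n" for n using partition_fun_nonneg \<rho> by (simp add: q_def)
  have b: "b \<longlonglongrightarrow> \<phi> * \<theta>"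
  proof -
    have "(\<lambda>n. Re (of_nat n * fps_nth (irreducibles_fps mult) n * of_real \<rho> ^ n)) \<longlonglongrightarrow> Re (of_real \<theta>)"
      by (intro tendsto_Re flajolet_soria_coeffs[OF fs])
    also have "(\<lambda>n. Re (of_nat n * fps_nth (irreducibles_fps mult) n * of_real \<rho> ^ n)) =
        (\<lambda>n. real n * real (mult n) * \<rho> ^ n)"
    proof
      fix n
      have "of_nat n * fps_nth (irreducibles_fps mult) n * of_real \<rho> ^ n = complex_of_real (real n * real (mult n) * \<rho> ^ n)"
        by (simp add: irreducibles_fps_def)
      then show "Re (of_nat n * fps_nth (irreducibles_fps mult) n * of_real \<rho> ^ n) = real n * real (mult n) * \<rho> ^ n"
        by (simp only: Re_complex_of_real)
    qed
    finally show ?thesis unfolding b_def by (intro tendsto_intros) simp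
  qed
  interpret S: size_biased_recursion b q W \<Psi> shift sym_lipschitz "\<phi> * \<theta>" K
  proof
    show "0 < \<phi> * \<theta>" "b \<longlonglongrightarrow> \<phi> * \<theta>" "0 < K" by fact+
    show "0 \<le> b j" for j using \<phi> \<rho> by (simp add: b_def)
    show "0 \<le> q n" for n by (rule q0)
    show "(\<lambda>n. q n * real n powr (1 - \<phi> * \<theta>)) \<longlonglongrightarrow> K" using K by (simp add: q_def)
  next
    fix B L :: real and F :: "(nat \<Rightarrow> real) \<Rightarrow> real"
    assume F: "sym_lipschitz B L F"
    note B0 = sym_lipschitz_nonneg(1)[OF F] and L0 = sym_lipschitz_nonneg(2)[OF F]
    show "0 \<le> B" "0 \<le> L" by fact+
    show "sym_lipschitz B L (shift j F)" for j unfolding shift_def by (rule sym_lipschitz_case_nat[OF F])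
    fix r :: nat
    have "\<bar>WS F r\<bar> \<le> weighted_sum (\<lambda>_. B * 1) r"
      unfolding WS_def by (intro weighted_sum_abs_le) (simp add: sym_lipschitzD(2)[OF F])
    then have "\<bar>WS F r\<bar> \<le> B * partition_fun r" unfolding weighted_sum_cmult .
    then show "\<bar>W F r\<bar> \<le> B * q r"
      using \<rho> by (simp add: W_def q_def abs_mult mult_right_mono mult.assoc[symmetric])
    show "\<bar>\<Psi> F r\<bar> \<le> B" unfolding \<Psi>_def by (rule gem_expectation_bound[OF F])
    \<comment> \<open>Component sizes and sticks are at most r, so both averages lie within L r of
      the value of F at the zero sequence.\<close>
    show "\<bar>W F r - q r * \<Psi> F r\<bar> \<le> q r * (2 * L * real r)"
    proof -
      let ?F0 = "F (\<lambda>_. 0)"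
      have "WS F r - partition_fun r * ?F0 = weighted_sum (\<lambda>A. F (size_seq (image_mset wt A)) - ?F0) r"
        by (simp add: WS_def weighted_sum_def sum_subtractf sum_distrib_right right_diff_distrib)
      also have "\<bar>\<dots>\<bar> \<le> weighted_sum (\<lambda>_. (L * real r) * 1) r"
        using size_seq_object_bounds by (intro weighted_sum_abs_le) (simp add: sym_lipschitzD(3)[OF F])
      finally have "\<bar>WS F r - partition_fun r * ?F0\<bar> * \<rho> ^ r \<le> L * real r * partition_fun r * \<rho> ^ r"
        unfolding weighted_sum_cmult using \<rho> by (intro mult_right_mono) auto
      moreover have "\<bar>W F r - q r * ?F0\<bar> = \<bar>WS F r - partition_fun r * ?F0\<bar> * \<rho> ^ r"
      proof -
        have "W F r - q r * ?F0 = (WS F r - partition_fun r * ?F0) * \<rho> ^ r"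
          by (simp add: W_def q_def algebra_simps)
        then show ?thesis using \<rho> by (simp add: abs_mult)
      qed
      ultimately have 1: "\<bar>W F r - q r * ?F0\<bar> \<le> q r * (L * real r)"
        by (simp add: q_def mult_ac)
      have "\<bar>q r * \<Psi> F r - q r * ?F0\<bar> = q r * \<bar>\<Psi> F r - ?F0\<bar>"
        using q0[of r] by (simp add: abs_mult right_diff_distrib[symmetric])
      also have "\<dots> \<le> q r * (L * real r)"
        unfolding \<Psi>_def using q0 by (intro mult_left_mono gem_expectation_near_0[OF F a]) auto
      finally show ?thesis using 1 by simp
    qed
    show "\<bar>real r * W F r - (\<Sum>i<r. b (r - i) * W (shift (r - i) F) i)\<bar> \<le>
        B * \<bar>real r * q r - (\<Sum>i<r. b (r - i) * q i)\<bar>"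
    proof -
      let ?S = "\<lambda>w. \<Sum>j\<in>{1..r}. real (mult j) * (\<phi> * real j * w j (r - j))"
      \<comment> \<open>Substitutes i = r - j and splits \<rho>^r into \<rho>^j, which goes into b,
        and \<rho>^(r - j).\<close>
      have sum_eq: "(\<Sum>i<r. b (r - i) * (w (r - i) i * \<rho> ^ i)) =
          ?S w * \<rho> ^ r" for w :: "nat \<Rightarrow> nat \<Rightarrow> real"
      proof -
        have "(\<Sum>i<r. b (r - i) * (w (r - i) i * \<rho> ^ i)) = (\<Sum>j\<in>{1..r}. b j * (w j (r - j) * \<rho> ^ (r - j)))"
          by (intro sum.reindex_bij_witness[of _ "\<lambda>j. r - j" "\<lambda>i. r - i"]) auto
        also have "\<dots> = (\<Sum>j\<in>{1..r}. real (mult j) * (\<phi> * real j * w j (r - j)) * \<rho> ^ r)"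
        proof (intro sum.cong refl)
          fix j assume "j \<in> {1..r}"
          then have "\<rho> ^ r = \<rho> ^ j * \<rho> ^ (r - j)" by (simp add: power_add[symmetric])
          then show "b j * (w j (r - j) * \<rho> ^ (r - j)) = real (mult j) * (\<phi> * real j * w j (r - j)) * \<rho> ^ r"
            by (simp add: b_def mult_ac)
        qed
        finally show ?thesis by (simp add: sum_distrib_right)
      qed
      have "real r * W F r - (\<Sum>i<r. b (r - i) * W (shift (r - i) F) i) =
          (real r * WS F r - ?S (\<lambda>j. WS (shift j F))) * \<rho> ^ r"
        unfolding W_def using sum_eq[of "\<lambda>j. WS (shift j F)"] by (simp add: left_diff_distrib)
      then have "\<bar>real r * W F r - (\<Sum>i<r. b (r - i) * W (shift (r - i) F) i)\<bar> =
          \<bar>real r * WS F r - ?S (\<lambda>j. WS (shift j F))\<bar> * \<rho> ^ r"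
        using \<rho> by (simp add: abs_mult)
      also have "\<dots> \<le> B * \<bar>real r * partition_fun r - ?S (\<lambda>_. partition_fun)\<bar> * \<rho> ^ r"
      proof (rule mult_right_mono)
        show "\<bar>real r * WS F r - ?S (\<lambda>j. WS (shift j F))\<bar> \<le>
          B * \<bar>real r * partition_fun r - ?S (\<lambda>_. partition_fun)\<bar>"
          unfolding WS_def
          by (rule weighted_sum_size_bias)
             (simp_all add: sym_lipschitzD(2)[OF F] shift_def sym_lipschitz_size_seq_add_mset[OF F])
      qed (use \<rho> in simp)
      also have "\<dots> = B * (\<bar>real r * partition_fun r - ?S (\<lambda>_. partition_fun)\<bar> * \<rho> ^ r)"
        by simp
      also have "\<bar>real r * partition_fun r - ?S (\<lambda>_. partition_fun)\<bar> * \<rho> ^ r =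
          \<bar>(real r * partition_fun r - ?S (\<lambda>_. partition_fun)) * \<rho> ^ r\<bar>"
        using \<rho> by (simp add: abs_mult)
      also have "(real r * partition_fun r - ?S (\<lambda>_. partition_fun)) * \<rho> ^ r =
          real r * q r - (\<Sum>i<r. b (r - i) * q i)"
        unfolding q_def using sum_eq[of "\<lambda>_. partition_fun"] by (simp add: left_diff_distrib)
      finally show ?thesis .
    qed
    assume r: "r > 0"
    show "\<bar>\<Psi> F r - (\<Sum>i<r. stick_weight (\<phi> * \<theta>) r i * \<Psi> (shift (r - i) F) i)\<bar> \<le> 2 * L"
      using gem_expectation_rec[OF F a r] L0 by (simp add: \<Psi>_def shift_def)
  qed
  define Fn where "Fn n g = F (\<lambda>i. g i / real n)" for n :: nat and g
  have "sym_lipschitz B (L / real n) (Fn n)" if n: "n > 0" for n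
    unfolding sym_lipschitz_def
  proof (intro conjI allI impI)
    have comp: "(\<lambda>x :: nat \<Rightarrow> real. x i) \<in> borel_measurable (PiM UNIV (\<lambda>_. borel))" for i
      by (rule measurable_component_singleton) simp
    have "(\<lambda>g i. g i / real n) \<in> PiM UNIV (\<lambda>_. borel) \<rightarrow>\<^sub>M PiM UNIV (\<lambda>_. borel)"
      using comp by (intro measurable_PiM_single') auto
    then show "Fn n \<in> borel_measurable (PiM UNIV (\<lambda>_. borel))"
      unfolding Fn_def by (rule measurable_compose[OF _ sym_lipschitzD(1)[OF F]])
    show "\<bar>Fn n g\<bar> \<le> B" for g unfolding Fn_def by (rule sym_lipschitzD(2)[OF F])
    show "\<bar>Fn n g - Fn n g'\<bar> \<le> L / real n * \<delta>" if "\<forall>i. \<bar>g i - g' i\<bar> \<le> \<delta>" for g g' \<delta>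
    proof -
      have "\<bar>g i / real n - g' i / real n\<bar> \<le> \<delta> / real n" for i
        using that n by (simp add: diff_divide_distrib[symmetric] abs_divide divide_right_mono)
      from sym_lipschitzD(3)[OF F this] show ?thesis by (simp add: Fn_def)
    qed
    show "Fn n (g \<circ> p) = Fn n g" if "bij p" for g p
      using sym_lipschitzD(4)[OF F that, of "\<lambda>i. g i / real n"] by (simp add: Fn_def o_def)
  qed
  from S.limit[OF this] have "(\<lambda>n. W (Fn n) n / q n - \<Psi> (Fn n) n) \<longlonglongrightarrow> 0" by blast
  moreover have "W (Fn n) n / q n = weighted_sum (\<lambda>A. F (\<lambda>i. size_seq (image_mset wt A) i / real n)) n / partition_fun n" for n
    using \<rho> by (simp add: W_def q_def WS_def Fn_def)
  moreover have "eventually (\<lambda>n. \<Psi> (Fn n) n = gem_expectation (\<phi> * \<theta>) F 1) sequentially"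
    using eventually_gt_at_top[of 0]
  proof eventually_elim
    case (elim n)
    \<comment> \<open>A stick-breaking of length n, divided by n, is one of length 1.\<close>
    then show ?case by (simp add: \<Psi>_def gem_expectation_def Fn_def gem_def)
  qed
  ultimately have "(\<lambda>n. weighted_sum (\<lambda>A. F (\<lambda>i. size_seq (image_mset wt A) i / real n)) n / partition_fun n
      - gem_expectation (\<phi> * \<theta>) F 1) \<longlonglongrightarrow> 0"
    by (auto elim: Lim_transform_eventually eventually_mono)
  then show ?thesis by (rule LIM_zero_cancel)
qed

text \<open>On the unit cube, where all order statistics live, f is within e/4 of a Lipschitz
  function h. The error for the limit law, the error for the objects and the convergence for h
  contribute e/4 each.\<close>

theorem object_sizes_tendsto_PD:
  assumes fs: "flajolet_soria (irreducibles_fps mult) \<rho> \<theta> c" and \<rho>1: "\<rho> < 1"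
    and \<phi>\<rho>: "\<not> distinct_parts \<Longrightarrow> \<phi> < 1 / \<rho>"
    and f: "continuous_map (R_top k) euclideanreal f"
  shows "(\<lambda>n. weighted_sum (\<lambda>A. f (scaled_sizes k n (image_mset wt A))) n / partition_fun n)
     \<longlonglongrightarrow> (\<integral>x. f x \<partial>PD_first k (\<phi> * \<theta>))"
proof (rule LIMSEQ_I)
  let ?f = "\<lambda>n. weighted_sum (\<lambda>A. f (scaled_sizes k n (image_mset wt A))) n"
  fix e :: real assume e: "e > 0"
  have \<rho>: "\<rho> > 0" and \<theta>: "\<theta> > 0" using fs by (auto simp: flajolet_soria_def)
  have a: "\<phi> * \<theta> > 0" using \<phi> \<theta> by simp
  define f' where "f' x = f (restrict x {..<k})" for x
  let ?S = "{x :: nat \<Rightarrow> real. \<forall>i. 0 \<le> x i \<and> x i \<le> 1}"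
  have cont: "continuous_on UNIV f'" unfolding f'_def by (rule continuous_on_restrict[OF f])
  have cont_S: "continuous_on ?S f'" by (rule continuous_on_subset[OF cont]) simp
  have "?S \<noteq> {}" by (auto intro!: exI[of _ "\<lambda>_. 0"])
  have "e / 4 > 0" using e by simp
  from lipschitz_approximation[OF compact_unit_cube \<open>?S \<noteq> {}\<close> cont_S this]
  obtain m h where m: "m \<ge> 0" and h_lip: "\<And>x y. \<bar>h x - h y\<bar> \<le> m * dist x y"
    and h: "\<And>x. x \<in> ?S \<Longrightarrow> \<bar>h x - f' x\<bar> \<le> e / 4" by blast
  have "bounded (f' ` ?S)" using compact_imp_bounded[OF compact_continuous_image[OF cont_S compact_unit_cube]] .
  then obtain B where B: "\<And>x. x \<in> ?S \<Longrightarrow> \<bar>f' x\<bar> \<le> B" by (auto simp: bounded_iff)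
  define F where "F g = h (order_stat g)" for g
  define F' where "F' g = f' (order_stat g)" for g
  let ?F = "\<lambda>n. weighted_sum (\<lambda>A. F (\<lambda>i. size_seq (image_mset wt A) i / real n)) n"
  have order_stat_S: "order_stat g \<in> ?S" for g using order_stat_bounds by simp
  have F: "sym_lipschitz (B + e / 4) (2 * m) F"
    unfolding F_def
  proof (rule sym_lipschitz_order_stat[OF m h_lip])
    fix x :: "nat \<Rightarrow> real" assume "\<And>i. 0 \<le> x i \<and> x i \<le> 1"
    then have "x \<in> ?S" by simp
    from h[OF this] B[OF this] show "\<bar>h x\<bar> \<le> B + e / 4" by linarith
  qed
  have close: "\<bar>F g - F' g\<bar> \<le> e / 4" for g unfolding F_def F'_def by (rule h[OF order_stat_S])
  have "(\<integral>x. f x \<partial>PD_first k (\<phi> * \<theta>)) = gem_expectation (\<phi> * \<theta>) F' 1"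
    unfolding integral_PD_first[OF f a] F'_def f'_def ..
  moreover have "\<bar>gem_expectation (\<phi> * \<theta>) F 1 - gem_expectation (\<phi> * \<theta>) F' 1\<bar> \<le> e / 4"
  proof -
    have "F' \<in> borel_measurable (PiM UNIV (\<lambda>_. borel))"
      unfolding F'_def by (rule measurable_compose[OF order_stat_measurable_borel borel_measurable_continuous_onI[OF cont]])
    from measurable_compose[OF gem_measurable' this]
    have int': "integrable unif_seq (\<lambda>u. F' (gem (\<phi> * \<theta>) 1 u))"
      using B[OF order_stat_S] by (intro unif_seq.P.integrable_const_bound[where B = B]) (simp_all add: F'_def)
    note int = gem_integrable[OF F, of "\<phi> * \<theta>" 1]
    let ?d = "\<lambda>u. F (gem (\<phi> * \<theta>) 1 u) - F' (gem (\<phi> * \<theta>) 1 u)"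
    have diff: "gem_expectation (\<phi> * \<theta>) F 1 - gem_expectation (\<phi> * \<theta>) F' 1 = (\<integral>u. ?d u \<partial>unif_seq)"
      unfolding gem_expectation_def using int int' by simp
    have "\<bar>\<integral>u. ?d u \<partial>unif_seq\<bar> \<le> (\<integral>u. \<bar>?d u\<bar> \<partial>unif_seq)"
      by (rule integral_abs_bound)
    moreover have "(\<integral>u. \<bar>?d u\<bar> \<partial>unif_seq) \<le> (\<integral>u. e / 4 \<partial>unif_seq)"
      using int int' close by (intro integral_mono) auto
    moreover have "(\<integral>u. e / 4 \<partial>unif_seq) = e / 4" using unif_seq.P.prob_space by simp
    ultimately show ?thesis unfolding diff by linarith
  qed
  ultimately have PD: "\<bar>gem_expectation (\<phi> * \<theta>) F 1 - (\<integral>x. f x \<partial>PD_first k (\<phi> * \<theta>))\<bar> \<le> e / 4" by simp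
  have objs: "\<bar>?f n / partition_fun n -
      ?F n / partition_fun n\<bar> \<le> e / 4"
    if n: "n > 0" for n
  proof -
    have le: "\<bar>f (scaled_sizes k n (image_mset wt A)) - F (\<lambda>i. size_seq (image_mset wt A) i / real n)\<bar> \<le> (e / 4) * 1"
      if A: "A \<in> objects n" for A
    proof -
      let ?g = "\<lambda>i. size_seq (image_mset wt A) i / real n"
      have "decseq ?g" using decseq_size_seq n by (auto simp: decseq_def divide_right_mono)
      moreover have "0 \<le> ?g i" "?g i \<le> 1" for i
        using size_seq_object_bounds[OF A, of i] n by auto
      \<comment> \<open>The scaled sizes are non-increasing and lie in [0, 1], so neither sorting
        nor clipping changes them.\<close>
      ultimately have "order_stat ?g = ?g" by (auto simp: order_stat_decseq clip01_id)
      then have "f (scaled_sizes k n (image_mset wt A)) = F' ?g"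
        by (simp add: F'_def f'_def scaled_sizes_eq)
      then show ?thesis using close[of ?g] by (simp add: abs_minus_commute)
    qed
    have "?f n -
        ?F n =
        weighted_sum (\<lambda>A. f (scaled_sizes k n (image_mset wt A)) - F (\<lambda>i. size_seq (image_mset wt A) i / real n)) n"
      by (simp add: weighted_sum_def sum_subtractf right_diff_distrib)
    also have "\<bar>\<dots>\<bar> \<le> weighted_sum (\<lambda>_. (e / 4) * 1) n"
      by (rule weighted_sum_abs_le[OF le])
    also have "\<dots> = (e / 4) * partition_fun n" by (rule weighted_sum_cmult)
    finally show ?thesis
      using partition_fun_nonneg[of n] e
      by (cases "partition_fun n = 0")
         (simp_all add: diff_divide_distrib[symmetric] abs_divide divide_le_eq)
  qed
  from LIMSEQ_D[OF object_expectation_tendsto[OF fs \<rho>1 \<phi>\<rho> F], of "e / 4"] e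
  obtain N where N: "\<And>n. n \<ge> N \<Longrightarrow> \<bar>?F n / partition_fun n
      - gem_expectation (\<phi> * \<theta>) F 1\<bar> < e / 4" by auto
  show "\<exists>no. \<forall>n\<ge>no. norm (?f n / partition_fun n -
      (\<integral>x. f x \<partial>PD_first k (\<phi> * \<theta>))) < e"
  proof (intro exI allI impI)
    fix n assume n: "n \<ge> max N 1"
    then show "norm (?f n / partition_fun n -
      (\<integral>x. f x \<partial>PD_first k (\<phi> * \<theta>))) < e"
      using N[of n] objs[of n] PD e unfolding real_norm_def by linarith
  qed
qed

lemma bij_betw_mset_set_objects:
  assumes distinct_parts
  shows "bij_betw mset_set (selections_of_weight U wt r) (objects r)"
proof (rule bij_betwI[where g = set_mset])
  show "mset_set \<in> selections_of_weight U wt r \<rightarrow> objects r"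
    by (auto simp: selections_of_weight_def objects_def multisets_of_weight_def sum_unfold_sum_mset count_mset_set')
  have eq: "mset_set (set_mset A) = A" if "A \<in> objects r" for A
  proof (rule multiset_eqI)
    fix u
    have "count A u \<le> 1" using that assms unfolding objects_def by blast
    then show "count (mset_set (set_mset A)) u = count A u"
      by (cases "u \<in># A") (auto simp: count_mset_set' not_in_iff[symmetric] le_Suc_eq)
  qed
  show "set_mset \<in> objects r \<rightarrow> selections_of_weight U wt r"
  proof
    fix A assume A: "A \<in> objects r"
    have "(\<Sum>u\<in>set_mset A. wt u) = (\<Sum>u\<in>#A. wt u)"
      using eq[OF A] by (simp add: sum_unfold_sum_mset)
    then show "set_mset A \<in> selections_of_weight U wt r"
      using A by (auto simp: selections_of_weight_def objects_def multisets_of_weight_def)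
  qed
  show "set_mset (mset_set S) = S" if "S \<in> selections_of_weight U wt r" for S
    using that by (simp add: selections_of_weight_def)
  show "mset_set (set_mset A) = A" if "A \<in> objects r" for A by (rule eq[OF that])
qed

lemma integral_multiset_sizes_law:
  assumes "\<not> distinct_parts" and f: "f \<in> borel_measurable (R_borel k)"
  shows "(\<integral>x. f x \<partial>multiset_sizes_law U wt \<phi> k n) =
     weighted_sum (\<lambda>A. f (scaled_sizes k n (image_mset wt A))) n / partition_fun n"
proof -
  have eq: "multisets_of_weight U wt n = objects n" unfolding objects_def using assms(1) by blast
  show ?thesis
    unfolding multiset_sizes_law_def eq
    by (subst integral_distr_tilted[OF finite_objects \<phi> f scaled_sizes_in_space])
       (simp add: weighted_sum_def)
qed

lemma integral_selection_sizes_law: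
  assumes d: distinct_parts and f: "f \<in> borel_measurable (R_borel k)"
  shows "(\<integral>x. f x \<partial>selection_sizes_law U wt \<phi> k n) =
     weighted_sum (\<lambda>A. f (scaled_sizes k n (image_mset wt A))) n / partition_fun n"
proof -
  note bij = bij_betw_mset_set_objects[OF d, of n]
  have fin: "finite (selections_of_weight U wt n)"
    using bij_betw_finite[OF bij] finite_objects by blast
  have sum: "(\<Sum>S\<in>selections_of_weight U wt n. \<phi> ^ card S * h (mset_set S)) = weighted_sum h n" for h
    unfolding weighted_sum_def sum.reindex_bij_betw[OF bij, symmetric] by simp
  show ?thesis
    unfolding selection_sizes_law_def
    using integral_distr_tilted[OF fin \<phi> f, of "\<lambda>S. scaled_sizes k n (image_mset wt (mset_set S))" card]
      sum[of "\<lambda>A. f (scaled_sizes k n (image_mset wt A))"] sum[of "\<lambda>_. 1"] scaled_sizes_in_space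
    by simp
qed

end

theorem theorem5:
  fixes U :: "'a set" and wt :: "'a \<Rightarrow> nat" and m :: "nat \<Rightarrow> nat"
    and \<rho> \<theta> c \<phi> :: real and k :: nat
  assumes "\<And>u. u \<in> U \<Longrightarrow> wt u > 0"
    and "\<And>i. i \<ge> 1 \<Longrightarrow> finite {u \<in> U. wt u = i} \<and> card {u \<in> U. wt u = i} = m i"
    and "fps_conv_radius (irreducibles_fps m) = ereal \<rho>"
    and "\<rho> < 1"
    and "flajolet_soria (irreducibles_fps m) \<rho> \<theta> c"
    and "\<phi> > 0"
    and "k > 0"
  shows
    "(\<phi> < 1 / \<rho> \<longrightarrow>
       weakly_converges (R_top k) (multiset_sizes_law U wt \<phi> k) (PD_first k (\<phi> * \<theta>))
         (at_infinity_along (\<lambda>n. multisets_of_weight U wt n \<noteq> {}))) \<and>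
     weakly_converges (R_top k) (selection_sizes_law U wt \<phi> k) (PD_first k (\<phi> * \<theta>))
       (at_infinity_along (\<lambda>n. selections_of_weight U wt n \<noteq> {}))"
proof -
  \<comment> \<open>The assumptions of the locale do not mention \<open>distinct_parts\<close>, so
    its predicate has no such argument and one fact serves both interpretations.\<close>
  have irr: "irreducibles U wt \<phi>"
    using assms by unfold_locales auto
  have fps: "irreducibles_fps (irreducibles.mult U wt) = irreducibles_fps m"
    using assms(2) by (auto simp: irreducibles_fps_def irreducibles.mult_def[OF irr] fps_eq_iff)
  have fs: "flajolet_soria (irreducibles_fps (irreducibles.mult U wt)) \<rho> \<theta> c"
    unfolding fps by fact
  have "weakly_converges (R_top k) (multiset_sizes_law U wt \<phi> k) (PD_first k (\<phi> * \<theta>))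
      (at_infinity_along (\<lambda>n. multisets_of_weight U wt n \<noteq> {}))" if "\<phi> < 1 / \<rho>"
    unfolding weakly_converges_def
  proof (intro allI impI)
    interpret irreducibles U wt False \<phi> by (rule irr)
    have nf: "\<not> False" by simp
    fix f assume "continuous_map (R_top k) euclideanreal f \<and> bounded (f ` topspace (R_top k))"
    then have f: "continuous_map (R_top k) euclideanreal f" by blast
    have "(\<lambda>n. \<integral>x. f x \<partial>multiset_sizes_law U wt \<phi> k n) \<longlonglongrightarrow> (\<integral>x. f x \<partial>PD_first k (\<phi> * \<theta>))"
      unfolding integral_multiset_sizes_law[OF nf borel_measurable_R_top[OF f]]
      by (rule object_sizes_tendsto_PD[OF fs assms(4) that f])
    \<comment> \<open>Convergence along all n passes to the smaller filter of those n for which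
      objects exist.\<close>
    then show "((\<lambda>n. \<integral>x. f x \<partial>multiset_sizes_law U wt \<phi> k n) \<longlongrightarrow> (\<integral>x. f x \<partial>PD_first k (\<phi> * \<theta>)))
        (at_infinity_along (\<lambda>n. multisets_of_weight U wt n \<noteq> {}))"
      by (rule tendsto_mono[OF inf_le1])
  qed
  moreover have "weakly_converges (R_top k) (selection_sizes_law U wt \<phi> k) (PD_first k (\<phi> * \<theta>))
      (at_infinity_along (\<lambda>n. selections_of_weight U wt n \<noteq> {}))"
    unfolding weakly_converges_def
  proof (intro allI impI)
    interpret irreducibles U wt True \<phi> by (rule irr)
    fix f assume "continuous_map (R_top k) euclideanreal f \<and> bounded (f ` topspace (R_top k))"
    then have f: "continuous_map (R_top k) euclideanreal f" by blast
    have "(\<lambda>n. \<integral>x. f x \<partial>selection_sizes_law U wt \<phi> k n) \<longlonglongrightarrow> (\<integral>x. f x \<partial>PD_first k (\<phi> * \<theta>))"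
      unfolding integral_selection_sizes_law[OF TrueI borel_measurable_R_top[OF f]]
      by (rule object_sizes_tendsto_PD[OF fs assms(4) _ f]) simp
    then show "((\<lambda>n. \<integral>x. f x \<partial>selection_sizes_law U wt \<phi> k n) \<longlongrightarrow> (\<integral>x. f x \<partial>PD_first k (\<phi> * \<theta>)))
        (at_infinity_along (\<lambda>n. selections_of_weight U wt n \<noteq> {}))"
      by (rule tendsto_mono[OF inf_le1])
  qed
  ultimately show ?thesis by blast
qed

end
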